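(* For the quantum homogeneous space $\mathcal{O}_q(\mathrm{F}_3)\subseteq\mathcal{O}_q(\mathrm{SU}_3)$, a quantum principal bundle is given by the pair $(\mathcal{O}_q(\mathrm{SU}_3),\Omega^1_q(\mathrm{SU}_3))$.
   Context: For a quantum homogeneous space $B\subseteq A$ and a left $A$-covariant first-order differential calculus $\Omega^1(A)$ over $A$, the pair $(A,\Omega^1(A))$ is a quantum principal bundle if and only if $\Omega^1(A)$ is right $\pi_B(A)$-covariant, where $\pi_B:A\to\pi_B(A):=A/B^+A$ ($B^+=\ker\varepsilon|_B$) is the quotient map; that is, iff the coaction $\Delta_R:\Omega^1(A)\to\Omega^1(A)\otimes\pi_B(A)$, $a'\mathrm{d}a\mapsto a'_{(1)}\mathrm{d}a_{(1)}\otimes\pi_B(a'_{(2)}a_{(2)})$ is well defined. This may be taken as the definition here. Let $q\in\mathbb{R}\setminus\{-1,0,1\}$. Let $\Delta^+=\{\alpha_1,\alpha_2,\alpha_1+\alpha_2\}$ be the positive roots of $\mathfrak{sl}_3$, with Cartan matrix $a_{11}=a_{22}=2$, $a_{12}=a_{21}=-1$. $U_q(\mathfrak{sl}_3)$ is the complex algebra generated by $E_i,F_i,K_i^{\pm1}$ ($i=1,2$) with $K_iK_j=K_jK_i$, $K_iE_j=q^{a_{ij}}E_jK_i$, $K_iF_j=q^{-a_{ij}}F_jK_i$, $[E_i,F_j]=\delta_{ij}\frac{K_i-K_i^{-1}}{q-q^{-1}}$, and $E_i^2E_j-(q+q^{-1})E_iE_jE_i+E_jE_i^2=0$, $F_i^2F_j-(q+q^{-1})F_iF_jF_i+F_jF_i^2=0$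 for $i\ne j$. It is a Hopf $*$-algebra with $\Delta(E_i)=E_i\otimes K_i+1\otimes E_i$, $\Delta(F_i)=F_i\otimes1+K_i^{-1}\otimes F_i$, $\Delta(K_i)=K_i\otimes K_i$, $\varepsilon(E_i)=\varepsilon(F_i)=0$, $\varepsilon(K_i)=1$, $E_i^*=K_iF_i$, $F_i^*=E_iK_i^{-1}$, $K_i^*=K_i$. $A:=\mathcal{O}_q(\mathrm{SU}_3)$ is the Hopf subalgebra of the Hopf dual of $U_q(\mathfrak{sl}_3)$ generated by $u_{ij}$ ($1\le i,j\le3$), where $\Delta(u_{ij})=\sum_a u_{ia}\otimes u_{aj}$ and the only nonzero pairings of the $u_{ij}$ with the generators are $\langle E_1,u_{21}\rangle=\langle E_2,u_{32}\rangle=\langle F_1,u_{12}\rangle=\langle F_2,u_{23}\rangle=1$, $\langle K_i^{\pm1},u_{jj}\rangle=q^{\pm(\delta_{i,j-1}-\delta_{ij})}$. Put $X\triangleright a:=a_{(1)}\langle X,a_{(2)}\rangle$. Then $B:=\mathcal{O}_q(\mathrm{F}_3):=\{b\in A: K_i^{\pm1}\triangleright b=b,\ i=1,2\}$. Put $E_{\alpha_i}:=E_i$, $E_{\alpha_1+\alpha_2}:=E_2E_1-q^{-1}E_1E_2$, $F_\gamma:=E_\gamma^*$, and $T:=\mathrm{span}_{\mathbb{C}}\{E_\gamma,F_\gamma:\gamma\in\Delta^+\}$. $\Omega^1_q(\mathrm{SU}_3)=A\otimes\Lambda^1$ is the left $A$-covariant first-order differential calculus over $A$ with $\Lambda^1:=A^+/\{y\in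 A^+:X(y)=0\ \forall X\in T\}$ (where $A^+=\ker\varepsilon$), a right $A$-module with basis $\{e_\gamma,f_\gamma\}$ dual to $\{E_\gamma,F_\gamma\}$, bimodule structure $a(b\otimes v)c=abc_{(1)}\otimes vc_{(2)}$, and $\mathrm{d}a=\sum_\gamma (E_\gamma\triangleright a)\otimes e_\gamma+(F_\gamma\triangleright a)\otimes f_\gamma$. *)

theory Defs
  imports
    Complex_Main
    "HOL-Algebra.Module"
    "HOL-Algebra.QuotRing"
    "HOL-Library.Poly_Mapping"
    "HOL-Library.Product_Plus"
begin

section \<open>Complex vector spaces: span, quotient, tensor product\<close>

text \<open>
  Complex vector spaces are \<open>module\<close> records over the following ring. For plain
  vector spaces the inherited fields \<open>mult\<close> and \<open>one\<close> carry no meaning.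
\<close>

definition complex_field :: "complex ring" where
  "complex_field = \<lparr>carrier = UNIV, mult = (*), one = 1, zero = 0, add = (+)\<rparr>"

definition lin_span :: "(complex, 'v, 'm) module_scheme \<Rightarrow> 'v set \<Rightarrow> 'v set" where
  "lin_span M S = \<Inter>{H. submodule H complex_field M \<and> S \<subseteq> H}"

definition linear_map ::
  "(complex, 'v, 'm) module_scheme \<Rightarrow> (complex, 'w, 'n) module_scheme \<Rightarrow> ('v \<Rightarrow> 'w) \<Rightarrow> bool" where
  "linear_map M N \<phi> \<longleftrightarrow>
     \<phi> \<in> carrier M \<rightarrow> carrier N \<and>
     (\<forall>x\<in>carrier M. \<forall>y\<in>carrier M. \<phi> (x \<oplus>\<^bsub>M\<^esub> y) = \<phi> x \<oplus>\<^bsub>N\<^esub> \<phi> y) \<and>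
     (\<forall>c. \<forall>x\<in>carrier M. \<phi> (c \<odot>\<^bsub>M\<^esub> x) = c \<odot>\<^bsub>N\<^esub> \<phi> x)"

definition quot_space ::
  "(complex, 'v, 'm) module_scheme \<Rightarrow> 'v set \<Rightarrow> (complex, 'v set) module" where
  "quot_space M N =
     \<lparr>carrier = a_rcosets\<^bsub>M\<^esub> N, mult = undefined, one = undefined, zero = N, add = set_add M,
      smult = (\<lambda>c X. \<Union>x\<in>X. N +>\<^bsub>M\<^esub> (c \<odot>\<^bsub>M\<^esub> x))\<rparr>"

definition free_space :: "'x set \<Rightarrow> (complex, 'x \<Rightarrow>\<^sub>0 complex) module" where
  "free_space X =
     \<lparr>carrier = {p. Poly_Mapping.keys p \<subseteq> X}, mult = undefined, one = undefined, zero = 0,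
      add = (+), smult = (\<lambda>c. Poly_Mapping.map ((*) c))\<rparr>"

definition bilinear_relators ::
  "(complex, 'v, 'm) module_scheme \<Rightarrow> (complex, 'w, 'n) module_scheme \<Rightarrow>
   ('v \<times> 'w \<Rightarrow>\<^sub>0 complex) set" where
  "bilinear_relators M N =
     {Poly_Mapping.single (x \<oplus>\<^bsub>M\<^esub> x', y) 1 - Poly_Mapping.single (x, y) 1
        - Poly_Mapping.single (x', y) 1 |
        x x' y. x \<in> carrier M \<and> x' \<in> carrier M \<and> y \<in> carrier N} \<union>
     {Poly_Mapping.single (x, y \<oplus>\<^bsub>N\<^esub> y') 1 - Poly_Mapping.single (x, y) 1
        - Poly_Mapping.single (x, y') 1 |
        x y y'. x \<in> carrier M \<and> y \<in> carrier N \<and> y' \<in> carrier N} \<union>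
     {Poly_Mapping.single (c \<odot>\<^bsub>M\<^esub> x, y) 1 - Poly_Mapping.single (x, y) c |
        c x y. x \<in> carrier M \<and> y \<in> carrier N} \<union>
     {Poly_Mapping.single (x, c \<odot>\<^bsub>N\<^esub> y) 1 - Poly_Mapping.single (x, y) c |
        c x y. x \<in> carrier M \<and> y \<in> carrier N}"

definition tensor_null ::
  "(complex, 'v, 'm) module_scheme \<Rightarrow> (complex, 'w, 'n) module_scheme \<Rightarrow>
   ('v \<times> 'w \<Rightarrow>\<^sub>0 complex) set" where
  "tensor_null M N = lin_span (free_space (carrier M \<times> carrier N)) (bilinear_relators M N)"

definition tensor ::
  "(complex, 'v, 'm) module_scheme \<Rightarrow> (complex, 'w, 'n) module_scheme \<Rightarrow>
   (complex, ('v \<times> 'w \<Rightarrow>\<^sub>0 complex) set) module" where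
  "tensor M N = quot_space (free_space (carrier M \<times> carrier N)) (tensor_null M N)"

definition ptensor ::
  "(complex, 'v, 'm) module_scheme \<Rightarrow> (complex, 'w, 'n) module_scheme \<Rightarrow>
   'v \<Rightarrow> 'w \<Rightarrow> ('v \<times> 'w \<Rightarrow>\<^sub>0 complex) set" where
  "ptensor M N x y =
     tensor_null M N +>\<^bsub>free_space (carrier M \<times> carrier N)\<^esub> Poly_Mapping.single (x, y) 1"

text \<open>
  The map out of a tensor product that is induced by \<open>\<beta>\<close>; for bilinear \<open>\<beta>\<close> the value
  does not depend on the chosen representative \<open>p\<close> of the coset \<open>t\<close>.
\<close>

definition tensor_lift ::
  "(complex, 'u, 'k) module_scheme \<Rightarrow> ('v \<Rightarrow> 'w \<Rightarrow> 'u) \<Rightarrow> ('v \<times> 'w \<Rightarrow>\<^sub>0 complex) set \<Rightarrow> 'u" where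
  "tensor_lift P \<beta> t =
     (let p = (SOME p. p \<in> t) in
      \<Oplus>\<^bsub>P\<^esub>k\<in>Poly_Mapping.keys p. Poly_Mapping.lookup p k \<odot>\<^bsub>P\<^esub> \<beta> (fst k) (snd k))"


section \<open>The free algebra on the generators\<close>

datatype node = N1 | N2

fun node_index :: "node \<Rightarrow> nat" where
  "node_index N1 = 1"
| "node_index N2 = 2"

definition cartan :: "node \<Rightarrow> node \<Rightarrow> int" where
  "cartan i j = (if i = j then 2 else -1)"

text \<open>\<open>GKi i\<close> is the generator that becomes the inverse of \<open>GK i\<close>.\<close>

datatype qgen = GE node | GF node | GK node | GKi node

datatype word = Word (letters: "qgen list")

instantiation word :: monoid_add
begin

definition zero_word :: word where "0 = Word []"

definition plus_word :: "word \<Rightarrow> word \<Rightarrow> word" where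
  "v + w = Word (letters v @ letters w)"

instance
  by standard (simp_all add: zero_word_def plus_word_def)

end

text \<open>
  The free complex algebra is the monoid algebra of words, with the convolution product of
  \<^typ>\<open>word \<Rightarrow>\<^sub>0 complex\<close>. Its tensor square is the monoid algebra of pairs of words.
\<close>

type_synonym free_alg = "word \<Rightarrow>\<^sub>0 complex"
type_synonym free_alg2 = "word \<times> word \<Rightarrow>\<^sub>0 complex"
type_synonym functional = "free_alg \<Rightarrow> complex"

definition scal :: "complex \<Rightarrow> ('k::monoid_add) \<Rightarrow>\<^sub>0 complex" where
  "scal c = Poly_Mapping.single 0 c"

definition gen :: "qgen \<Rightarrow> free_alg" where
  "gen g = Poly_Mapping.single (Word [g]) 1"

abbreviation E :: "node \<Rightarrow> free_alg" where "E i \<equiv> gen (GE i)"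
abbreviation F :: "node \<Rightarrow> free_alg" where "F i \<equiv> gen (GF i)"
abbreviation K :: "node \<Rightarrow> free_alg" where "K i \<equiv> gen (GK i)"
abbreviation Kinv :: "node \<Rightarrow> free_alg" where "Kinv i \<equiv> gen (GKi i)"

definition free_algebra :: "(complex, free_alg) module" where
  "free_algebra =
     \<lparr>carrier = UNIV, mult = (*), one = 1, zero = 0, add = (+), smult = (\<lambda>c x. scal c * x)\<rparr>"

definition comult_gen :: "qgen \<Rightarrow> free_alg2" where
  "comult_gen g = (case g of
     GE i \<Rightarrow> Poly_Mapping.single (Word [GE i], Word [GK i]) 1 + Poly_Mapping.single (0, Word [GE i]) 1
   | GF i \<Rightarrow> Poly_Mapping.single (Word [GF i], 0) 1 + Poly_Mapping.single (Word [GKi i], Word [GF i]) 1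
   | GK i \<Rightarrow> Poly_Mapping.single (Word [GK i], Word [GK i]) 1
   | GKi i \<Rightarrow> Poly_Mapping.single (Word [GKi i], Word [GKi i]) 1)"

definition comult :: "free_alg \<Rightarrow> free_alg2" where
  "comult x = (\<Sum>w\<in>Poly_Mapping.keys x.
     scal (Poly_Mapping.lookup x w) * prod_list (map comult_gen (letters w)))"

fun counit_gen :: "qgen \<Rightarrow> complex" where
  "counit_gen (GE i) = 0"
| "counit_gen (GF i) = 0"
| "counit_gen (GK i) = 1"
| "counit_gen (GKi i) = 1"

definition counit :: functional where
  "counit x = (\<Sum>w\<in>Poly_Mapping.keys x.
     Poly_Mapping.lookup x w * prod_list (map counit_gen (letters w)))"

text \<open>The values on generators are forced by the antipode axiom for \<^const>\<open>comult_gen\<close>.\<close>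

fun antipode_gen :: "qgen \<Rightarrow> free_alg" where
  "antipode_gen (GE i) = - (E i * Kinv i)"
| "antipode_gen (GF i) = - (K i * F i)"
| "antipode_gen (GK i) = Kinv i"
| "antipode_gen (GKi i) = K i"

definition antipode :: "free_alg \<Rightarrow> free_alg" where
  "antipode x = (\<Sum>w\<in>Poly_Mapping.keys x.
     scal (Poly_Mapping.lookup x w) * prod_list (map antipode_gen (rev (letters w))))"

fun star_gen :: "qgen \<Rightarrow> free_alg" where
  "star_gen (GE i) = K i * F i"
| "star_gen (GF i) = E i * Kinv i"
| "star_gen (GK i) = K i"
| "star_gen (GKi i) = Kinv i"

definition star :: "free_alg \<Rightarrow> free_alg" where
  "star x = (\<Sum>w\<in>Poly_Mapping.keys x.
     scal (cnj (Poly_Mapping.lookup x w)) * prod_list (map star_gen (rev (letters w))))"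


section \<open>Quantized enveloping algebra and its Hopf dual\<close>

text \<open>
  \<open>U\<^sub>q(sl\<^sub>3)\<close> is the free algebra modulo \<open>uq_ideal q\<close>. The structure maps above descend to it.
\<close>

definition uq_relators :: "real \<Rightarrow> free_alg set" where
  "uq_relators q = (let s = (\<lambda>k::int. scal (complex_of_real q powi k)) in
     {K i * K j - K j * K i | i j. True} \<union>
     {K i * Kinv i - 1 | i. True} \<union>
     {Kinv i * K i - 1 | i. True} \<union>
     {K i * E j - s (cartan i j) * E j * K i | i j. True} \<union>
     {K i * F j - s (- cartan i j) * F j * K i | i j. True} \<union>
     {E i * F j - F j * E i
        - (if i = j then scal (1 / (complex_of_real q - 1 / complex_of_real q)) * (K i - Kinv i) else 0)
        | i j. True} \<union>
     {E i * E i * E j - (s 1 + s (-1)) * E i * E j * E i + E j * E i * E i | i j. i \<noteq> j} \<union>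
     {F i * F i * F j - (s 1 + s (-1)) * F i * F j * F i + F j * F i * F i | i j. i \<noteq> j})"

definition uq_ideal :: "real \<Rightarrow> free_alg set" where
  "uq_ideal q = Idl\<^bsub>free_algebra\<^esub> (uq_relators q)"

text \<open>
  Linear functionals on \<open>U\<^sub>q(sl\<^sub>3)\<close> are the linear functionals on the free algebra that
  vanish on the ideal; the pairing \<open>\<langle>X, a\<rangle>\<close> is \<open>a X\<close>.
\<close>

definition uq_dual :: "real \<Rightarrow> functional set" where
  "uq_dual q = {a. (\<forall>x y. a (x + y) = a x + a y) \<and> (\<forall>c x. a (scal c * x) = c * a x) \<and>
                   (\<forall>x\<in>uq_ideal q. a x = 0)}"

text \<open>The convolution product: \<open>\<langle>X, a b\<rangle> = \<langle>X\<^sub>(\<^sub>1\<^sub>), a\<rangle> \<langle>X\<^sub>(\<^sub>2\<^sub>), b\<rangle>\<close>.\<close>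

definition conv :: "functional \<Rightarrow> functional \<Rightarrow> functional" where
  "conv a b x = (\<Sum>k\<in>Poly_Mapping.keys (comult x).
     Poly_Mapping.lookup (comult x) k *
     a (Poly_Mapping.single (fst k) 1) * b (Poly_Mapping.single (snd k) 1))"

definition uq_dual_algebra :: "real \<Rightarrow> (complex, functional) module" where
  "uq_dual_algebra q =
     \<lparr>carrier = uq_dual q, mult = conv, one = counit, zero = (\<lambda>x. 0),
      add = (\<lambda>a b x. a x + b x), smult = (\<lambda>c a x. c * a x)\<rparr>"

text \<open>
  The coproduct of a functional is dual to the product: \<open>coprod_decomp H a n f g\<close> says
  \<open>\<Delta>(a) = \<Sum>i<n. f i \<otimes> g i\<close> with all \<open>f i\<close>, \<open>g i\<close> in \<open>H\<close>.
\<close>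

definition coprod_decomp ::
  "functional set \<Rightarrow> functional \<Rightarrow> nat \<Rightarrow> (nat \<Rightarrow> functional) \<Rightarrow> (nat \<Rightarrow> functional) \<Rightarrow> bool" where
  "coprod_decomp H a n f g \<longleftrightarrow>
     (\<forall>i<n. f i \<in> H \<and> g i \<in> H) \<and> (\<forall>X Y. a (X * Y) = (\<Sum>i<n. f i X * g i Y))"

definition hopf_dual :: "real \<Rightarrow> functional set" where
  "hopf_dual q = {a \<in> uq_dual q. \<exists>n f g. coprod_decomp (uq_dual q) a n f g}"

definition hopf_subalgebra :: "real \<Rightarrow> functional set \<Rightarrow> bool" where
  "hopf_subalgebra q H \<longleftrightarrow>
     H \<subseteq> hopf_dual q \<and>
     submodule H complex_field (uq_dual_algebra q) \<and>
     counit \<in> H \<and>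
     (\<forall>a\<in>H. \<forall>b\<in>H. conv a b \<in> H) \<and>
     (\<forall>a\<in>H. \<exists>n f g. coprod_decomp H a n f g) \<and>
     (\<forall>a\<in>H. a \<circ> antipode \<in> H)"


section \<open>Quantum SU(3) and the quantum full flag manifold\<close>

fun gen_matrix :: "real \<Rightarrow> qgen \<Rightarrow> nat \<Rightarrow> nat \<Rightarrow> complex" where
  "gen_matrix q (GE i) r c = (if r = node_index i + 1 \<and> c = node_index i then 1 else 0)"
| "gen_matrix q (GF i) r c = (if r = node_index i \<and> c = node_index i + 1 then 1 else 0)"
| "gen_matrix q (GK i) r c =
     (if r = c then complex_of_real q powi
        (of_bool (node_index i + 1 = r) - of_bool (node_index i = r)) else 0)"
| "gen_matrix q (GKi i) r c =
     (if r = c then complex_of_real q powi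
        (- (of_bool (node_index i + 1 = r) - of_bool (node_index i = r))) else 0)"

fun word_matrix :: "real \<Rightarrow> qgen list \<Rightarrow> nat \<Rightarrow> nat \<Rightarrow> complex" where
  "word_matrix q [] r c = (if r = c then 1 else 0)"
| "word_matrix q (g # gs) r c = (\<Sum>a\<in>{1..3}. gen_matrix q g r a * word_matrix q gs a c)"

text \<open>
  The pairing with words is determined by the pairing with generators, since
  \<open>\<Delta>(u\<^sub>i\<^sub>j) = \<Sum>a. u\<^sub>i\<^sub>a \<otimes> u\<^sub>a\<^sub>j\<close>.
\<close>

definition u :: "real \<Rightarrow> nat \<Rightarrow> nat \<Rightarrow> functional" where
  "u q i j x = (\<Sum>w\<in>Poly_Mapping.keys x.
     Poly_Mapping.lookup x w * word_matrix q (letters w) i j)"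

definition Oq_SU3 :: "real \<Rightarrow> functional set" where
  "Oq_SU3 q = \<Inter>{H. hopf_subalgebra q H \<and> (\<forall>i\<in>{1..3}. \<forall>j\<in>{1..3}. u q i j \<in> H)}"

definition Oq_SU3_algebra :: "real \<Rightarrow> (complex, functional) module" where
  "Oq_SU3_algebra q = (uq_dual_algebra q)\<lparr>carrier := Oq_SU3 q\<rparr>"

text \<open>
  \<open>act X a = a\<^sub>(\<^sub>1\<^sub>) \<langle>X, a\<^sub>(\<^sub>2\<^sub>)\<rangle>\<close>, because \<open>\<langle>Y, a\<^sub>(\<^sub>1\<^sub>)\<rangle> \<langle>X, a\<^sub>(\<^sub>2\<^sub>)\<rangle> = \<langle>Y X, a\<rangle>\<close>.
\<close>

definition act :: "free_alg \<Rightarrow> functional \<Rightarrow> functional" where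
  "act X a = (\<lambda>Y. a (Y * X))"

definition Oq_F3 :: "real \<Rightarrow> functional set" where
  "Oq_F3 q = {b \<in> Oq_SU3 q. \<forall>i. act (K i) b = b \<and> act (Kinv i) b = b}"


section \<open>Quantum principal bundles over quantum homogeneous spaces\<close>

text \<open>
  The Hopf algebra \<open>A\<close> consists of functionals as above, with counit \<open>a \<mapsto> a 1\<close> and coproduct
  given by \<^const>\<open>coprod_decomp\<close>.
\<close>

definition aug_ideal :: "(complex, functional) module \<Rightarrow> functional set \<Rightarrow> functional set" where
  "aug_ideal A B = lin_span A {b \<otimes>\<^bsub>A\<^esub> a | b a. b \<in> B \<and> b 1 = 0 \<and> a \<in> carrier A}"

definition qhs_quot ::
  "(complex, functional) module \<Rightarrow> functional set \<Rightarrow> (complex, functional set) module" where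
  "qhs_quot A B = quot_space A (aug_ideal A B)"

definition qhs_proj ::
  "(complex, functional) module \<Rightarrow> functional set \<Rightarrow> functional \<Rightarrow> functional set" where
  "qhs_proj A B a = aug_ideal A B +>\<^bsub>A\<^esub> a"

record ('a, 'w) calculus =
  forms :: "(complex, 'w) module"
  lact :: "'a \<Rightarrow> 'w \<Rightarrow> 'w"
  ract :: "'w \<Rightarrow> 'a \<Rightarrow> 'w"
  diff :: "'a \<Rightarrow> 'w"

text \<open>
  Right covariance: \<open>a' da \<mapsto> a'\<^sub>(\<^sub>1\<^sub>) da\<^sub>(\<^sub>1\<^sub>) \<otimes> \<pi>(a'\<^sub>(\<^sub>2\<^sub>) a\<^sub>(\<^sub>2\<^sub>))\<close> is a well-defined linear map.
\<close>

definition right_covariant ::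
  "(complex, functional) module \<Rightarrow> functional set \<Rightarrow> (functional, 'w) calculus \<Rightarrow> bool" where
  "right_covariant A B \<Gamma> \<longleftrightarrow>
    (let \<Omega> = forms \<Gamma>; P = qhs_quot A B; \<Omega>P = tensor \<Omega> P in
     \<exists>\<Phi>. linear_map \<Omega> \<Omega>P \<Phi> \<and>
       (\<forall>a'\<in>carrier A. \<forall>a\<in>carrier A. \<forall>n f g m h k.
          coprod_decomp (carrier A) a' n f g \<longrightarrow> coprod_decomp (carrier A) a m h k \<longrightarrow>
          \<Phi> (lact \<Gamma> a' (diff \<Gamma> a)) =
            (\<Oplus>\<^bsub>\<Omega>P\<^esub>i\<in>{..<n}. \<Oplus>\<^bsub>\<Omega>P\<^esub>j\<in>{..<m}.
               ptensor \<Omega> P (lact \<Gamma> (f i) (diff \<Gamma> (h j))) (qhs_proj A B (g i \<otimes>\<^bsub>A\<^esub> k j)))))"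

text \<open>
  Over a quantum homogeneous space, a left covariant calculus gives a quantum principal bundle
  if and only if it is right covariant; this criterion is taken as the definition.
\<close>

definition quantum_principal_bundle ::
  "(complex, functional) module \<Rightarrow> functional set \<Rightarrow> (functional, 'w) calculus \<Rightarrow> bool" where
  "quantum_principal_bundle A B \<Gamma> \<longleftrightarrow> right_covariant A B \<Gamma>"


section \<open>The calculus on quantum SU(3)\<close>

text \<open>\<open>A12\<close> is \<open>\<alpha>\<^sub>1 + \<alpha>\<^sub>2\<close>.\<close>

datatype posroot = A1 | A2 | A12

fun Epos :: "real \<Rightarrow> posroot \<Rightarrow> free_alg" where
  "Epos q A1 = E N1"
| "Epos q A2 = E N2"
| "Epos q A12 = E N2 * E N1 - scal (1 / complex_of_real q) * E N1 * E N2"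

definition Fpos :: "real \<Rightarrow> posroot \<Rightarrow> free_alg" where
  "Fpos q \<gamma> = star (Epos q \<gamma>)"

definition tangent_space :: "real \<Rightarrow> free_alg set" where
  "tangent_space q = lin_span free_algebra (range (Epos q) \<union> range (Fpos q))"

definition Oq_SU3_plus :: "real \<Rightarrow> functional set" where
  "Oq_SU3_plus q = {y \<in> Oq_SU3 q. y 1 = 0}"

definition Lambda1_null :: "real \<Rightarrow> functional set" where
  "Lambda1_null q = {y \<in> Oq_SU3_plus q. \<forall>X\<in>tangent_space q. y X = 0}"

definition Lambda1 :: "real \<Rightarrow> (complex, functional set) module" where
  "Lambda1 q = quot_space ((Oq_SU3_algebra q)\<lparr>carrier := Oq_SU3_plus q\<rparr>) (Lambda1_null q)"

definition Lambda1_ract :: "real \<Rightarrow> functional set \<Rightarrow> functional \<Rightarrow> functional set" where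
  "Lambda1_ract q v c = (\<Union>y\<in>v. Lambda1_null q +>\<^bsub>Oq_SU3_algebra q\<^esub> conv y c)"

text \<open>The basis of \<^const>\<open>Lambda1\<close> dual to \<^const>\<open>Epos\<close>, \<^const>\<open>Fpos\<close>.\<close>

definition e_form :: "real \<Rightarrow> posroot \<Rightarrow> functional set" where
  "e_form q \<gamma> = (THE v. v \<in> carrier (Lambda1 q) \<and>
     (\<forall>y\<in>v. \<forall>\<delta>. y (Epos q \<delta>) = (if \<delta> = \<gamma> then 1 else 0) \<and> y (Fpos q \<delta>) = 0))"

definition f_form :: "real \<Rightarrow> posroot \<Rightarrow> functional set" where
  "f_form q \<gamma> = (THE v. v \<in> carrier (Lambda1 q) \<and>
     (\<forall>y\<in>v. \<forall>\<delta>. y (Epos q \<delta>) = 0 \<and> y (Fpos q \<delta>) = (if \<delta> = \<gamma> then 1 else 0)))"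

type_synonym su3_form = "(functional \<times> functional set \<Rightarrow>\<^sub>0 complex) set"

definition Omega1_space :: "real \<Rightarrow> (complex, su3_form) module" where
  "Omega1_space q = tensor (Oq_SU3_algebra q) (Lambda1 q)"

abbreviation form_tensor :: "real \<Rightarrow> functional \<Rightarrow> functional set \<Rightarrow> su3_form" where
  "form_tensor q \<equiv> ptensor (Oq_SU3_algebra q) (Lambda1 q)"

definition Omega1_lact :: "real \<Rightarrow> functional \<Rightarrow> su3_form \<Rightarrow> su3_form" where
  "Omega1_lact q a = tensor_lift (Omega1_space q) (\<lambda>b v. form_tensor q (conv a b) v)"

text \<open>
  \<open>(b \<otimes> v) c = b c\<^sub>(\<^sub>1\<^sub>) \<otimes> v c\<^sub>(\<^sub>2\<^sub>)\<close>, independently of the decomposition of the coproduct of \<open>c\<close>.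
\<close>

definition Omega1_ract :: "real \<Rightarrow> su3_form \<Rightarrow> functional \<Rightarrow> su3_form" where
  "Omega1_ract q \<omega> c = (SOME \<eta>. \<exists>n f g. coprod_decomp (Oq_SU3 q) c n f g \<and>
     \<eta> = tensor_lift (Omega1_space q)
           (\<lambda>b v. \<Oplus>\<^bsub>Omega1_space q\<^esub>i\<in>{..<n}. form_tensor q (conv b (f i)) (Lambda1_ract q v (g i))) \<omega>)"

definition Omega1_diff :: "real \<Rightarrow> functional \<Rightarrow> su3_form" where
  "Omega1_diff q a = (\<Oplus>\<^bsub>Omega1_space q\<^esub>\<gamma>\<in>UNIV.
     form_tensor q (act (Epos q \<gamma>) a) (e_form q \<gamma>) \<oplus>\<^bsub>Omega1_space q\<^esub>
     form_tensor q (act (Fpos q \<gamma>) a) (f_form q \<gamma>))"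

definition Omega1_q_SU3 :: "real \<Rightarrow> (functional, su3_form) calculus" where
  "Omega1_q_SU3 q =
     \<lparr>forms = Omega1_space q, lact = Omega1_lact q, ract = Omega1_ract q, diff = Omega1_diff q\<rparr>"

end

theory Submission
  imports Defs
begin

text \<open>
  The algebra \<open>A\<close> is spanned by products of iterated antipodes of the \<open>u\<^sub>i\<^sub>j\<close>, hence by weight vectors
  for the action of the \<open>K\<^sub>i\<close>. If \<open>f\<close> and \<open>w\<close> have the same right weight, \<open>w\<close> also has this
  weight from the left and \<open>\<epsilon>(w) = 1\<close>, then \<open>f = f S(w\<^sub>(\<^sub>1\<^sub>)) w\<^sub>(\<^sub>2\<^sub>)\<close> with \<open>f S(w\<^sub>(\<^sub>1\<^sub>)) \<in> B\<close>, so that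
  \<open>\<pi>(f) = \<epsilon>(f) \<pi>(w)\<close>. By independence of characters, \<open>\<pi>\<close> therefore kills everything that vanishes
  on the torus generated by the \<open>K\<^sub>i\<close>. A tangent vector \<open>X\<close> commutes with the \<open>K\<^sub>i\<close> up to a
  character \<open>\<gamma>\<close>; if \<open>w\<close> restricts to \<open>\<gamma>\<^sup>-\<^sup>1\<close> on the torus, then
  \<open>b \<otimes> e\<^sub>X \<mapsto> b\<^sub>(\<^sub>1\<^sub>) \<otimes> e\<^sub>X \<otimes> \<pi>(b\<^sub>(\<^sub>2\<^sub>) w)\<close> is the required coaction, because both sides only depend on
  the restriction of the last leg to the torus.
\<close>

section \<open>Complex vector spaces\<close>

text \<open>The coaction is prescribed on the elements \<open>a' da\<close>, between which there are
  linear relations, so the formula itself does not show that it is well defined. Hence the map is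
  built on the tensor product of A with \<open>Lambda1\<close>, where linearity comes from the
  universal property, and the prescribed formula is verified afterwards. The obstacle is that A is
  given as an intersection of Hopf subalgebras: it comes without a basis, and coproducts come as
  arbitrary finite decompositions. Elements are therefore reached by induction on how they are
  generated, with the antipode as one of the operations; since it exchanges left and right weights,
  both are carried along. Decompositions are compared through their values on words instead of as
  tensors. The twist by \<open>w\<close> comes from the order of factors: at a word s followed by a
  torus element K, the functional X \<triangleright> a has the value a(s K X), while the coaction
  formula asks for a(s X K). The two differ by the character of X, which the extra factor
  cancels.\<close>

lemma complex_field_simps [simp]:
  "carrier complex_field = UNIV" "mult complex_field = (*)" "one complex_field = 1"
  "zero complex_field = 0" "add complex_field = (+)"
  by (simp_all add: complex_field_def)

lemma cring_complex_field: "cring complex_field"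
proof -
  have "\<exists>y. y + x = 0" for x :: complex
    by (rule exI[of _ "- x"]) simp
  then show ?thesis
    by (intro cringI abelian_groupI comm_monoidI) (auto simp: algebra_simps)
qed

abbreviation cspace :: "(complex, 'v, 'm) module_scheme \<Rightarrow> bool" where
  "cspace \<equiv> module complex_field"

abbreviation csubspace :: "'v set \<Rightarrow> (complex, 'v, 'm) module_scheme \<Rightarrow> bool" where
  "csubspace N M \<equiv> submodule N complex_field M"

lemma cspaceI:
  fixes M (structure)
  assumes "abelian_group M"
    and "\<And>c x. x \<in> carrier M \<Longrightarrow> c \<odot> x \<in> carrier M"
    and "\<And>c d x. x \<in> carrier M \<Longrightarrow> (c + d) \<odot> x = c \<odot> x \<oplus> d \<odot> x"
    and "\<And>c x y. x \<in> carrier M \<Longrightarrow> y \<in> carrier M \<Longrightarrow> c \<odot> (x \<oplus> y) = c \<odot> x \<oplus> c \<odot> y"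
    and "\<And>c d x. x \<in> carrier M \<Longrightarrow> (c * d) \<odot> x = c \<odot> (d \<odot> x)"
    and "\<And>x. x \<in> carrier M \<Longrightarrow> 1 \<odot> x = x"
  shows "cspace M"
  using assms by (intro moduleI cring_complex_field) auto

lemma cspaceD:
  assumes "cspace M" "x \<in> carrier M"
  shows "c \<odot>\<^bsub>M\<^esub> x \<in> carrier M" "(c + d) \<odot>\<^bsub>M\<^esub> x = c \<odot>\<^bsub>M\<^esub> x \<oplus>\<^bsub>M\<^esub> d \<odot>\<^bsub>M\<^esub> x"
    "y \<in> carrier M \<Longrightarrow> c \<odot>\<^bsub>M\<^esub> (x \<oplus>\<^bsub>M\<^esub> y) = c \<odot>\<^bsub>M\<^esub> x \<oplus>\<^bsub>M\<^esub> c \<odot>\<^bsub>M\<^esub> y"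
    "(c * d) \<odot>\<^bsub>M\<^esub> x = c \<odot>\<^bsub>M\<^esub> (d \<odot>\<^bsub>M\<^esub> x)" "1 \<odot>\<^bsub>M\<^esub> x = x" "0 \<odot>\<^bsub>M\<^esub> x = \<zero>\<^bsub>M\<^esub>"
proof -
  interpret module complex_field M by fact
  show "c \<odot>\<^bsub>M\<^esub> x \<in> carrier M" "1 \<odot>\<^bsub>M\<^esub> x = x"
    using smult_closed[of c x] smult_one[of x] assms(2) by auto
  show "(c + d) \<odot>\<^bsub>M\<^esub> x = c \<odot>\<^bsub>M\<^esub> x \<oplus>\<^bsub>M\<^esub> d \<odot>\<^bsub>M\<^esub> x" "(c * d) \<odot>\<^bsub>M\<^esub> x = c \<odot>\<^bsub>M\<^esub> (d \<odot>\<^bsub>M\<^esub> x)"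
    "0 \<odot>\<^bsub>M\<^esub> x = \<zero>\<^bsub>M\<^esub>"
    using smult_l_distr[of c d x] smult_assoc1[of c d x] smult_l_null[of x] assms(2) by auto
  show "c \<odot>\<^bsub>M\<^esub> (x \<oplus>\<^bsub>M\<^esub> y) = c \<odot>\<^bsub>M\<^esub> x \<oplus>\<^bsub>M\<^esub> c \<odot>\<^bsub>M\<^esub> y" if "y \<in> carrier M"
    using smult_r_distr[of c x y] assms(2) that by auto
qed

context module begin

lemma abelian_group_M: "abelian_group M"
  by (rule M.abelian_group_axioms)

end

text \<open>Negatives become scalar multiples, so a set closed under addition and scalars is a
  subspace, and differences can be treated by linearity.\<close>

lemma cspace_minus:
  assumes "cspace M" "x \<in> carrier M"
  shows "\<ominus>\<^bsub>M\<^esub> x = (- 1) \<odot>\<^bsub>M\<^esub> x"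
proof -
  interpret module complex_field M by fact
  have "x \<oplus>\<^bsub>M\<^esub> (- 1) \<odot>\<^bsub>M\<^esub> x = (1 + (- 1)) \<odot>\<^bsub>M\<^esub> x"
    using smult_l_distr[of 1 "- 1" x] smult_one[of x] assms by simp
  also have "\<dots> = \<zero>\<^bsub>M\<^esub>" using assms smult_l_null[of x] by simp
  finally show ?thesis
    using assms smult_closed[of "- 1" x] by (metis UNIV_I complex_field_simps(1) M.add.inv_comm M.minus_equality)
qed

lemma csubspaceI:
  assumes "cspace M" "N \<subseteq> carrier M" "\<zero>\<^bsub>M\<^esub> \<in> N"
    and "\<And>x y. x \<in> N \<Longrightarrow> y \<in> N \<Longrightarrow> x \<oplus>\<^bsub>M\<^esub> y \<in> N"
    and "\<And>c x. x \<in> N \<Longrightarrow> c \<odot>\<^bsub>M\<^esub> x \<in> N"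
  shows "csubspace N M"
  using assms by (intro module.submoduleI) (auto simp: cspace_minus subset_iff)

lemma csubspaceD:
  assumes "cspace M" "csubspace N M"
  shows "N \<subseteq> carrier M" "\<zero>\<^bsub>M\<^esub> \<in> N" "x \<in> N \<Longrightarrow> y \<in> N \<Longrightarrow> x \<oplus>\<^bsub>M\<^esub> y \<in> N"
    "x \<in> N \<Longrightarrow> c \<odot>\<^bsub>M\<^esub> x \<in> N" "x \<in> N \<Longrightarrow> \<ominus>\<^bsub>M\<^esub> x \<in> N"
proof -
  interpret module complex_field M by fact
  show "N \<subseteq> carrier M" "x \<in> N \<Longrightarrow> y \<in> N \<Longrightarrow> x \<oplus>\<^bsub>M\<^esub> y \<in> N" "x \<in> N \<Longrightarrow> \<ominus>\<^bsub>M\<^esub> x \<in> N"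
    "x \<in> N \<Longrightarrow> c \<odot>\<^bsub>M\<^esub> x \<in> N"
    using submoduleE[OF assms(2)] by auto
  show "\<zero>\<^bsub>M\<^esub> \<in> N"
    using subgroup.one_closed[OF submodule.axioms(1)[OF assms(2)]] by simp
qed

lemma csubspace_Inter:
  assumes "cspace M" "\<And>H. H \<in> \<H> \<Longrightarrow> csubspace H M" "\<H> \<noteq> {}"
  shows "csubspace (\<Inter>\<H>) M"
proof (intro csubspaceI[OF assms(1)])
  show "\<Inter>\<H> \<subseteq> carrier M"
    using csubspaceD(1)[OF assms(1) assms(2)] assms(3) by blast
qed (auto intro: csubspaceD[OF assms(1) assms(2)])

lemma csubspace_lin_span:
  assumes "cspace M" "S \<subseteq> carrier M"
  shows "csubspace (lin_span M S) M"
  unfolding lin_span_def using assms module.carrier_is_submodule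
  by (intro csubspace_Inter) blast+

lemma lin_span_superset: "S \<subseteq> lin_span M S"
  by (auto simp: lin_span_def)

lemma lin_span_least: "csubspace H M \<Longrightarrow> S \<subseteq> H \<Longrightarrow> lin_span M S \<subseteq> H"
  by (auto simp: lin_span_def)

lemma cspace_subspace: "cspace M \<Longrightarrow> csubspace N M \<Longrightarrow> cspace (M\<lparr>carrier := N\<rparr>)"
  by (rule submodule.submodule_is_module)

lemma linear_mapD:
  assumes "linear_map M N \<phi>" "x \<in> carrier M"
  shows "\<phi> x \<in> carrier N" "y \<in> carrier M \<Longrightarrow> \<phi> (x \<oplus>\<^bsub>M\<^esub> y) = \<phi> x \<oplus>\<^bsub>N\<^esub> \<phi> y"
    "\<phi> (c \<odot>\<^bsub>M\<^esub> x) = c \<odot>\<^bsub>N\<^esub> \<phi> x"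
  using assms by (auto simp: linear_map_def)

lemma linear_map_zero:
  assumes "cspace M" "cspace N" "linear_map M N \<phi>"
  shows "\<phi> \<zero>\<^bsub>M\<^esub> = \<zero>\<^bsub>N\<^esub>"
proof -
  interpret M: module complex_field M by fact
  interpret N: module complex_field N by fact
  have "\<phi> (0 \<odot>\<^bsub>M\<^esub> \<zero>\<^bsub>M\<^esub>) = 0 \<odot>\<^bsub>N\<^esub> \<phi> \<zero>\<^bsub>M\<^esub>"
    using assms(3) by (intro linear_mapD(3)) auto
  then show ?thesis
    using M.smult_l_null[of "\<zero>\<^bsub>M\<^esub>"] N.smult_l_null[of "\<phi> \<zero>\<^bsub>M\<^esub>"] linear_mapD(1)[OF assms(3)] by simp
qed

lemma linear_map_finsum:
  assumes "cspace M" "cspace N" "linear_map M N \<phi>" "f \<in> I \<rightarrow> carrier M"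
  shows "\<phi> (\<Oplus>\<^bsub>M\<^esub>i\<in>I. f i) = (\<Oplus>\<^bsub>N\<^esub>i\<in>I. \<phi> (f i))"
proof -
  interpret M: module complex_field M by fact
  interpret N: module complex_field N by fact
  show ?thesis
    using assms(4)
  proof (induction I rule: infinite_finite_induct)
    case (insert i I)
    then have "f i \<in> carrier M" "f \<in> I \<rightarrow> carrier M" by auto
    then show ?case
      using insert linear_mapD[OF assms(3)]
      by (simp add: Pi_def M.finsum_closed)
  qed (use linear_map_zero[OF assms(1-3)] in auto)
qed

lemma (in abelian_monoid) finsum_swap:
  assumes "finite I" "finite J" "\<And>i j. i \<in> I \<Longrightarrow> j \<in> J \<Longrightarrow> f i j \<in> carrier G"
  shows "(\<Oplus>i\<in>I. \<Oplus>j\<in>J. f i j) = (\<Oplus>j\<in>J. \<Oplus>i\<in>I. f i j)"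
  using assms(1,3)
proof (induction I)
  case (insert i I)
  then have "(\<Oplus>i\<in>insert i I. \<Oplus>j\<in>J. f i j) = (\<Oplus>j\<in>J. f i j) \<oplus> (\<Oplus>j\<in>J. \<Oplus>i\<in>I. f i j)"
    by (subst finsum_insert) (auto intro!: finsum_closed)
  also have "\<dots> = (\<Oplus>j\<in>J. f i j \<oplus> (\<Oplus>i\<in>I. f i j))"
    using insert by (subst finsum_addf) (auto intro!: finsum_closed)
  also have "\<dots> = (\<Oplus>j\<in>J. \<Oplus>i\<in>insert i I. f i j)"
    using insert by (intro finsum_cong' refl) (auto intro!: finsum_closed simp: Pi_def)
  finally show ?case .
qed simp

lemma (in abelian_monoid) finsum_Times:
  assumes "finite I" "finite J" "\<And>i j. i \<in> I \<Longrightarrow> j \<in> J \<Longrightarrow> f i j \<in> carrier G"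
  shows "(\<Oplus>i\<in>I. \<Oplus>j\<in>J. f i j) = (\<Oplus>k\<in>I \<times> J. f (fst k) (snd k))"
  using assms(1,3)
proof (induction I)
  case (insert i I)
  have *: "insert i I \<times> J = Pair i ` J \<union> I \<times> J" by auto
  have "(\<Oplus>k\<in>Pair i ` J. f (fst k) (snd k)) = (\<Oplus>j\<in>J. f i j)"
    using insert by (subst finsum_reindex) (auto simp: inj_on_def)
  then have "(\<Oplus>k\<in>insert i I \<times> J. f (fst k) (snd k))
      = (\<Oplus>j\<in>J. f i j) \<oplus> (\<Oplus>k\<in>I \<times> J. f (fst k) (snd k))"
    unfolding * using insert assms(2) by (subst finsum_Un_disjoint) auto
  also have "\<dots> = (\<Oplus>i\<in>insert i I. \<Oplus>j\<in>J. f i j)"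
    using insert by (subst finsum_insert) (auto intro!: finsum_closed)
  finally show ?case by simp
qed simp

lemma (in abelian_monoid) finsum_Plus:
  assumes "finite I" "finite J" "f \<in> I \<rightarrow> carrier G" "g \<in> J \<rightarrow> carrier G"
  shows "(\<Oplus>k\<in>I <+> J. case_sum f g k) = (\<Oplus>i\<in>I. f i) \<oplus> (\<Oplus>j\<in>J. g j)"
proof -
  have "(\<Oplus>k\<in>Inl ` I. case_sum f g k) = (\<Oplus>i\<in>I. f i)"
    using assms by (subst finsum_reindex) (auto simp: inj_on_def)
  moreover have "(\<Oplus>k\<in>Inr ` J. case_sum f g k) = (\<Oplus>j\<in>J. g j)"
    using assms by (subst finsum_reindex) (auto simp: inj_on_def)
  ultimately show ?thesis
    unfolding Plus_def using assms by (subst finsum_Un_disjoint) auto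
qed


lemma csubspace_kernel:
  assumes "cspace M" "cspace N" "linear_map M N \<phi>"
  shows "csubspace {x \<in> carrier M. \<phi> x = \<zero>\<^bsub>N\<^esub>} M"
proof -
  interpret M: module complex_field M by fact
  interpret N: module complex_field N by fact
  show ?thesis
    using N.smult_r_null
    by (intro csubspaceI assms(1))
      (auto simp: linear_map_zero[OF assms] linear_mapD[OF assms(3)] cspaceD[OF assms(1)])
qed

lemma cspace_diff_zero_iff:
  assumes "cspace M" "x \<in> carrier M" "y \<in> carrier M"
  shows "x \<ominus>\<^bsub>M\<^esub> y = \<zero>\<^bsub>M\<^esub> \<longleftrightarrow> x = y"
proof -
  interpret M: module complex_field M by fact
  show ?thesis
    using assms(2,3) by (metis M.add.inv_closed M.add.inv_equality M.minus_eq M.minus_minus M.r_neg)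
qed

lemma cspace_diff:
  assumes "cspace M" "x \<in> carrier M" "y \<in> carrier M"
  shows "x \<ominus>\<^bsub>M\<^esub> y = x \<oplus>\<^bsub>M\<^esub> (- 1) \<odot>\<^bsub>M\<^esub> y"
  by (simp add: a_minus_def cspace_minus assms)


section \<open>Quotient spaces\<close>

context
  fixes M :: "(complex, 'v, 'm) module_scheme" and N :: "'v set"
  assumes M: "cspace M" and N: "csubspace N M"
begin

interpretation M: module complex_field M by (rule M)

interpretation N: abelian_subgroup N M
  by (intro abelian_subgroupI3 additive_subgroupI submodule.axioms(1)[OF N] M.abelian_group_M)

lemma quot_space_simps [simp]:
  "carrier (quot_space M N) = a_rcosets\<^bsub>M\<^esub> N" "zero (quot_space M N) = N"
  "add (quot_space M N) = set_add M"
  "smult (quot_space M N) = (\<lambda>c X. \<Union>x\<in>X. N +>\<^bsub>M\<^esub> (c \<odot>\<^bsub>M\<^esub> x))"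
  by (simp_all add: quot_space_def)

lemma mem_coset_iff: "x \<in> carrier M \<Longrightarrow> y \<in> N +>\<^bsub>M\<^esub> x \<longleftrightarrow> y \<in> carrier M \<and> y \<ominus>\<^bsub>M\<^esub> x \<in> N"
  using N.a_rcos_module_minus[of x y] M.a_r_coset_subset_G[OF csubspaceD(1)[OF M N], of x]
    M.is_abelian_group
  by (metis N.a_elemrcos_carrier N.a_rcos_module M.minus_eq)

lemma coset_self: "x \<in> carrier M \<Longrightarrow> x \<in> N +>\<^bsub>M\<^esub> x"
  by (rule N.a_rcos_self)

lemma coset_closed: "x \<in> carrier M \<Longrightarrow> N +>\<^bsub>M\<^esub> x \<in> carrier (quot_space M N)"
  using M.a_rcosetsI[OF csubspaceD(1)[OF M N]] by simp

lemma coset_cases: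
  assumes "X \<in> carrier (quot_space M N)"
  obtains x where "x \<in> carrier M" "X = N +>\<^bsub>M\<^esub> x"
  using assms by (auto simp: A_RCOSETS_def')

lemma coset_eq_iff:
  assumes "x \<in> carrier M" "y \<in> carrier M"
  shows "N +>\<^bsub>M\<^esub> x = N +>\<^bsub>M\<^esub> y \<longleftrightarrow> x \<ominus>\<^bsub>M\<^esub> y \<in> N"
  using assms N.a_repr_independence' N.a_repr_independenceD mem_coset_iff
  by (metis coset_self)

lemma coset_add:
  assumes "x \<in> carrier M" "y \<in> carrier M"
  shows "(N +>\<^bsub>M\<^esub> x) \<oplus>\<^bsub>quot_space M N\<^esub> (N +>\<^bsub>M\<^esub> y) = N +>\<^bsub>M\<^esub> (x \<oplus>\<^bsub>M\<^esub> y)"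
  using N.a_rcos_sum[OF assms] by simp

text \<open>The scalar multiple in the quotient is a union of cosets over all representatives
  \<open>y\<close> of the given coset. They all coincide, because \<open>N\<close> contains
  \<open>c (y - x)\<close>, so the union is a single coset.\<close>

lemma coset_smult:
  assumes "x \<in> carrier M"
  shows "c \<odot>\<^bsub>quot_space M N\<^esub> (N +>\<^bsub>M\<^esub> x) = N +>\<^bsub>M\<^esub> (c \<odot>\<^bsub>M\<^esub> x)"
proof -
  have "N +>\<^bsub>M\<^esub> (c \<odot>\<^bsub>M\<^esub> y) = N +>\<^bsub>M\<^esub> (c \<odot>\<^bsub>M\<^esub> x)" if "y \<in> N +>\<^bsub>M\<^esub> x" for y
  proof -
    have y: "y \<in> carrier M" "y \<ominus>\<^bsub>M\<^esub> x \<in> N" using that assms mem_coset_iff by auto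
    then have "c \<odot>\<^bsub>M\<^esub> (y \<ominus>\<^bsub>M\<^esub> x) \<in> N" using csubspaceD[OF M N] by auto
    moreover have "c \<odot>\<^bsub>M\<^esub> (y \<ominus>\<^bsub>M\<^esub> x) = c \<odot>\<^bsub>M\<^esub> y \<ominus>\<^bsub>M\<^esub> c \<odot>\<^bsub>M\<^esub> x"
      using y assms by (simp add: M.minus_eq M.smult_r_distr M.smult_r_minus)
    ultimately show ?thesis using y assms by (subst coset_eq_iff) auto
  qed
  then have "(\<Union>y\<in>N +>\<^bsub>M\<^esub> x. N +>\<^bsub>M\<^esub> (c \<odot>\<^bsub>M\<^esub> y)) = (\<Union>y\<in>N +>\<^bsub>M\<^esub> x. N +>\<^bsub>M\<^esub> (c \<odot>\<^bsub>M\<^esub> x))"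
    by (intro SUP_cong refl)
  also have "\<dots> = N +>\<^bsub>M\<^esub> (c \<odot>\<^bsub>M\<^esub> x)" using coset_self[OF assms] by blast
  finally show ?thesis by simp
qed

lemma coset_zero: "x \<in> N \<Longrightarrow> N +>\<^bsub>M\<^esub> x = \<zero>\<^bsub>quot_space M N\<^esub>"
  using M.a_coset_join2[of x N] csubspaceD(1)[OF M N] submodule.axioms(1)[OF N] by auto

lemma quot_space_zero_coset: "\<zero>\<^bsub>quot_space M N\<^esub> = N +>\<^bsub>M\<^esub> \<zero>\<^bsub>M\<^esub>"
  using coset_zero[of "\<zero>\<^bsub>M\<^esub>"] csubspaceD[OF M N] by auto

lemma cspace_quot_space: "cspace (quot_space M N)"
proof -
  let ?Q = "quot_space M N"
  have ag: "abelian_group ?Q"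
  proof (rule abelian_groupI)
    show "\<exists>Y\<in>carrier ?Q. Y \<oplus>\<^bsub>?Q\<^esub> X = \<zero>\<^bsub>?Q\<^esub>" if X: "X \<in> carrier ?Q" for X
      using X
    proof (rule coset_cases)
      fix x assume x: "x \<in> carrier M" "X = N +>\<^bsub>M\<^esub> x"
      show ?thesis
        by (rule bexI[of _ "N +>\<^bsub>M\<^esub> (\<ominus>\<^bsub>M\<^esub> x)"])
          (simp_all add: x coset_add coset_closed M.l_neg quot_space_zero_coset del: quot_space_simps)
    qed
  next
    show "\<zero>\<^bsub>?Q\<^esub> \<in> carrier ?Q" by (simp add: quot_space_zero_coset coset_closed del: quot_space_simps)
  qed (elim coset_cases, simp add: coset_add coset_closed quot_space_zero_coset M.a_ac
        del: quot_space_simps)+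
  show ?thesis
    by (rule cspaceI[OF ag]; elim coset_cases)
      (simp_all add: coset_add coset_smult coset_closed cspaceD[OF M] del: quot_space_simps)
qed

end

declare quot_space_simps [simp del]


section \<open>Tensor products\<close>

lemma lookup_map_times [simp]:
  "Poly_Mapping.lookup (Poly_Mapping.map ((*) c) p) k = c * (Poly_Mapping.lookup p k :: complex)"
  by (simp add: Poly_Mapping.map.rep_eq when_def)

lemma free_space_simps [simp]:
  "carrier (free_space X) = {p. Poly_Mapping.keys p \<subseteq> X}" "zero (free_space X) = 0"
  "add (free_space X) = (+)" "smult (free_space X) = (\<lambda>c. Poly_Mapping.map ((*) c))"
  by (simp_all add: free_space_def)

lemma keys_map_times_subset: "Poly_Mapping.keys (Poly_Mapping.map ((*) c) p) \<subseteq> Poly_Mapping.keys (p :: 'x \<Rightarrow>\<^sub>0 complex)"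
  by (auto simp: in_keys_iff)

lemma keys_add_subset: "Poly_Mapping.keys p \<subseteq> X \<Longrightarrow> Poly_Mapping.keys q \<subseteq> X \<Longrightarrow> Poly_Mapping.keys (p + q) \<subseteq> X"
  using keys_add[of p q] by auto

lemma cspace_free_space: "cspace (free_space X)"
proof (rule cspaceI)
  show "abelian_group (free_space X)"
  proof (rule abelian_groupI)
    fix p assume "p \<in> carrier (free_space X)"
    then show "\<exists>q\<in>carrier (free_space X). q \<oplus>\<^bsub>free_space X\<^esub> p = \<zero>\<^bsub>free_space X\<^esub>"
      by (intro bexI[of _ "- p"]) (auto simp: in_keys_iff)
  qed (auto simp: keys_add_subset add_ac)
qed (use keys_map_times_subset in \<open>fastforce simp: lookup_add algebra_simps intro!: poly_mapping_eqI\<close>)+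

lemma free_space_minus: "p \<in> carrier (free_space X) \<Longrightarrow> \<ominus>\<^bsub>free_space X\<^esub> p = - p"
  by (subst cspace_minus[OF cspace_free_space]) (auto intro!: poly_mapping_eqI)

lemma single_in_free_space [simp]: "k \<in> X \<Longrightarrow> Poly_Mapping.single k c \<in> carrier (free_space X)"
  by auto

text \<open>The linear extension of \<open>\<phi>\<close> from the basis; \<open>tensor_lift\<close>
  is this sum taken at a chosen representative.\<close>

definition free_lift :: "(complex, 'u, 'k) module_scheme \<Rightarrow> ('x \<Rightarrow> 'u) \<Rightarrow> ('x \<Rightarrow>\<^sub>0 complex) \<Rightarrow> 'u" where
  "free_lift P \<phi> p = (\<Oplus>\<^bsub>P\<^esub>k\<in>Poly_Mapping.keys p. Poly_Mapping.lookup p k \<odot>\<^bsub>P\<^esub> \<phi> k)"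

context
  fixes P :: "(complex, 'u, 'k) module_scheme" and \<phi> :: "'x \<Rightarrow> 'u" and X :: "'x set"
  assumes P: "cspace P" and \<phi>: "\<phi> \<in> X \<rightarrow> carrier P"
begin

interpretation P: module complex_field P by (rule P)

text \<open>Additivity compares elements with different supports; over a common index set the
  additional terms have coefficient 0.\<close>

lemma free_lift_superset:
  assumes "finite J" "Poly_Mapping.keys p \<subseteq> J" "J \<subseteq> X"
  shows "free_lift P \<phi> p = (\<Oplus>\<^bsub>P\<^esub>k\<in>J. Poly_Mapping.lookup p k \<odot>\<^bsub>P\<^esub> \<phi> k)"
  unfolding free_lift_def using assms \<phi>
  by (intro P.add.finprod_mono_neutral_cong_left) (auto simp: in_keys_iff cspaceD[OF P] Pi_def subset_iff)

lemma linear_free_lift: "linear_map (free_space X) P (free_lift P \<phi>)"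
  unfolding linear_map_def
proof (intro conjI funcsetI ballI allI)
  have c: "c \<odot>\<^bsub>P\<^esub> \<phi> k \<in> carrier P" if "k \<in> X" for c k
    using that \<phi> cspaceD(1)[OF P] by auto
  fix p assume p: "p \<in> carrier (free_space X)"
  then show "free_lift P \<phi> p \<in> carrier P"
    unfolding free_lift_def using c by (intro P.finsum_closed) auto
  fix q assume q: "q \<in> carrier (free_space X)"
  let ?J = "Poly_Mapping.keys p \<union> Poly_Mapping.keys q"
  have J: "?J \<subseteq> X" using p q by auto
  have "free_lift P \<phi> (p + q) = (\<Oplus>\<^bsub>P\<^esub>k\<in>?J. Poly_Mapping.lookup (p + q) k \<odot>\<^bsub>P\<^esub> \<phi> k)"
    using J keys_add[of p q] by (intro free_lift_superset) auto
  also have "\<dots> = (\<Oplus>\<^bsub>P\<^esub>k\<in>?J. Poly_Mapping.lookup p k \<odot>\<^bsub>P\<^esub> \<phi> k \<oplus>\<^bsub>P\<^esub> Poly_Mapping.lookup q k \<odot>\<^bsub>P\<^esub> \<phi> k)"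
    using J \<phi> c by (intro P.finsum_cong' refl) (auto simp: lookup_add cspaceD[OF P] subset_iff Pi_def)
  also have "\<dots> = (\<Oplus>\<^bsub>P\<^esub>k\<in>?J. Poly_Mapping.lookup p k \<odot>\<^bsub>P\<^esub> \<phi> k) \<oplus>\<^bsub>P\<^esub> (\<Oplus>\<^bsub>P\<^esub>k\<in>?J. Poly_Mapping.lookup q k \<odot>\<^bsub>P\<^esub> \<phi> k)"
    using J c by (intro P.finsum_addf) auto
  also have "\<dots> = free_lift P \<phi> p \<oplus>\<^bsub>P\<^esub> free_lift P \<phi> q"
    using J by (subst (1 2) free_lift_superset) auto
  finally show "free_lift P \<phi> (p \<oplus>\<^bsub>free_space X\<^esub> q) = free_lift P \<phi> p \<oplus>\<^bsub>P\<^esub> free_lift P \<phi> q" by simp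
next
  fix a p assume p: "p \<in> carrier (free_space X)"
  have c: "c \<odot>\<^bsub>P\<^esub> \<phi> k \<in> carrier P" if "k \<in> X" for c k
    using that \<phi> cspaceD(1)[OF P] by auto
  have "free_lift P \<phi> (Poly_Mapping.map ((*) a) p)
      = (\<Oplus>\<^bsub>P\<^esub>k\<in>Poly_Mapping.keys p. Poly_Mapping.lookup (Poly_Mapping.map ((*) a) p) k \<odot>\<^bsub>P\<^esub> \<phi> k)"
    using p keys_map_times_subset[of a p] by (intro free_lift_superset) auto
  also have "\<dots> = (\<Oplus>\<^bsub>P\<^esub>k\<in>Poly_Mapping.keys p. a \<odot>\<^bsub>P\<^esub> (Poly_Mapping.lookup p k \<odot>\<^bsub>P\<^esub> \<phi> k))"
    using p \<phi> c by (intro P.finsum_cong' refl) (auto simp: cspaceD[OF P] subset_iff Pi_def)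
  also have "\<dots> = a \<odot>\<^bsub>P\<^esub> free_lift P \<phi> p"
    unfolding free_lift_def using p c by (intro P.finsum_smult_ldistr[symmetric]) auto
  finally show "free_lift P \<phi> (a \<odot>\<^bsub>free_space X\<^esub> p) = a \<odot>\<^bsub>P\<^esub> free_lift P \<phi> p" by simp
qed

lemma free_lift_single:
  assumes "k \<in> X"
  shows "free_lift P \<phi> (Poly_Mapping.single k c) = c \<odot>\<^bsub>P\<^esub> \<phi> k"
proof -
  have "\<phi> k \<in> carrier P" using assms \<phi> by auto
  then show ?thesis
    using assms cspaceD[OF P] by (subst free_lift_superset[of "{k}"]) auto
qed

lemma free_lift_diff:
  assumes "p \<in> carrier (free_space X)" "q \<in> carrier (free_space X)"
  shows "free_lift P \<phi> (p - q) = free_lift P \<phi> p \<ominus>\<^bsub>P\<^esub> free_lift P \<phi> q"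
proof -
  have "p - q = p \<oplus>\<^bsub>free_space X\<^esub> (- 1) \<odot>\<^bsub>free_space X\<^esub> q"
    by (auto simp: lookup_add lookup_minus intro!: poly_mapping_eqI)
  then show ?thesis
    using assms linear_mapD[OF linear_free_lift] cspaceD(1)[OF cspace_free_space, of q X "- 1"]
    by (simp only: cspace_diff[OF P])
qed

end

section \<open>The universal property of the tensor product\<close>

definition bilinear_map ::
  "(complex, 'v, 'm) module_scheme \<Rightarrow> (complex, 'w, 'n) module_scheme \<Rightarrow>
   (complex, 'u, 'k) module_scheme \<Rightarrow> ('v \<Rightarrow> 'w \<Rightarrow> 'u) \<Rightarrow> bool" where
  "bilinear_map M N P \<beta> \<longleftrightarrow> (\<forall>x\<in>carrier M. linear_map N P (\<beta> x)) \<and>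
     (\<forall>y\<in>carrier N. linear_map M P (\<lambda>x. \<beta> x y))"

lemma bilinear_mapD:
  assumes "bilinear_map M N P \<beta>" "x \<in> carrier M" "y \<in> carrier N"
  shows "\<beta> x y \<in> carrier P"
    "x' \<in> carrier M \<Longrightarrow> \<beta> (x \<oplus>\<^bsub>M\<^esub> x') y = \<beta> x y \<oplus>\<^bsub>P\<^esub> \<beta> x' y"
    "y' \<in> carrier N \<Longrightarrow> \<beta> x (y \<oplus>\<^bsub>N\<^esub> y') = \<beta> x y \<oplus>\<^bsub>P\<^esub> \<beta> x y'"
    "\<beta> (c \<odot>\<^bsub>M\<^esub> x) y = c \<odot>\<^bsub>P\<^esub> \<beta> x y" "\<beta> x (c \<odot>\<^bsub>N\<^esub> y) = c \<odot>\<^bsub>P\<^esub> \<beta> x y"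
  using assms by (auto simp: bilinear_map_def linear_map_def)

lemma bilinear_mapI:
  assumes "\<And>x y. x \<in> carrier M \<Longrightarrow> y \<in> carrier N \<Longrightarrow> \<beta> x y \<in> carrier P"
    "\<And>x x' y. x \<in> carrier M \<Longrightarrow> x' \<in> carrier M \<Longrightarrow> y \<in> carrier N \<Longrightarrow> \<beta> (x \<oplus>\<^bsub>M\<^esub> x') y = \<beta> x y \<oplus>\<^bsub>P\<^esub> \<beta> x' y"
    "\<And>x y y'. x \<in> carrier M \<Longrightarrow> y \<in> carrier N \<Longrightarrow> y' \<in> carrier N \<Longrightarrow> \<beta> x (y \<oplus>\<^bsub>N\<^esub> y') = \<beta> x y \<oplus>\<^bsub>P\<^esub> \<beta> x y'"
    "\<And>c x y. x \<in> carrier M \<Longrightarrow> y \<in> carrier N \<Longrightarrow> \<beta> (c \<odot>\<^bsub>M\<^esub> x) y = c \<odot>\<^bsub>P\<^esub> \<beta> x y"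
    "\<And>c x y. x \<in> carrier M \<Longrightarrow> y \<in> carrier N \<Longrightarrow> \<beta> x (c \<odot>\<^bsub>N\<^esub> y) = c \<odot>\<^bsub>P\<^esub> \<beta> x y"
  shows "bilinear_map M N P \<beta>"
  using assms by (auto simp: bilinear_map_def linear_map_def)

context
  fixes M :: "(complex, 'v, 'm) module_scheme" and N :: "(complex, 'w, 'n) module_scheme"
  assumes M: "cspace M" and N: "cspace N"
begin

interpretation M: module complex_field M by (rule M)
interpretation N: module complex_field N by (rule N)

private abbreviation "FS \<equiv> free_space (carrier M \<times> carrier N)"

lemma bilinear_relators_subset: "bilinear_relators M N \<subseteq> carrier FS"
proof
  fix p assume "p \<in> bilinear_relators M N"
  moreover have "a - b \<in> carrier FS" if "a \<in> carrier FS" "b \<in> carrier FS" for a b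
    using that keys_diff[of a b] by auto
  ultimately show "p \<in> carrier FS"
    unfolding bilinear_relators_def using cspaceD(1)[OF M] cspaceD(1)[OF N]
    by (auto simp del: free_space_simps intro!: single_in_free_space)
qed

lemma csubspace_tensor_null: "csubspace (tensor_null M N) FS"
  unfolding tensor_null_def by (intro csubspace_lin_span cspace_free_space bilinear_relators_subset)

lemma cspace_tensor: "cspace (tensor M N)"
  unfolding tensor_def by (intro cspace_quot_space cspace_free_space csubspace_tensor_null)

lemma ptensor_closed:
  "x \<in> carrier M \<Longrightarrow> y \<in> carrier N \<Longrightarrow> ptensor M N x y \<in> carrier (tensor M N)"
  unfolding tensor_def ptensor_def
  by (intro coset_closed cspace_free_space csubspace_tensor_null) auto

lemma tensor_coset_eqI:
  assumes "p \<in> carrier FS" "p' \<in> carrier FS" "p - p' \<in> bilinear_relators M N"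
  shows "tensor_null M N +>\<^bsub>FS\<^esub> p = tensor_null M N +>\<^bsub>FS\<^esub> p'"
proof -
  have "p - p' \<in> tensor_null M N"
    unfolding tensor_null_def using assms(3) lin_span_superset[of "bilinear_relators M N"] by (rule set_mp[rotated])
  moreover have "p \<ominus>\<^bsub>FS\<^esub> p' = p - p'"
    by (simp add: a_minus_def free_space_minus[OF assms(2)])
  ultimately show ?thesis
    by (simp only: coset_eq_iff[OF cspace_free_space csubspace_tensor_null assms(1,2)])
qed

lemma bilinear_ptensor: "bilinear_map M N (tensor M N) (ptensor M N)"
proof (rule bilinear_mapI)
  note sm = coset_smult[OF cspace_free_space csubspace_tensor_null, folded tensor_def]
  note ad = coset_add[OF cspace_free_space csubspace_tensor_null, folded tensor_def]
  fix x y assume x: "x \<in> carrier M" and y: "y \<in> carrier N"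
  show "ptensor M N x y \<in> carrier (tensor M N)" using x y by (rule ptensor_closed)
  show "ptensor M N (x \<oplus>\<^bsub>M\<^esub> x') y = ptensor M N x y \<oplus>\<^bsub>tensor M N\<^esub> ptensor M N x' y"
    if "x' \<in> carrier M" for x'
    unfolding ptensor_def using x y that
    by (subst ad, simp, simp, intro tensor_coset_eqI)
      (auto dest!: subsetD[OF keys_add] simp: bilinear_relators_def diff_diff_eq[symmetric])
  show "ptensor M N x (y \<oplus>\<^bsub>N\<^esub> y') = ptensor M N x y \<oplus>\<^bsub>tensor M N\<^esub> ptensor M N x y'"
    if "y' \<in> carrier N" for y'
    unfolding ptensor_def using x y that
    by (subst ad, simp, simp, intro tensor_coset_eqI)
      (auto dest!: subsetD[OF keys_add] simp: bilinear_relators_def diff_diff_eq[symmetric])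
  show "ptensor M N (c \<odot>\<^bsub>M\<^esub> x) y = c \<odot>\<^bsub>tensor M N\<^esub> ptensor M N x y" for c
    unfolding ptensor_def using x y cspaceD(1)[OF M]
    by (subst sm, simp, intro tensor_coset_eqI) (auto simp: bilinear_relators_def)
  show "ptensor M N x (c \<odot>\<^bsub>N\<^esub> y) = c \<odot>\<^bsub>tensor M N\<^esub> ptensor M N x y" for c
    unfolding ptensor_def using x y cspaceD(1)[OF N]
    by (subst sm, simp, intro tensor_coset_eqI) (auto simp: bilinear_relators_def)
qed

context
  fixes P :: "(complex, 'u, 'k) module_scheme" and \<beta> :: "'v \<Rightarrow> 'w \<Rightarrow> 'u"
  assumes P: "cspace P" and \<beta>: "bilinear_map M N P \<beta>"
begin

interpretation P: module complex_field P by (rule P)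

private definition "\<phi> k = \<beta> (fst k) (snd k)"

private lemma \<phi>: "\<phi> \<in> carrier M \<times> carrier N \<rightarrow> carrier P"
  using bilinear_mapD(1)[OF \<beta>] by (auto simp: \<phi>_def)

text \<open>The kernel of the linear extension is a subspace, so it is enough that bilinearity of
  \<open>\<beta>\<close> kills the relators spanning \<open>tensor_null\<close>.\<close>

lemma free_lift_tensor_null: "tensor_null M N \<subseteq> {p \<in> carrier FS. free_lift P \<phi> p = \<zero>\<^bsub>P\<^esub>}"
  unfolding tensor_null_def
proof (rule lin_span_least)
  note lin = linear_free_lift[OF P \<phi>]
  show "csubspace {p \<in> carrier FS. free_lift P \<phi> p = \<zero>\<^bsub>P\<^esub>} FS"
    by (rule csubspace_kernel[OF cspace_free_space P lin])
  show "bilinear_relators M N \<subseteq> {p \<in> carrier FS. free_lift P \<phi> p = \<zero>\<^bsub>P\<^esub>}"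
  proof
    fix p assume p: "p \<in> bilinear_relators M N"
    note b = bilinear_mapD[OF \<beta>]
    have d: "free_lift P \<phi> (p - q) = free_lift P \<phi> p \<ominus>\<^bsub>P\<^esub> free_lift P \<phi> q"
      if "p \<in> carrier FS" "q \<in> carrier FS" for p q
      using free_lift_diff[OF P \<phi> that] .
    have dc: "p - q \<in> carrier FS" if "p \<in> carrier FS" "q \<in> carrier FS" for p q
      using that keys_diff[of p q] by auto
    have z: "(x \<oplus>\<^bsub>P\<^esub> y) \<ominus>\<^bsub>P\<^esub> x \<ominus>\<^bsub>P\<^esub> y = \<zero>\<^bsub>P\<^esub>" if "x \<in> carrier P" "y \<in> carrier P" for x y
      using that by (simp add: P.minus_eq P.a_comm[of x y] P.a_assoc P.r_neg)
    have "free_lift P \<phi> p = \<zero>\<^bsub>P\<^esub>"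
      using p z unfolding bilinear_relators_def
      by (auto simp: d dc free_lift_single[OF P \<phi>] \<phi>_def b cspaceD[OF M] cspaceD[OF N] cspaceD[OF P]
          cspace_diff_zero_iff[OF P] simp del: free_space_simps)
    then show "p \<in> {p \<in> carrier FS. free_lift P \<phi> p = \<zero>\<^bsub>P\<^esub>}"
      using p bilinear_relators_subset by auto
  qed
qed

text \<open>The representative picked by \<open>SOME\<close> differs from \<open>p\<close> by an
  element of \<open>tensor_null\<close>, on which the linear extension vanishes.\<close>

lemma tensor_lift_coset:
  assumes "p \<in> carrier FS"
  shows "tensor_lift P \<beta> (tensor_null M N +>\<^bsub>FS\<^esub> p) = free_lift P \<phi> p"
proof -
  let ?t = "tensor_null M N +>\<^bsub>FS\<^esub> p"
  have "(SOME p. p \<in> ?t) \<in> ?t"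
    using coset_self[OF cspace_free_space csubspace_tensor_null assms] by (rule someI)
  then have s: "(SOME p. p \<in> ?t) \<in> carrier FS" "(SOME p. p \<in> ?t) - p \<in> tensor_null M N"
    by (simp_all add: mem_coset_iff[OF cspace_free_space csubspace_tensor_null assms] a_minus_def
        free_space_minus[OF assms])
  then have "free_lift P \<phi> ((SOME p. p \<in> ?t) - p) = \<zero>\<^bsub>P\<^esub>"
    using free_lift_tensor_null by auto
  then have "free_lift P \<phi> (SOME p. p \<in> ?t) = free_lift P \<phi> p"
    using free_lift_diff[OF P \<phi> s(1) assms] linear_mapD(1)[OF linear_free_lift[OF P \<phi>]] s(1) assms
    by (simp add: cspace_diff_zero_iff[OF P] del: free_space_simps)
  then show ?thesis
    unfolding tensor_lift_def free_lift_def \<phi>_def Let_def .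
qed

lemma linear_tensor_lift: "linear_map (tensor M N) P (tensor_lift P \<beta>)"
  unfolding linear_map_def
proof (intro conjI funcsetI ballI allI)
  note c = coset_cases[OF cspace_free_space csubspace_tensor_null, folded tensor_def]
  note sm = coset_smult[OF cspace_free_space csubspace_tensor_null, folded tensor_def]
  note ad = coset_add[OF cspace_free_space csubspace_tensor_null, folded tensor_def]
  note lin = linear_mapD[OF linear_free_lift[OF P \<phi>]]
  fix s assume "s \<in> carrier (tensor M N)"
  then obtain p where p: "p \<in> carrier FS" "s = tensor_null M N +>\<^bsub>FS\<^esub> p" by (rule c)
  show "tensor_lift P \<beta> s \<in> carrier P"
    unfolding p(2) using p(1) by (simp only: tensor_lift_coset lin(1))
  show "tensor_lift P \<beta> (a \<odot>\<^bsub>tensor M N\<^esub> s) = a \<odot>\<^bsub>P\<^esub> tensor_lift P \<beta> s" for a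
    unfolding p(2) using p(1) cspaceD(1)[OF cspace_free_space p(1)]
    by (simp only: sm tensor_lift_coset lin(3))
  fix t assume "t \<in> carrier (tensor M N)"
  then obtain r where r: "r \<in> carrier FS" "t = tensor_null M N +>\<^bsub>FS\<^esub> r" by (rule c)
  have "p \<oplus>\<^bsub>FS\<^esub> r \<in> carrier FS" using p r by (simp add: keys_add_subset)
  then show "tensor_lift P \<beta> (s \<oplus>\<^bsub>tensor M N\<^esub> t) = tensor_lift P \<beta> s \<oplus>\<^bsub>P\<^esub> tensor_lift P \<beta> t"
    unfolding p(2) r(2) using p(1) r(1) by (simp only: ad tensor_lift_coset lin(2))
qed

lemma tensor_lift_ptensor:
  assumes "x \<in> carrier M" "y \<in> carrier N"
  shows "tensor_lift P \<beta> (ptensor M N x y) = \<beta> x y"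
  unfolding ptensor_def using assms bilinear_mapD(1)[OF \<beta>]
  by (subst tensor_lift_coset) (auto simp: free_lift_single[OF P \<phi>] \<phi>_def cspaceD[OF P])

end

end

section \<open>Linear functionals on the free algebra\<close>

text \<open>Counit, convolution and matrix coefficients are all finite sums of this shape, so
  additivity and homogeneity are proved once for all of them.\<close>

definition klift :: "('k \<Rightarrow> complex) \<Rightarrow> ('k \<Rightarrow>\<^sub>0 complex) \<Rightarrow> complex" where
  "klift \<phi> p = (\<Sum>k\<in>Poly_Mapping.keys p. Poly_Mapping.lookup p k * \<phi> k)"

lemma klift_zero [simp]: "klift \<phi> 0 = 0"
  by (simp add: klift_def)

lemma klift_single [simp]: "klift \<phi> (Poly_Mapping.single k c) = c * \<phi> k"
  by (cases "c = 0") (simp_all add: klift_def)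

lemma klift_add: "klift \<phi> (p + r) = klift \<phi> p + klift \<phi> r"
  unfolding klift_def by (rule setsum_keys_plus_distrib) (simp_all add: algebra_simps)

lemma klift_sum: "klift \<phi> (\<Sum>i\<in>I. p i) = (\<Sum>i\<in>I. klift \<phi> (p i))"
  by (induction I rule: infinite_finite_induct) (simp_all add: klift_add)

lemma klift_sum_list: "klift \<phi> (\<Sum>i\<leftarrow>xs. p i) = (\<Sum>i\<leftarrow>xs. klift \<phi> (p i))"
  by (induction xs) (simp_all add: klift_add)

lemma klift_scal: "klift \<phi> (scal c * p) = c * klift \<phi> p"
proof -
  have l: "Poly_Mapping.lookup (scal c * p) k = c * Poly_Mapping.lookup p k" for k
    unfolding scal_def mult_map_scale_conv_mult[symmetric]
    by (simp add: Poly_Mapping.map.rep_eq when_def)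
  have "klift \<phi> (scal c * p) = (\<Sum>k\<in>Poly_Mapping.keys p. Poly_Mapping.lookup (scal c * p) k * \<phi> k)"
    unfolding klift_def by (rule sum.mono_neutral_left) (auto simp: in_keys_iff l)
  then show ?thesis by (simp add: klift_def l sum_distrib_left mult.assoc)
qed

lemma poly_mapping_sum_single: "(\<Sum>k\<in>Poly_Mapping.keys p. Poly_Mapping.single k (Poly_Mapping.lookup p k)) = p"
proof (rule poly_mapping_eqI)
  fix k
  have "(\<Sum>x\<in>Poly_Mapping.keys p. Poly_Mapping.lookup (Poly_Mapping.single x (Poly_Mapping.lookup p x)) k)
      = (\<Sum>x\<in>Poly_Mapping.keys p. if x = k then Poly_Mapping.lookup p x else 0)"
    by (intro sum.cong refl) (auto simp: lookup_single)
  then show "Poly_Mapping.lookup (\<Sum>k\<in>Poly_Mapping.keys p. Poly_Mapping.single k (Poly_Mapping.lookup p k)) k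
      = Poly_Mapping.lookup p k"
    by (simp add: lookup_sum in_keys_iff)
qed

lemma scal_commute: "scal c * p = p * scal c"
proof -
  have "scal c * (\<Sum>k\<in>Poly_Mapping.keys p. Poly_Mapping.single k (Poly_Mapping.lookup p k))
      = (\<Sum>k\<in>Poly_Mapping.keys p. Poly_Mapping.single k (Poly_Mapping.lookup p k)) * scal c"
    unfolding sum_distrib_left sum_distrib_right
    by (intro sum.cong refl) (simp add: scal_def mult_single mult.commute)
  then show ?thesis by (simp add: poly_mapping_sum_single)
qed

definition lin :: "functional \<Rightarrow> bool" where
  "lin a \<longleftrightarrow> (\<forall>x y. a (x + y) = a x + a y) \<and> (\<forall>c x. a (scal c * x) = c * a x)"

abbreviation wrd :: "qgen list \<Rightarrow> free_alg" where
  "wrd w \<equiv> Poly_Mapping.single (Word w) 1"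

definition ev :: "functional \<Rightarrow> qgen list \<Rightarrow> complex" where
  "ev a w = a (wrd w)"

definition wlift :: "(qgen list \<Rightarrow> complex) \<Rightarrow> functional" where
  "wlift \<phi> = klift (\<phi> \<circ> letters)"

lemma lin_klift: "lin (klift \<phi>)"
  by (simp add: lin_def klift_add klift_scal)

lemma lin_wlift [simp]: "lin (wlift \<phi>)"
  by (simp add: wlift_def lin_klift)

lemma ev_wlift [simp]: "ev (wlift \<phi>) = \<phi>"
  by (simp add: ev_def wlift_def fun_eq_iff)

lemma linD: "lin a \<Longrightarrow> a (x + y) = a x + a y" "lin a \<Longrightarrow> a (scal c * x) = c * a x"
  by (simp_all add: lin_def)

lemma lin_zero: "lin a \<Longrightarrow> a 0 = 0"
  using linD(2)[of a 0 0] by simp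

lemma lin_minus: "lin a \<Longrightarrow> a (- x) = - a x"
  using linD(1)[of a x "- x"] lin_zero[of a] by (simp add: eq_neg_iff_add_eq_0 add.commute)

lemma lin_diff: "lin a \<Longrightarrow> a (x - y) = a x - a y"
  using linD(1)[of a x "- y"] by (simp add: lin_minus)

lemma lin_sum: "lin a \<Longrightarrow> a (\<Sum>i\<in>I. x i) = (\<Sum>i\<in>I. a (x i))"
  by (induction I rule: infinite_finite_induct) (simp_all add: linD lin_zero)

lemma lin_single: "lin a \<Longrightarrow> a (Poly_Mapping.single w c) = c * ev a (letters w)"
  using linD(2)[of a c "Poly_Mapping.single w 1"] by (simp add: scal_def mult_single ev_def)

text \<open>Words form a basis of the free algebra. From here on functionals are handled as
  functions on lists of letters, and identities between them are checked word by word.\<close>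

lemma lin_eq_wlift: "lin a \<Longrightarrow> a = wlift (ev a)"
proof
  fix x assume a: "lin a"
  have "a x = a (\<Sum>k\<in>Poly_Mapping.keys x. Poly_Mapping.single k (Poly_Mapping.lookup x k))"
    by (simp add: poly_mapping_sum_single)
  also have "\<dots> = wlift (ev a) x"
    using a by (simp add: lin_sum lin_single wlift_def klift_def)
  finally show "a x = wlift (ev a) x" .
qed

lemma lin_ext: "lin a \<Longrightarrow> lin b \<Longrightarrow> (\<And>w. ev a w = ev b w) \<Longrightarrow> a = b"
  using lin_eq_wlift[of a] lin_eq_wlift[of b] by (metis ext)

lemma lin_mult_left: "lin a \<Longrightarrow> lin (\<lambda>x. a (y * x))"
  by (simp add: lin_def distrib_left) (metis mult.assoc scal_commute)

lemma lin_mult_right: "lin a \<Longrightarrow> lin (\<lambda>x. a (x * y))"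
  by (simp add: lin_def distrib_right mult.assoc)

lemma lin_plus: "lin a \<Longrightarrow> lin b \<Longrightarrow> lin (\<lambda>x. a x + b x)"
  by (simp add: lin_def algebra_simps)

lemma lin_cmult: "lin a \<Longrightarrow> lin (\<lambda>x. c * a x)"
  by (simp add: lin_def algebra_simps)

lemma lin_const0: "lin (\<lambda>x. 0)"
  by (simp add: lin_def)

lemma lin_sum_list: "(\<And>p. p \<in> set ps \<Longrightarrow> lin (h p)) \<Longrightarrow> lin (\<lambda>x. \<Sum>p\<leftarrow>ps. h p x)"
  by (induction ps) (simp_all add: lin_const0 lin_plus)

lemma wrd_append: "wrd v * wrd w = wrd (v @ w)"
  by (simp add: mult_single plus_word_def)

lemma one_eq_wrd: "(1 :: free_alg) = wrd []"
  by (simp add: zero_word_def[symmetric])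

lemma gen_eq_wrd: "gen g = wrd [g]"
  by (simp add: gen_def)

lemma eval_one: "a 1 = ev a []"
  by (simp only: ev_def one_eq_wrd)

text \<open>For a fixed word on the left both sides are linear in \<open>Y\<close>, so agreement on
  words suffices; then the same argument applies to \<open>X\<close> with \<open>Y\<close>
  fixed.\<close>

lemma bilin_ext:
  assumes "lin a" "\<And>p. p \<in> set ps \<Longrightarrow> lin (fst p) \<and> lin (snd p)"
    and "\<And>v w. ev a (v @ w) = (\<Sum>p\<leftarrow>ps. ev (fst p) v * ev (snd p) w)"
  shows "a (X * Y) = (\<Sum>p\<leftarrow>ps. fst p X * snd p Y)"
proof -
  have "(\<lambda>Y. a (wrd v * Y)) = (\<lambda>Y. \<Sum>p\<leftarrow>ps. fst p (wrd v) * snd p Y)" for v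
    using assms by (intro lin_ext lin_mult_left lin_sum_list lin_cmult)
      (auto simp: ev_def wrd_append)
  then have *: "a (wrd v * Y) = (\<Sum>p\<leftarrow>ps. snd p Y * fst p (wrd v))" for v
    by (metis (no_types, lifting) mult.commute map_eq_conv)
  have "(\<lambda>X. a (X * Y)) = (\<lambda>X. \<Sum>p\<leftarrow>ps. snd p Y * fst p X)"
    using assms by (intro lin_ext lin_mult_right lin_sum_list lin_cmult)
      (auto simp: ev_def *)
  then show ?thesis by (metis (no_types, lifting) mult.commute map_eq_conv)
qed


section \<open>Functions on words\<close>

text \<open>The tensor monomials in the coproduct of a word, all with coefficient 1. A list keeps
  repeated monomials apart, and the recursion on the first letter is the multiplicativity of the
  coproduct.\<close>

fun splits :: "qgen list \<Rightarrow> (qgen list \<times> qgen list) list" where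
  "splits [] = [([], [])]"
| "splits (GE i # w) = map (\<lambda>p. (GE i # fst p, GK i # snd p)) (splits w)
     @ map (\<lambda>p. (fst p, GE i # snd p)) (splits w)"
| "splits (GF i # w) = map (\<lambda>p. (GF i # fst p, snd p)) (splits w)
     @ map (\<lambda>p. (GKi i # fst p, GF i # snd p)) (splits w)"
| "splits (GK i # w) = map (\<lambda>p. (GK i # fst p, GK i # snd p)) (splits w)"
| "splits (GKi i # w) = map (\<lambda>p. (GKi i # fst p, GKi i # snd p)) (splits w)"

definition convw :: "(qgen list \<Rightarrow> complex) \<Rightarrow> (qgen list \<Rightarrow> complex) \<Rightarrow> qgen list \<Rightarrow> complex" where
  "convw \<phi> \<psi> w = (\<Sum>p\<leftarrow>splits w. \<phi> (fst p) * \<psi> (snd p))"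

lemma convw_simps [simp]:
  "convw \<phi> \<psi> [] = \<phi> [] * \<psi> []"
  "convw \<phi> \<psi> (GE i # w) = convw (\<lambda>w. \<phi> (GE i # w)) (\<lambda>w. \<psi> (GK i # w)) w + convw \<phi> (\<lambda>w. \<psi> (GE i # w)) w"
  "convw \<phi> \<psi> (GF i # w) = convw (\<lambda>w. \<phi> (GF i # w)) \<psi> w + convw (\<lambda>w. \<phi> (GKi i # w)) (\<lambda>w. \<psi> (GF i # w)) w"
  "convw \<phi> \<psi> (GK i # w) = convw (\<lambda>w. \<phi> (GK i # w)) (\<lambda>w. \<psi> (GK i # w)) w"
  "convw \<phi> \<psi> (GKi i # w) = convw (\<lambda>w. \<phi> (GKi i # w)) (\<lambda>w. \<psi> (GKi i # w)) w"
  by (simp_all add: convw_def comp_def)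

lemma convw_add_left: "convw (\<lambda>w. \<phi> w + \<phi>' w) \<psi> w = convw \<phi> \<psi> w + convw \<phi>' \<psi> w"
  by (simp add: convw_def sum_list_addf algebra_simps)

lemma convw_add_right: "convw \<phi> (\<lambda>w. \<psi> w + \<psi>' w) w = convw \<phi> \<psi> w + convw \<phi> \<psi>' w"
  by (simp add: convw_def sum_list_addf algebra_simps)

lemma convw_cmult_left: "convw (\<lambda>w. c * \<phi> w) \<psi> w = c * convw \<phi> \<psi> w"
  by (simp add: convw_def sum_list_const_mult mult.assoc)

lemma convw_cmult_right: "convw \<phi> (\<lambda>w. c * \<psi> w) w = c * convw \<phi> \<psi> w"
  by (simp add: convw_def sum_list_const_mult mult.left_commute)

lemma convw_sum_list_left: "convw (\<lambda>w. \<Sum>x\<leftarrow>xs. \<phi> x w) \<psi> w = (\<Sum>x\<leftarrow>xs. convw (\<phi> x) \<psi> w)"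
  using convw_cmult_left[of 0 "\<lambda>w. 0"]
  by (induction xs) (simp_all add: convw_add_left)

lemma convw_sum_list_right: "convw \<phi> (\<lambda>w. \<Sum>x\<leftarrow>xs. \<psi> x w) w = (\<Sum>x\<leftarrow>xs. convw \<phi> (\<psi> x) w)"
  using convw_cmult_right[of _ 0 "\<lambda>w. 0"]
  by (induction xs) (simp_all add: convw_add_right)

text \<open>Multiplicativity of the coproduct, with the left factor expanded and the right factor
  kept as a convolution.\<close>

lemma convw_append:
  "convw \<phi> \<psi> (v @ w) = (\<Sum>p\<leftarrow>splits v. convw (\<lambda>w. \<phi> (fst p @ w)) (\<lambda>w. \<psi> (snd p @ w)) w)"
proof (induction v arbitrary: \<phi> \<psi>)
  case (Cons g v)
  then show ?case by (cases g) (simp_all add: comp_def)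
qed simp

lemma sum_list_swap:
  fixes f :: "'a \<Rightarrow> 'b \<Rightarrow> complex"
  shows "(\<Sum>x\<leftarrow>xs. \<Sum>y\<leftarrow>ys. f x y) = (\<Sum>y\<leftarrow>ys. \<Sum>x\<leftarrow>xs. f x y)"
  by (induction xs) (simp_all add: sum_list_addf)

text \<open>Exchanging the two sums of \<open>convw_append\<close> expands the right factor instead,
  which is where right weights and right contexts act.\<close>

lemma convw_append2:
  "convw \<phi> \<psi> (v @ w) = (\<Sum>p\<leftarrow>splits w. convw (\<lambda>v. \<phi> (v @ fst p)) (\<lambda>v. \<psi> (v @ snd p)) v)"
  unfolding convw_append
  by (simp add: convw_def sum_list_swap[of _ "splits w"])

text \<open>Coassociativity on each generator. The first letter is absorbed into the functions,
  which is why they are generalized in the induction.\<close>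

lemma convw_assoc: "convw (convw \<phi> \<psi>) \<chi> w = convw \<phi> (convw \<psi> \<chi>) w"
proof (induction w arbitrary: \<phi> \<psi> \<chi>)
  case (Cons g w)
  then show ?case
    by (cases g) (simp_all add: convw_add_left convw_add_right)
qed simp

section \<open>Counit and antipode on words\<close>

definition epsw :: "qgen list \<Rightarrow> complex" where
  "epsw w = prod_list (map counit_gen w)"

lemma epsw_simps [simp]: "epsw [] = 1" "epsw (g # w) = counit_gen g * epsw w" "epsw (v @ w) = epsw v * epsw w"
  by (simp_all add: epsw_def)

lemma convw_epsw: "convw \<phi> epsw w = \<phi> w"
proof (induction w arbitrary: \<phi>)
  case (Cons g w)
  have z: "convw \<phi> (\<lambda>w. 0) w = 0" for \<phi>
    using convw_cmult_right[of \<phi> 0 "\<lambda>w. 0" w] by simp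
  show ?case using Cons by (cases g) (simp_all add: z cong: if_cong)
qed simp

text \<open>The antipode of a generator is a single word up to sign. So the antipode of a word is
  again a signed word, and word and sign are tracked separately without forming linear
  combinations.\<close>

fun antl :: "qgen \<Rightarrow> qgen list" where
  "antl (GE i) = [GE i, GKi i]"
| "antl (GF i) = [GK i, GF i]"
| "antl (GK i) = [GKi i]"
| "antl (GKi i) = [GK i]"

fun ants :: "qgen \<Rightarrow> complex" where
  "ants (GE i) = - 1"
| "ants (GF i) = - 1"
| "ants (GK i) = 1"
| "ants (GKi i) = 1"

definition aw :: "qgen list \<Rightarrow> qgen list" where
  "aw w = concat (map antl (rev w))"

definition asgn :: "qgen list \<Rightarrow> complex" where
  "asgn w = prod_list (map ants w)"

lemma aw_simps [simp]: "aw [] = []" "aw (g # w) = aw w @ antl g" "aw (v @ w) = aw w @ aw v"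
  by (simp_all add: aw_def)

lemma asgn_simps [simp]: "asgn [] = 1" "asgn (g # w) = ants g * asgn w" "asgn (v @ w) = asgn v * asgn w"
  by (simp_all add: asgn_def)

definition antw :: "(qgen list \<Rightarrow> complex) \<Rightarrow> qgen list \<Rightarrow> complex" where
  "antw \<phi> w = asgn w * \<phi> (aw w)"

section \<open>The Hopf operations of the free algebra as operations on words\<close>

lemma counit_eq_wlift: "counit = wlift epsw"
  by (simp add: fun_eq_iff counit_def wlift_def klift_def epsw_def)

lemma u_eq_wlift: "u q i j = wlift (\<lambda>w. word_matrix q w i j)"
  by (simp add: fun_eq_iff u_def wlift_def klift_def)

lemma comult_word: "prod_list (map comult_gen w) = (\<Sum>p\<leftarrow>splits w. Poly_Mapping.single (Word (fst p), Word (snd p)) 1)"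
proof (induction w)
  case Nil
  have "(1 :: free_alg2) = Poly_Mapping.single (Word [], Word []) 1"
    by (simp flip: zero_word_def zero_prod_def)
  then show ?case by simp
next
  case (Cons g w)
  have s: "Poly_Mapping.single (a, b) 1 * (\<Sum>p\<leftarrow>ps. Poly_Mapping.single (Word (fst p), Word (snd p)) 1)
    = (\<Sum>p\<leftarrow>ps. Poly_Mapping.single (Word (letters a @ fst p), Word (letters b @ snd p)) (1::complex))" for a b ps
    by (induction ps) (simp_all add: distrib_left mult_single plus_word_def)
  show ?case
    using Cons by (cases g) (simp_all add: comult_gen_def distrib_right s comp_def zero_word_def)
qed

lemma conv_eq_wlift: "conv a b = wlift (convw (ev a) (ev b))"
proof
  fix x
  let ?T = "\<lambda>k. a (Poly_Mapping.single (fst k) 1) * b (Poly_Mapping.single (snd k) 1)"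
  have w: "klift ?T (prod_list (map comult_gen w)) = convw (ev a) (ev b) w" for w
    by (simp add: comult_word klift_sum_list convw_def ev_def)
  have "conv a b x = klift ?T (comult x)"
    by (simp add: conv_def klift_def mult.assoc)
  also have "\<dots> = wlift (convw (ev a) (ev b)) x"
    by (simp add: comult_def klift_sum klift_scal w wlift_def) (simp add: klift_def)
  finally show "conv a b x = wlift (convw (ev a) (ev b)) x" .
qed

lemma antipode_eq_wlift:
  assumes "lin a"
  shows "a \<circ> antipode = wlift (antw (ev a))"
proof
  fix x
  have g: "antipode_gen g = scal (ants g) * wrd (antl g)" for g
    by (cases g) (simp_all add: gen_def mult_single plus_word_def scal_def zero_word_def single_uminus)
  have w: "prod_list (map antipode_gen (rev w)) = scal (asgn w) * wrd (aw w)" for w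
  proof (induction w rule: rev_induct)
    case Nil
    then show ?case by (simp add: scal_def zero_word_def mult_single flip: one_eq_wrd)
  next
    case (snoc g w)
    then show ?case
      by (simp add: g scal_def mult_single plus_word_def zero_word_def mult.commute)
  qed
  have "(a \<circ> antipode) x = (\<Sum>w\<in>Poly_Mapping.keys x. Poly_Mapping.lookup x w * (asgn (letters w) * ev a (aw (letters w))))"
    by (simp add: antipode_def lin_sum[OF assms] linD[OF assms] w ev_def)
  then show "(a \<circ> antipode) x = wlift (antw (ev a)) x"
    by (simp add: wlift_def klift_def antw_def)
qed


section \<open>Functionals on the quantized enveloping algebra\<close>

text \<open>The power of q from the Cartan matrix, in a form without integer exponents so that field
  arithmetic applies.\<close>

definition qc :: "real \<Rightarrow> node \<Rightarrow> node \<Rightarrow> complex" where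
  "qc q i j = (if i = j then (complex_of_real q)\<^sup>2 else 1 / complex_of_real q)"

lemma powi_cartan: "complex_of_real q powi (cartan i j) = qc q i j"
    "complex_of_real q powi (- cartan i j) = 1 / qc q i j"
  by (simp_all add: cartan_def qc_def power_int_minus divide_inverse)

text \<open>The defining relations, evaluated on the relators themselves (without left and right factors).\<close>

definition uq_rels :: "real \<Rightarrow> (qgen list \<Rightarrow> complex) \<Rightarrow> bool" where
  "uq_rels q \<phi> \<longleftrightarrow>
     (\<forall>i j. \<phi> [GK i, GK j] = \<phi> [GK j, GK i]) \<and>
     (\<forall>i. \<phi> [GK i, GKi i] = \<phi> []) \<and>
     (\<forall>i. \<phi> [GKi i, GK i] = \<phi> []) \<and>
     (\<forall>i j. \<phi> [GK i, GE j] = qc q i j * \<phi> [GE j, GK i]) \<and>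
     (\<forall>i j. \<phi> [GK i, GF j] = 1 / qc q i j * \<phi> [GF j, GK i]) \<and>
     (\<forall>i j. \<phi> [GE i, GF j] = \<phi> [GF j, GE i] + (if i = j then
        1 / (complex_of_real q - 1 / complex_of_real q) * (\<phi> [GK i] - \<phi> [GKi i]) else 0)) \<and>
     (\<forall>i j. i \<noteq> j \<longrightarrow> \<phi> [GE i, GE i, GE j] =
        (complex_of_real q + 1 / complex_of_real q) * \<phi> [GE i, GE j, GE i] - \<phi> [GE j, GE i, GE i]) \<and>
     (\<forall>i j. i \<noteq> j \<longrightarrow> \<phi> [GF i, GF i, GF j] =
        (complex_of_real q + 1 / complex_of_real q) * \<phi> [GF i, GF j, GF i] - \<phi> [GF j, GF i, GF i])"

text \<open>The ideal is spanned by relators multiplied by words on both sides, so vanishing on it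
  is tested by placing the relators in all contexts of two words.\<close>

definition uqw :: "real \<Rightarrow> (qgen list \<Rightarrow> complex) \<Rightarrow> bool" where
  "uqw q \<phi> \<longleftrightarrow> (\<forall>us vs. uq_rels q (\<lambda>w. \<phi> (us @ w @ vs)))"

lemma uq_rels_add: "uq_rels q \<phi> \<Longrightarrow> uq_rels q \<psi> \<Longrightarrow> uq_rels q (\<lambda>w. \<phi> w + \<psi> w)"
  unfolding uq_rels_def by (auto simp: algebra_simps)

lemma uq_rels_cmult: "uq_rels q \<phi> \<Longrightarrow> uq_rels q (\<lambda>w. c * \<phi> w)"
  unfolding uq_rels_def by (auto simp: right_diff_distrib distrib_left mult.left_commute)

lemma uq_rels_sum_list: "(\<And>x. x \<in> set xs \<Longrightarrow> uq_rels q (\<phi> x)) \<Longrightarrow> uq_rels q (\<lambda>w. \<Sum>x\<leftarrow>xs. \<phi> x w)"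
proof (induction xs)
  case Nil
  show ?case by (simp add: uq_rels_def)
qed (simp add: uq_rels_add)

lemma uqw_context: "uqw q \<phi> \<Longrightarrow> uqw q (\<lambda>w. \<phi> (us @ w @ vs))"
proof -
  assume "uqw q \<phi>"
  then have "uq_rels q (\<lambda>w. \<phi> ((us @ us') @ w @ (vs' @ vs)))" for us' vs'
    unfolding uqw_def by blast
  then show ?thesis by (simp add: uqw_def)
qed

lemma ring_free_algebra: "ring free_algebra"
proof -
  have "\<exists>y. y + x = 0" for x :: free_alg
    by (rule exI[of _ "- x"]) simp
  then show ?thesis
    by (intro ringI abelian_groupI monoidI) (auto simp: free_algebra_def algebra_simps)
qed

lemma free_algebra_simps [simp]:
  "carrier free_algebra = UNIV" "mult free_algebra = (*)" "one free_algebra = 1"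
  "zero free_algebra = 0" "add free_algebra = (+)" "smult free_algebra = (\<lambda>c x. scal c * x)"
  by (simp_all add: free_algebra_def)

lemma free_algebra_a_inv [simp]: "\<ominus>\<^bsub>free_algebra\<^esub> x = - x"
proof -
  interpret ring free_algebra by (rule ring_free_algebra)
  show ?thesis by (rule minus_equality) auto
qed

lemma uq_rels_iff:
  assumes b: "lin b"
  shows "uq_rels q (ev b) \<longleftrightarrow> (\<forall>r\<in>uq_relators q. b r = 0)"
proof -
  have one: "b 1 = ev b []" by (rule eval_one)
  have w: "b (wrd w) = ev b w" "b (scal c * wrd w) = c * ev b w" for w c
    using linD(2)[OF b] by (simp_all add: ev_def)
  have all: "(\<forall>r\<in>{f i j | i j. True}. b r = 0) \<longleftrightarrow> (\<forall>i j. b (f i j) = 0)"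
    "(\<forall>r\<in>{g i | i. True}. b r = 0) \<longleftrightarrow> (\<forall>i. b (g i) = 0)"
    "(\<forall>r\<in>{f i j | i j. i \<noteq> j}. b r = 0) \<longleftrightarrow> (\<forall>i j. i \<noteq> j \<longrightarrow> b (f i j) = 0)"
    for f :: "node \<Rightarrow> node \<Rightarrow> free_alg" and g
    by blast+
  have if_b: "b (if P then x else y) = (if P then b x else b y)" for P x y by simp
  show ?thesis
    unfolding uq_relators_def Let_def ball_Un all powi_cartan
    by (simp add: uq_rels_def gen_eq_wrd wrd_append mult.assoc distrib_right right_diff_distrib if_b
          lin_diff[OF b] linD(1)[OF b] lin_zero[OF b] one w power_int_minus divide_inverse)
      (auto simp: algebra_simps)
qed

lemma uq_rels_relators:
  assumes a: "lin a"
  shows "uq_rels q (\<lambda>w. ev a (us @ w @ vs)) \<longleftrightarrow> (\<forall>r\<in>uq_relators q. a (wrd us * r * wrd vs) = 0)"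
proof -
  let ?b = "\<lambda>x. a (wrd us * x * wrd vs)"
  have "lin ?b"
    using lin_mult_left[OF lin_mult_right[OF a, of "wrd vs"], of "wrd us"] by simp
  moreover have "ev ?b = (\<lambda>w. ev a (us @ w @ vs))"
    by (simp add: ev_def wrd_append fun_eq_iff)
  ultimately show ?thesis using uq_rels_iff[of ?b q] by simp
qed

text \<open>In one direction, a relator between two words stays in the ideal. In the other, the
  elements annihilated in every context form a two-sided ideal containing the relators, hence
  containing the ideal they generate.\<close>

lemma uq_dual_iff: "a \<in> uq_dual q \<longleftrightarrow> lin a \<and> uqw q (ev a)"
proof
  assume "a \<in> uq_dual q"
  then have a: "lin a" "\<And>x. x \<in> uq_ideal q \<Longrightarrow> a x = 0" by (auto simp: uq_dual_def lin_def)
  interpret I: ideal "uq_ideal q" free_algebra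
    unfolding uq_ideal_def by (rule ring.genideal_ideal[OF ring_free_algebra]) simp
  have "a (wrd us * r * wrd vs) = 0" if "r \<in> uq_relators q" for us r vs
  proof (rule a(2))
    have "r \<in> uq_ideal q"
      unfolding uq_ideal_def using ring.genideal_self[OF ring_free_algebra, of "uq_relators q"] that by auto
    then have "wrd us * r \<in> uq_ideal q" using I.I_l_closed[of r "wrd us"] by simp
    then show "wrd us * r * wrd vs \<in> uq_ideal q" using I.I_r_closed[of _ "wrd vs"] by simp
  qed
  then show "lin a \<and> uqw q (ev a)" using a uq_rels_relators by (simp add: uqw_def)
next
  assume A: "lin a \<and> uqw q (ev a)"
  then have r: "a (wrd us * r * wrd vs) = 0" if "r \<in> uq_relators q" for us r vs
    using uq_rels_relators[of a q us vs] that unfolding uqw_def by blast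
  have r: "a (x * r * y) = 0" if "r \<in> uq_relators q" for x r y
  proof -
    have "(\<lambda>y. a (wrd us * r * y)) = (\<lambda>y. 0)" for us
      using r[OF that] by (intro lin_ext[OF lin_mult_left lin_const0]) (simp_all add: A ev_def)
    then have "a (wrd us * r * y) = 0" for us by meson
    then have "(\<lambda>x. a (x * (r * y))) = (\<lambda>x. 0)"
      by (intro lin_ext[OF lin_mult_right lin_const0]) (simp_all add: A ev_def mult.assoc)
    then show ?thesis by (metis mult.assoc)
  qed
  let ?J = "{z. \<forall>x y. a (x * z * y) = 0}"
  have "ideal ?J free_algebra"
  proof (rule idealI[OF ring_free_algebra])
    interpret ring free_algebra by (rule ring_free_algebra)
    show "subgroup ?J (add_monoid free_algebra)"
    proof (rule add.subgroupI)
      show "?J \<noteq> {}" using A by (auto simp: lin_zero intro!: exI[of _ 0])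
    qed (use A in \<open>auto simp: distrib_left distrib_right linD lin_minus simp flip: a_inv_def\<close>)
  next
    fix z x assume z: "z \<in> ?J"
    have "a (x' * (x * z) * y) = 0" "a (x' * (z * x) * y) = 0" for x' y
      using z[THEN CollectD, rule_format, of "x' * x" y] z[THEN CollectD, rule_format, of x' "x * y"]
      by (simp_all add: mult.assoc)
    then show "x \<otimes>\<^bsub>free_algebra\<^esub> z \<in> ?J" "z \<otimes>\<^bsub>free_algebra\<^esub> x \<in> ?J" by simp_all
  qed
  then have "uq_ideal q \<subseteq> ?J"
    unfolding uq_ideal_def using r by (intro ring.genideal_minimal[OF ring_free_algebra]) auto
  then have "a (1 * x * 1) = 0" if "x \<in> uq_ideal q" for x using that by blast
  then show "a \<in> uq_dual q" using A by (simp add: uq_dual_def lin_def)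
qed


section \<open>Compatibility of the relations with coproduct and antipode\<close>

lemma qc_simps: "qc q i i = (complex_of_real q)\<^sup>2" "i \<noteq> j \<Longrightarrow> qc q i j = 1 / complex_of_real q"
  "qc q j i = qc q i j"
  by (simp_all add: qc_def)

context
  fixes q :: real and \<phi> :: "qgen list \<Rightarrow> complex"
  assumes q: "q \<noteq> 0" and \<phi>: "uqw q \<phi>"
begin

lemma qc_nonzero: "qc q i j \<noteq> 0"
  using q by (simp add: qc_def)

lemma uqw_rel: "uq_rels q (\<lambda>w. \<phi> (us @ w @ vs))"
  using \<phi> by (simp add: uqw_def)

lemma uqw_KK: "\<phi> (us @ GK i # GK j # vs) = \<phi> (us @ GK j # GK i # vs)"
  using uqw_rel[of us vs] unfolding uq_rels_def by simp

lemma uqw_KKi: "\<phi> (us @ GK i # GKi i # vs) = \<phi> (us @ vs)" "\<phi> (us @ GKi i # GK i # vs) = \<phi> (us @ vs)"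
  using uqw_rel[of us vs] unfolding uq_rels_def by simp_all

lemma uqw_KE: "\<phi> (us @ GK i # GE j # vs) = qc q i j * \<phi> (us @ GE j # GK i # vs)"
  using uqw_rel[of us vs] unfolding uq_rels_def by simp

lemma uqw_KF: "\<phi> (us @ GK i # GF j # vs) = 1 / qc q i j * \<phi> (us @ GF j # GK i # vs)"
  using uqw_rel[of us vs] unfolding uq_rels_def by simp

lemma uqw_EF: "\<phi> (us @ GE i # GF j # vs) = \<phi> (us @ GF j # GE i # vs) + (if i = j then
    1 / (complex_of_real q - 1 / complex_of_real q) * (\<phi> (us @ GK i # vs) - \<phi> (us @ GKi i # vs)) else 0)"
  using uqw_rel[of us vs] unfolding uq_rels_def by simp

lemma uqw_Serre_E: "i \<noteq> j \<Longrightarrow> \<phi> (us @ GE i # GE i # GE j # vs) =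
    (complex_of_real q + 1 / complex_of_real q) * \<phi> (us @ GE i # GE j # GE i # vs) - \<phi> (us @ GE j # GE i # GE i # vs)"
  using uqw_rel[of us vs] unfolding uq_rels_def by simp

lemma uqw_Serre_F: "i \<noteq> j \<Longrightarrow> \<phi> (us @ GF i # GF i # GF j # vs) =
    (complex_of_real q + 1 / complex_of_real q) * \<phi> (us @ GF i # GF j # GF i # vs) - \<phi> (us @ GF j # GF i # GF i # vs)"
  using uqw_rel[of us vs] unfolding uq_rels_def by simp

text \<open>The relators do not mention how inverses of \<open>K i\<close> commute with other
  letters. Insert \<open>K i\<close> and its inverse on the right, move \<open>K i\<close> to the
  left past the other letter, and cancel it there.\<close>

lemma uqw_KiE: "\<phi> (us @ GKi i # GE j # vs) = 1 / qc q i j * \<phi> (us @ GE j # GKi i # vs)"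
  using uqw_KKi(1)[of "us @ [GKi i, GE j]" i vs] uqw_KE[of "us @ [GKi i]" i j "GKi i # vs"]
    uqw_KKi(2)[of us i "GE j # GKi i # vs"] qc_nonzero[of i j] by simp

lemma uqw_KiF: "\<phi> (us @ GKi i # GF j # vs) = qc q i j * \<phi> (us @ GF j # GKi i # vs)"
  using uqw_KKi(1)[of "us @ [GKi i, GF j]" i vs] uqw_KF[of "us @ [GKi i]" i j "GKi i # vs"]
    uqw_KKi(2)[of us i "GF j # GKi i # vs"] qc_nonzero[of i j] by (simp add: field_simps)

lemma uqw_KiK: "\<phi> (us @ GKi i # GK j # vs) = \<phi> (us @ GK j # GKi i # vs)"
  using uqw_KKi(1)[of "us @ [GKi i, GK j]" i vs] uqw_KK[of "us @ [GKi i]" i j "GKi i # vs"]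
    uqw_KKi(2)[of us i "GK j # GKi i # vs"] by simp

lemma uqw_KiKi: "\<phi> (us @ GKi i # GKi j # vs) = \<phi> (us @ GKi j # GKi i # vs)"
  using uqw_KKi(1)[of "us @ [GKi i, GKi j]" i vs] uqw_KiK[of "us @ [GKi i]" j i "GKi i # vs"]
    uqw_KKi(2)[of us i "GKi j # GKi i # vs"] by simp

lemmas uqw_K = uqw_KK uqw_KKi uqw_KE uqw_KF uqw_KiE uqw_KiF uqw_KiK uqw_KiKi

text \<open>Rewriting of a pair of letters after a prefix of at most four. The longest words in
  question have six letters: the antipode of a cubic Serre monomial doubles each letter.\<close>

lemmas uqw_K_short = uqw_K[of "[]", simplified] uqw_K[of "[g]" for g, simplified]
  uqw_K[of "[g, h]" for g h, simplified] uqw_K[of "[g, h, k]" for g h k, simplified]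
  uqw_K[of "[g, h, k, l]" for g h k l, simplified]

lemmas uqw_short = uqw_Serre_E[of _ _ "[]", simplified] uqw_Serre_F[of _ _ "[]", simplified]
  uqw_Serre_F[of _ _ "[g]" for g, simplified] uqw_EF[of "[]", simplified] uqw_EF[of "[g]" for g, simplified]

end

text \<open>The coproduct respects the relations. Moving every \<open>K\<close> to the right and
  eliminating the leading Serre monomial brings both legs to a form in which the terms
  match.\<close>

lemma uq_rels_convw:
  assumes "q \<noteq> 0" "uqw q \<phi>" "uqw q \<psi>"
  shows "uq_rels q (convw \<phi> \<psi>)"
proof -
  let ?Q = "complex_of_real q"
  have Q: "?Q \<noteq> 0" using assms(1) by simp
  note P = uqw_K_short[OF assms(1,2)] uqw_short[OF assms(1,2)]
    uqw_K_short[OF assms(1,3)] uqw_short[OF assms(1,3)]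
  show ?thesis
    unfolding uq_rels_def
  proof (intro conjI allI impI)
    fix i j
    show "convw \<phi> \<psi> [GK i, GK j] = convw \<phi> \<psi> [GK j, GK i]"
      "convw \<phi> \<psi> [GK i, GKi i] = convw \<phi> \<psi> []" "convw \<phi> \<psi> [GKi i, GK i] = convw \<phi> \<psi> []"
      "convw \<phi> \<psi> [GK i, GE j] = qc q i j * convw \<phi> \<psi> [GE j, GK i]"
      "convw \<phi> \<psi> [GK i, GF j] = 1 / qc q i j * convw \<phi> \<psi> [GF j, GK i]"
      by (simp_all add: P algebra_simps add_divide_distrib)
    show "convw \<phi> \<psi> [GE i, GF j] = convw \<phi> \<psi> [GF j, GE i] + (if i = j then
        1 / (?Q - 1 / ?Q) * (convw \<phi> \<psi> [GK i] - convw \<phi> \<psi> [GKi i]) else 0)"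
      using qc_nonzero[OF assms(1,2)] by (simp add: P qc_simps(3)[of q i j] algebra_simps diff_divide_distrib)
    assume ij: "i \<noteq> j"
    show "convw \<phi> \<psi> [GE i, GE i, GE j] = (?Q + 1 / ?Q) * convw \<phi> \<psi> [GE i, GE j, GE i] - convw \<phi> \<psi> [GE j, GE i, GE i]"
      using Q ij by (simp add: P qc_simps field_simps power2_eq_square)
    show "convw \<phi> \<psi> [GF i, GF i, GF j] = (?Q + 1 / ?Q) * convw \<phi> \<psi> [GF i, GF j, GF i] - convw \<phi> \<psi> [GF j, GF i, GF i]"
      using Q ij by (simp add: P qc_simps field_simps power2_eq_square)
  qed
qed

text \<open>A context around a relator is split off on both sides by multiplicativity of the
  coproduct, which leaves the bare relator inside a context in each leg.\<close>

lemma uqw_convw: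
  assumes "q \<noteq> 0" "uqw q \<phi>" "uqw q \<psi>"
  shows "uqw q (convw \<phi> \<psi>)"
proof -
  have "convw \<phi> \<psi> (us @ w @ vs) = (\<Sum>p\<leftarrow>splits us. \<Sum>p'\<leftarrow>splits vs.
      convw (\<lambda>w. \<phi> (fst p @ w @ fst p')) (\<lambda>w. \<psi> (snd p @ w @ snd p')) w)" for us w vs
    by (simp only: convw_append[of \<phi> \<psi> us] convw_append2[of _ _ w vs] append_assoc)
  then show ?thesis
    unfolding uqw_def
    by (auto intro!: uq_rels_sum_list uq_rels_convw assms(1) uqw_context[OF assms(2)] uqw_context[OF assms(3)])
qed

text \<open>Reversal preserves the Serre relations, and the powers of q from collecting the
  \<open>K\<close> letters are the same for all three cubic monomials, since the Cartan matrix is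
  symmetric.\<close>

lemma uq_rels_antw:
  assumes "q \<noteq> 0" "uqw q \<phi>"
  shows "uq_rels q (antw \<phi>)"
proof -
  let ?Q = "complex_of_real q"
  have Q: "?Q \<noteq> 0" using assms(1) by simp
  note P = uqw_K_short[OF assms] uqw_short[OF assms] antw_def
  show ?thesis
    unfolding uq_rels_def
  proof (intro conjI allI impI)
    fix i j
    show "antw \<phi> [GK i, GK j] = antw \<phi> [GK j, GK i]"
      "antw \<phi> [GK i, GKi i] = antw \<phi> []" "antw \<phi> [GKi i, GK i] = antw \<phi> []"
      "antw \<phi> [GK i, GE j] = qc q i j * antw \<phi> [GE j, GK i]"
      "antw \<phi> [GK i, GF j] = 1 / qc q i j * antw \<phi> [GF j, GK i]"
      using qc_nonzero[OF assms(1,2)] by (simp_all add: P)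
    show "antw \<phi> [GE i, GF j] = antw \<phi> [GF j, GE i] + (if i = j then
        1 / (?Q - 1 / ?Q) * (antw \<phi> [GK i] - antw \<phi> [GKi i]) else 0)"
      using qc_nonzero[OF assms(1,2)] by (simp add: P qc_simps(3)[of q i j]) (simp add: add_divide_distrib[symmetric])
    assume ij: "i \<noteq> j"
    show "antw \<phi> [GE i, GE i, GE j] = (?Q + 1 / ?Q) * antw \<phi> [GE i, GE j, GE i] - antw \<phi> [GE j, GE i, GE i]"
      using Q ij by (simp add: P qc_simps field_simps power2_eq_square)
    show "antw \<phi> [GF i, GF i, GF j] = (?Q + 1 / ?Q) * antw \<phi> [GF i, GF j, GF i] - antw \<phi> [GF j, GF i, GF i]"
      using Q ij by (simp add: P qc_simps field_simps power2_eq_square)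
  qed
qed

text \<open>The antipode reverses products, so the two contexts reappear on opposite sides, together
  with their signs.\<close>

lemma uqw_antw:
  assumes "q \<noteq> 0" "uqw q \<phi>"
  shows "uqw q (antw \<phi>)"
proof -
  have "(\<lambda>w. antw \<phi> (us @ w @ vs)) = (\<lambda>w. asgn us * asgn vs * antw (\<lambda>w. \<phi> (aw vs @ w @ aw us)) w)" for us vs
    by (simp add: antw_def fun_eq_iff)
  then show ?thesis
    unfolding uqw_def using uq_rels_cmult uq_rels_antw assms(1) uqw_context[OF assms(2)] by simp
qed


section \<open>The Hopf algebra generated by the matrix coefficients\<close>

lemma sum_1_3: "(\<Sum>a\<in>{1..3::nat}. f a) = (\<Sum>a\<leftarrow>[1,2,3]. f a :: complex)"
  by (simp add: eval_nat_numeral atLeastAtMostSuc_conv algebra_simps)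

lemma sum_Suc_0_3: "(\<Sum>a\<in>{Suc 0..3}. f a) = f (Suc 0) + f 2 + (f 3 :: complex)"
  by (simp add: eval_nat_numeral atLeastAtMostSuc_conv algebra_simps)

lemma node_all: "(\<forall>i. P i) \<longleftrightarrow> P N1 \<and> P N2"
  by (metis node.exhaust)

text \<open>The bound on \<open>i\<close> matters for an empty \<open>v\<close>: its matrix is the
  identity on all natural numbers, whereas the sum ranges over 1 to 3.\<close>

lemma word_matrix_append:
  assumes "i \<in> {1..3}"
  shows "word_matrix q (v @ w) i j = (\<Sum>a\<in>{1..3}. word_matrix q v i a * word_matrix q w a j)"
  using assms
proof (induction v arbitrary: i)
  case Nil
  then have "(\<Sum>a\<in>{1..3}. word_matrix q [] i a * word_matrix q w a j)
      = (\<Sum>a\<in>{1..3}. if a = i then word_matrix q w i j else 0)"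
    by (intro sum.cong) auto
  then show ?case using Nil by simp
next
  case (Cons g v)
  then have "word_matrix q ((g # v) @ w) i j
      = (\<Sum>b\<in>{1..3}. \<Sum>a\<in>{1..3}. gen_matrix q g i b * (word_matrix q v b a * word_matrix q w a j))"
    by (simp add: sum_distrib_left)
  also have "\<dots> = (\<Sum>a\<in>{1..3}. \<Sum>b\<in>{1..3}. gen_matrix q g i b * (word_matrix q v b a * word_matrix q w a j))"
    by (rule sum.swap)
  finally show ?case by (simp add: sum_distrib_right mult.assoc)
qed

text \<open>These are the matrices of the vector representation, so every relation is an identity
  between 3 by 3 matrices and is checked entry by entry.\<close>

lemma uq_rels_word_matrix:
  assumes q: "q \<notin> {-1, 0, 1}" and "a \<in> {1..3}" "b \<in> {1..3}"
  shows "uq_rels q (\<lambda>w. word_matrix q w a b)"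
proof -
  have a: "a = 1 \<or> a = 2 \<or> a = 3" and b: "b = 1 \<or> b = 2 \<or> b = 3"
    using assms by auto
  let ?Q = "complex_of_real q"
  have Q: "?Q \<noteq> 0" using q by simp
  \<comment> \<open>Division is total, so a zero denominator would turn the commutator relation into
    \<open>E_i F_i = F_i E_i\<close>, which these matrices violate. Here q different from 1 and -1
    enters.\<close>
  have "?Q - 1 / ?Q \<noteq> 0"
  proof
    assume "?Q - 1 / ?Q = 0"
    then have "?Q * ?Q = 1" using Q by (simp add: field_simps)
    then have "complex_of_real (q * q) = complex_of_real 1" by simp
    then have "q * q = 1" by (simp only: of_real_eq_iff)
    then show False using q square_eq_1_iff[of q] by (auto simp: power2_eq_square)
  qed
  then have k: "1 / (?Q - 1 / ?Q) * (?Q - 1 / ?Q) = 1" "1 / (?Q - 1 / ?Q) * (1 / ?Q - ?Q) = - 1"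
    using Q by (auto simp: field_simps)
  show ?thesis
    using a b Q k unfolding uq_rels_def node_all
    by (elim disjE) (simp_all add: sum_Suc_0_3 qc_def power2_eq_square power_int_minus divide_inverse)
qed

lemma uqw_word_matrix:
  assumes "q \<notin> {-1, 0, 1}" "i \<in> {1..3}" "j \<in> {1..3}"
  shows "uqw q (\<lambda>w. word_matrix q w i j)"
proof -
  have "word_matrix q (us @ w @ vs) i j = (\<Sum>a\<leftarrow>[1,2,3]. \<Sum>b\<leftarrow>[1,2,3].
      (word_matrix q us i a * word_matrix q vs b j) * word_matrix q w a b)" for us w vs
    unfolding sum_1_3[symmetric] using assms(2)
    by (simp add: word_matrix_append sum_distrib_left mult_ac)
  then show ?thesis
    unfolding uqw_def
    by (auto intro!: uq_rels_sum_list uq_rels_cmult uq_rels_word_matrix assms(1) simp del: sum_list.Cons list.map)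
qed

lemma ev_conv [simp]: "ev (conv a b) = convw (ev a) (ev b)"
  by (simp add: conv_eq_wlift)

lemma conv_wrd: "conv a b (wrd w) = convw (ev a) (ev b) w"
  using ev_conv[of a b] by (metis ev_def)

lemma lin_conv [simp]: "lin (conv a b)"
  by (simp add: conv_eq_wlift)

lemma ev_antipode: "lin a \<Longrightarrow> ev (a \<circ> antipode) = antw (ev a)"
  by (simp add: antipode_eq_wlift)

lemma lin_antipode: "lin a \<Longrightarrow> lin (a \<circ> antipode)"
  by (simp add: antipode_eq_wlift)

lemma ev_antipode_fun: "lin a \<Longrightarrow> ev (\<lambda>x. a (antipode x)) = antw (ev a)"
  using ev_antipode[of a] by (simp add: comp_def)

lemma lin_antipode_fun: "lin a \<Longrightarrow> lin (\<lambda>x. a (antipode x))"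
  using lin_antipode[of a] by (simp add: comp_def)

lemma ev_u [simp]: "ev (u q i j) = (\<lambda>w. word_matrix q w i j)"
  by (simp add: u_eq_wlift)

lemma lin_u [simp]: "lin (u q i j)"
  by (simp add: u_eq_wlift)

lemma ev_counit [simp]: "ev counit = epsw"
  by (simp add: counit_eq_wlift)

lemma lin_counit [simp]: "lin counit"
  by (simp add: counit_eq_wlift)

lemma ev_plus [simp]: "ev (\<lambda>x. a x + b x) = (\<lambda>w. ev a w + ev b w)"
  by (simp add: ev_def fun_eq_iff)

lemma ev_cmult [simp]: "ev (\<lambda>x. c * a x) = (\<lambda>w. c * ev a w)"
  by (simp add: ev_def fun_eq_iff)

lemma uqw_add: "uqw q \<phi> \<Longrightarrow> uqw q \<psi> \<Longrightarrow> uqw q (\<lambda>w. \<phi> w + \<psi> w)"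
  by (simp add: uqw_def uq_rels_add)

lemma uqw_cmult: "uqw q \<phi> \<Longrightarrow> uqw q (\<lambda>w. c * \<phi> w)"
  by (simp add: uqw_def uq_rels_cmult)

lemma uqw_epsw: "uqw q epsw"
proof -
  have "uq_rels q epsw" by (simp add: uq_rels_def)
  then have "uq_rels q (\<lambda>w. (epsw us * epsw vs) * epsw w)" for us vs by (rule uq_rels_cmult)
  then show ?thesis by (simp add: uqw_def mult_ac)
qed

text \<open>The same set as the intersection \<open>Oq_SU3\<close>, in a form that allows induction.
  Closure under the coproduct is not a rule; it is derived in \<open>Oq_gen_dec\<close>.\<close>

inductive_set Oq_gen :: "real \<Rightarrow> functional set" for q where
  Oq_gen_u: "i \<in> {1..3} \<Longrightarrow> j \<in> {1..3} \<Longrightarrow> u q i j \<in> Oq_gen q"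
| Oq_gen_counit: "counit \<in> Oq_gen q"
| Oq_gen_conv: "a \<in> Oq_gen q \<Longrightarrow> b \<in> Oq_gen q \<Longrightarrow> conv a b \<in> Oq_gen q"
| Oq_gen_plus: "a \<in> Oq_gen q \<Longrightarrow> b \<in> Oq_gen q \<Longrightarrow> (\<lambda>x. a x + b x) \<in> Oq_gen q"
| Oq_gen_cmult: "a \<in> Oq_gen q \<Longrightarrow> (\<lambda>x. c * a x) \<in> Oq_gen q"
| Oq_gen_antipode: "a \<in> Oq_gen q \<Longrightarrow> a \<circ> antipode \<in> Oq_gen q"

lemma Oq_gen_uqw:
  assumes q: "q \<notin> {-1, 0, 1}" and "a \<in> Oq_gen q"
  shows "lin a \<and> uqw q (ev a)"
  using assms(2)
proof induction
  case (Oq_gen_u i j)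
  then show ?case using uqw_word_matrix[OF q] by simp
next
  case (Oq_gen_antipode a)
  then show ?case using q by (simp add: lin_antipode_fun ev_antipode_fun uqw_antw comp_def)
qed (use q in \<open>auto simp: uqw_epsw uqw_convw uqw_add uqw_cmult lin_plus lin_cmult\<close>)

lemma Oq_gen_zero: "(\<lambda>x. 0) \<in> Oq_gen q"
  using Oq_gen_cmult[OF Oq_gen_counit, of 0 q] by simp

text \<open>A coproduct decomposition tested on words, with its terms in a list, so that sums of
  functionals concatenate decompositions and convolutions multiply them.\<close>

definition dec :: "functional \<Rightarrow> (functional \<times> functional) list \<Rightarrow> bool" where
  "dec a ps \<longleftrightarrow> (\<forall>v w. ev a (v @ w) = (\<Sum>p\<leftarrow>ps. ev (fst p) v * ev (snd p) w))"

lemma sum_list_product: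
  "(\<Sum>z\<leftarrow>List.product xs ys. f (fst z) (snd z)) = (\<Sum>x\<leftarrow>xs. \<Sum>y\<leftarrow>ys. f x y :: complex)"
  by (induction xs) (simp_all add: comp_def)

lemma dec_u: "i \<in> {1..3} \<Longrightarrow> dec (u q i j) (map (\<lambda>k. (u q i k, u q k j)) [1,2,3])"
  unfolding dec_def ev_u by (simp only: word_matrix_append sum_1_3) simp

lemma dec_counit: "dec counit [(counit, counit)]"
  by (simp add: dec_def)

lemma dec_plus: "dec a ps \<Longrightarrow> dec b rs \<Longrightarrow> dec (\<lambda>x. a x + b x) (ps @ rs)"
  by (simp add: dec_def)

lemma dec_cmult: "dec a ps \<Longrightarrow> dec (\<lambda>x. c * a x) (map (\<lambda>p. (\<lambda>x. c * fst p x, snd p)) ps)"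
  by (simp add: dec_def comp_def sum_list_const_mult mult.assoc)

text \<open>The antipode is an antihomomorphism, hence the exchanged legs.\<close>

lemma dec_antipode:
  assumes "dec a ps" "lin a" "\<And>p. p \<in> set ps \<Longrightarrow> lin (fst p) \<and> lin (snd p)"
  shows "dec (a \<circ> antipode) (map (\<lambda>p. (snd p \<circ> antipode, fst p \<circ> antipode)) ps)"
proof -
  have "(\<Sum>p\<leftarrow>ps. ev (snd p \<circ> antipode) v * ev (fst p \<circ> antipode) w)
      = (\<Sum>p\<leftarrow>ps. asgn v * asgn w * (ev (fst p) (aw w) * ev (snd p) (aw v)))" for v w
    using assms(3) by (intro arg_cong[where f = sum_list] map_cong refl) (simp add: ev_antipode antw_def)
  then show ?thesis
    using assms(1,2) by (simp add: dec_def ev_antipode_fun antw_def comp_def sum_list_const_mult)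
qed

lemma dec_conv:
  assumes "dec a ps" "dec b rs"
  shows "dec (conv a b) (map (\<lambda>z. (conv (fst (fst z)) (fst (snd z)), conv (snd (fst z)) (snd (snd z)))) (List.product ps rs))"
  unfolding dec_def
proof (intro allI)
  fix v w
  have "ev (conv a b) (v @ w) = (\<Sum>s\<leftarrow>splits v. \<Sum>p\<leftarrow>ps. \<Sum>r\<leftarrow>rs.
      convw (ev (snd p)) (ev (snd r)) w * (ev (fst p) (fst s) * ev (fst r) (snd s)))"
    using assms by (simp add: dec_def convw_append convw_sum_list_left convw_sum_list_right
        convw_cmult_left convw_cmult_right) (simp add: mult_ac)
  also have "\<dots> = (\<Sum>p\<leftarrow>ps. \<Sum>r\<leftarrow>rs. \<Sum>s\<leftarrow>splits v.
      convw (ev (snd p)) (ev (snd r)) w * (ev (fst p) (fst s) * ev (fst r) (snd s)))"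
    by (simp only: sum_list_swap[of _ _ "splits v"])
  also have "\<dots> = (\<Sum>p\<leftarrow>ps. \<Sum>r\<leftarrow>rs. convw (ev (fst p)) (ev (fst r)) v * convw (ev (snd p)) (ev (snd r)) w)"
    by (simp add: sum_list_const_mult convw_def[of _ _ v] mult.commute)
  finally show "ev (conv a b) (v @ w) = (\<Sum>p\<leftarrow>map (\<lambda>z. (conv (fst (fst z)) (fst (snd z)), conv (snd (fst z)) (snd (snd z)))) (List.product ps rs).
      ev (fst p) v * ev (snd p) w)"
    by (simp add: comp_def sum_list_product[where f = "\<lambda>p r. convw (ev (fst p)) (ev (fst r)) v * convw (ev (snd p)) (ev (snd r)) w"])
qed

text \<open>Each way of generating an element turns decompositions of the arguments into a
  decomposition of the result with legs generated in the same way.\<close>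

lemma Oq_gen_dec:
  assumes q: "q \<notin> {-1, 0, 1}" and "a \<in> Oq_gen q"
  shows "\<exists>ps. set ps \<subseteq> Oq_gen q \<times> Oq_gen q \<and> dec a ps"
  using assms(2)
proof induction
  case (Oq_gen_u i j)
  then show ?case
    by (intro exI[of _ "map (\<lambda>k. (u q i k, u q k j)) [1,2,3]"] conjI dec_u) (auto intro!: Oq_gen.Oq_gen_u)
next
  case Oq_gen_counit
  show ?case using dec_counit Oq_gen.Oq_gen_counit by force
next
  case (Oq_gen_conv a b)
  then obtain ps rs where "set ps \<subseteq> Oq_gen q \<times> Oq_gen q" "dec a ps" "set rs \<subseteq> Oq_gen q \<times> Oq_gen q" "dec b rs" by blast
  then show ?case
    by (intro exI conjI, rule_tac [2] dec_conv) (auto intro!: Oq_gen.Oq_gen_conv)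
next
  case (Oq_gen_plus a b)
  then obtain ps rs where "set ps \<subseteq> Oq_gen q \<times> Oq_gen q" "dec a ps" "set rs \<subseteq> Oq_gen q \<times> Oq_gen q" "dec b rs" by blast
  then show ?case by (intro exI[of _ "ps @ rs"] conjI dec_plus) auto
next
  case (Oq_gen_cmult a c)
  then obtain ps where "set ps \<subseteq> Oq_gen q \<times> Oq_gen q" "dec a ps" by blast
  then show ?case by (intro exI conjI, rule_tac [2] dec_cmult) (auto intro!: Oq_gen.Oq_gen_cmult)
next
  case (Oq_gen_antipode a)
  then obtain ps where "set ps \<subseteq> Oq_gen q \<times> Oq_gen q" "dec a ps" by blast
  then show ?case using Oq_gen_uqw[OF q] Oq_gen_antipode
    by (intro exI conjI, rule_tac [2] dec_antipode) (auto intro!: Oq_gen.Oq_gen_antipode)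
qed


lemma coprod_decomp_iff:
  assumes "lin a" "\<And>i. i < n \<Longrightarrow> lin (f i) \<and> lin (g i)"
  shows "coprod_decomp H a n f g \<longleftrightarrow> (\<forall>i<n. f i \<in> H \<and> g i \<in> H) \<and>
    (\<forall>v w. ev a (v @ w) = (\<Sum>i<n. ev (f i) v * ev (g i) w))"
proof -
  let ?ps = "map (\<lambda>i. (f i, g i)) [0..<n]"
  have s: "(\<Sum>p\<leftarrow>?ps. h (fst p) (snd p)) = (\<Sum>i<n. h (f i) (g i) :: complex)" for h
    by (simp add: comp_def interv_sum_list_conv_sum_set_nat atLeast0LessThan)
  have "a (X * Y) = (\<Sum>p\<leftarrow>?ps. fst p X * snd p Y)"
    if "\<forall>v w. ev a (v @ w) = (\<Sum>i<n. ev (f i) v * ev (g i) w)" for X Y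
    using assms that by (intro bilin_ext) (auto simp: comp_def interv_sum_list_conv_sum_set_nat atLeast0LessThan)
  then have "a (X * Y) = (\<Sum>i<n. f i X * g i Y)"
    if "\<forall>v w. ev a (v @ w) = (\<Sum>i<n. ev (f i) v * ev (g i) w)" for X Y
    unfolding s[where h = "\<lambda>x y. x X * y Y", symmetric] using that by blast
  moreover have "ev a (v @ w) = (\<Sum>i<n. ev (f i) v * ev (g i) w)"
    if "\<forall>X Y. a (X * Y) = (\<Sum>i<n. f i X * g i Y)" for v w
    using that[rule_format, of "wrd v" "wrd w"] by (simp add: ev_def wrd_append)
  ultimately show ?thesis unfolding coprod_decomp_def by blast
qed

lemma coprod_decomp_of_dec:
  assumes "lin a" "dec a ps" "set ps \<subseteq> H \<times> H" "\<And>b. b \<in> H \<Longrightarrow> lin b"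
  shows "coprod_decomp H a (length ps) (\<lambda>i. fst (ps ! i)) (\<lambda>i. snd (ps ! i))"
proof -
  have "\<forall>i<length ps. fst (ps ! i) \<in> H \<and> snd (ps ! i) \<in> H"
    using assms(3) nth_mem by fastforce
  then show ?thesis
    using assms by (subst coprod_decomp_iff) (auto simp: dec_def sum_list_sum_nth atLeast0LessThan)
qed


section \<open>Weights\<close>

text \<open>A weight is recorded by its values at the two torus generators, as numbers and not as
  exponents; the values at the inverses follow in \<open>lwt_Ki\<close>.\<close>

definition lwt :: "(node \<Rightarrow> complex) \<Rightarrow> (qgen list \<Rightarrow> complex) \<Rightarrow> bool" where
  "lwt \<chi> \<phi> \<longleftrightarrow> (\<forall>i w. \<phi> (GK i # w) = \<chi> i * \<phi> w)"

definition rwt :: "(node \<Rightarrow> complex) \<Rightarrow> (qgen list \<Rightarrow> complex) \<Rightarrow> bool" where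
  "rwt \<chi> \<phi> \<longleftrightarrow> (\<forall>i w. \<phi> (w @ [GK i]) = \<chi> i * \<phi> w)"

lemma lwt_convw: "lwt \<alpha> \<phi> \<Longrightarrow> lwt \<beta> \<psi> \<Longrightarrow> lwt (\<lambda>i. \<alpha> i * \<beta> i) (convw \<phi> \<psi>)"
  by (simp add: lwt_def convw_cmult_left convw_cmult_right)

lemma rwt_convw: "rwt \<alpha> \<phi> \<Longrightarrow> rwt \<beta> \<psi> \<Longrightarrow> rwt (\<lambda>i. \<alpha> i * \<beta> i) (convw \<phi> \<psi>)"
  by (simp add: rwt_def convw_append2 convw_cmult_left convw_cmult_right)

lemma lwt_Ki:
  assumes "q \<noteq> 0" "uqw q \<phi>" "lwt \<chi> \<phi>" "\<chi> i \<noteq> 0"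
  shows "\<phi> (GKi i # w) = 1 / \<chi> i * \<phi> w"
  using uqw_KKi(1)[OF assms(1,2), of "[]" i w] assms(3,4) by (simp add: lwt_def field_simps)

lemma rwt_Ki:
  assumes "q \<noteq> 0" "uqw q \<phi>" "rwt \<chi> \<phi>" "\<chi> i \<noteq> 0"
  shows "\<phi> (w @ [GKi i]) = 1 / \<chi> i * \<phi> w"
proof -
  have "\<phi> w = \<phi> ((w @ [GKi i]) @ [GK i])"
    using uqw_KKi(2)[OF assms(1,2), of w i "[]"] by simp
  also have "\<dots> = \<chi> i * \<phi> (w @ [GKi i])"
    using assms(3) unfolding rwt_def by blast
  finally show ?thesis using assms(4) by simp
qed

text \<open>The antipode reverses words and inverts the \<open>K i\<close>: a left weight turns into
  the inverse right weight.\<close>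

lemma rwt_antw:
  assumes "q \<noteq> 0" "uqw q \<phi>" "lwt \<chi> \<phi>" "\<And>i. \<chi> i \<noteq> 0"
  shows "rwt (\<lambda>i. 1 / \<chi> i) (antw \<phi>)"
  using lwt_Ki[OF assms(1-3)] assms(4) by (simp add: rwt_def antw_def)

lemma lwt_antw:
  assumes "q \<noteq> 0" "uqw q \<phi>" "rwt \<chi> \<phi>" "\<And>i. \<chi> i \<noteq> 0"
  shows "lwt (\<lambda>i. 1 / \<chi> i) (antw \<phi>)"
  using rwt_Ki[OF assms(1-3)] assms(4) by (simp add: lwt_def antw_def)

lemma wt_epsw: "lwt (\<lambda>i. 1) epsw" "rwt (\<lambda>i. 1) epsw"
  by (simp_all add: lwt_def rwt_def)

definition u_wt :: "real \<Rightarrow> nat \<Rightarrow> node \<Rightarrow> complex" where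
  "u_wt q j i = gen_matrix q (GK i) j j"

lemma u_wt_nonzero: "q \<noteq> 0 \<Longrightarrow> u_wt q j i \<noteq> 0"
  by (simp add: u_wt_def)

lemma word_matrix_K: "word_matrix q [GK i] a b = (if a \<in> {1..3} \<and> a = b then u_wt q b i else 0)"
proof -
  have g: "gen_matrix q (GK i) a c = (if a = c then u_wt q c i else 0)" for c
    by (simp add: u_wt_def)
  have "word_matrix q [GK i] a b = (\<Sum>c\<in>{1..3}. gen_matrix q (GK i) a c * (if c = b then 1 else 0))"
    by (simp only: word_matrix.simps)
  also have "\<dots> = (\<Sum>c\<in>{1..3}. if c = b then (if a = b then u_wt q b i else 0) else 0)"
    unfolding g by (intro sum.cong) auto
  finally show ?thesis by (simp add: sum.delta)
qed

lemma lwt_u: "i \<in> {1..3} \<Longrightarrow> lwt (u_wt q i) (ev (u q i j))"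
proof -
  assume i: "i \<in> {1..3}"
  have "word_matrix q (GK k # w) i j = u_wt q i k * word_matrix q w i j" for k w
  proof -
    have "word_matrix q ([GK k] @ w) i j = (\<Sum>a\<in>{1..3}. if a = i then u_wt q i k * word_matrix q w i j else 0)"
      unfolding word_matrix_append[OF i] using i by (intro sum.cong refl) (auto simp: word_matrix_K simp del: word_matrix.simps)
    then show ?thesis using i by simp
  qed
  then show ?thesis by (simp add: lwt_def del: word_matrix.simps)
qed

lemma rwt_u: "i \<in> {1..3} \<Longrightarrow> j \<in> {1..3} \<Longrightarrow> rwt (u_wt q j) (ev (u q i j))"
proof -
  assume i: "i \<in> {1..3}" and j: "j \<in> {1..3}"
  have "word_matrix q (w @ [GK k]) i j = u_wt q j k * word_matrix q w i j" for k w
  proof -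
    have "word_matrix q (w @ [GK k]) i j = (\<Sum>a\<in>{1..3}. if a = j then u_wt q j k * word_matrix q w i j else 0)"
      unfolding word_matrix_append[OF i] by (intro sum.cong refl) (auto simp: word_matrix_K simp del: word_matrix.simps)
    then show ?thesis using j by simp
  qed
  then show ?thesis by (simp add: rwt_def)
qed

text \<open>
  A weight is realized by \<open>w\<close> if \<open>w\<close> has this weight on both sides and counit 1; then
  \<open>\<pi>(f) = \<epsilon>(f) \<pi>(w)\<close> for all \<open>f\<close> of the same right weight.
\<close>

definition realizes :: "real \<Rightarrow> (node \<Rightarrow> complex) \<Rightarrow> functional \<Rightarrow> (functional \<times> functional) list \<Rightarrow> bool" where
  "realizes q \<chi> w ps \<longleftrightarrow> w \<in> Oq_gen q \<and> ev w [] = 1 \<and> dec w ps \<and>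
     (\<forall>p\<in>set ps. fst p \<in> Oq_gen q \<and> snd p \<in> Oq_gen q \<and> lwt \<chi> (ev (fst p)) \<and> rwt \<chi> (ev (snd p)))"

definition good :: "real \<Rightarrow> (node \<Rightarrow> complex) \<Rightarrow> bool" where
  "good q \<chi> \<longleftrightarrow> (\<exists>w ps. realizes q \<chi> w ps)"

text \<open>Split \<open>w\<close> with the torus letter in the second leg, where the weight is
  known, and recombine the legs.\<close>

lemma realizes_rwt:
  assumes "realizes q \<chi> w ps"
  shows "rwt \<chi> (ev w)"
  unfolding rwt_def
proof (intro allI)
  fix i v
  have "ev w (v @ [GK i]) = (\<Sum>p\<leftarrow>ps. ev (fst p) v * ev (snd p) ([] @ [GK i]))"
    using assms by (simp add: realizes_def dec_def)
  also have "\<dots> = (\<Sum>p\<leftarrow>ps. \<chi> i * (ev (fst p) v * ev (snd p) []))"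
    using assms unfolding realizes_def rwt_def
    by (intro arg_cong[where f = sum_list] map_cong refl) (metis mult.left_commute)
  also have "\<dots> = \<chi> i * ev w (v @ [])"
    using assms unfolding realizes_def dec_def by (simp only: sum_list_const_mult)
  finally show "ev w (v @ [GK i]) = \<chi> i * ev w v" by simp
qed

context
  fixes q :: real
  assumes q: "q \<notin> {-1, 0, 1}"
begin

lemma Oq_gen_lin: "a \<in> Oq_gen q \<Longrightarrow> lin a"
  using Oq_gen_uqw[OF q] by blast

text \<open>The value of \<open>w\<close> at the inverse of \<open>K i\<close> times
  \<open>K i\<close> is its counit 1, and it is also a multiple of \<open>\<chi> i\<close>.\<close>

lemma good_nonzero:
  assumes "good q \<chi>"
  shows "\<chi> i \<noteq> 0"
proof
  assume z: "\<chi> i = 0"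
  obtain w ps where w: "realizes q \<chi> w ps" using assms by (auto simp: good_def)
  then have "w \<in> Oq_gen q" "ev w [] = 1" by (simp_all add: realizes_def)
  then have "ev w ([GKi i] @ [GK i]) = 1"
    using Oq_gen_uqw[OF q] uqw_KKi(2)[of q "ev w" "[]" i "[]"] q by simp
  moreover have "ev w ([GKi i] @ [GK i]) = \<chi> i * ev w [GKi i]"
    using realizes_rwt[OF w] unfolding rwt_def by blast
  ultimately show False using z by simp
qed

lemma good_one: "good q (\<lambda>i. 1)"
  unfolding good_def realizes_def
  by (intro exI[of _ counit] exI[of _ "[(counit, counit)]"]) (simp add: Oq_gen_counit dec_counit wt_epsw)

text \<open>In the coproduct of a diagonal coefficient the first legs share row \<open>j\<close> and
  the second legs share column \<open>j\<close>; rows determine left weights and columns right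
  weights.\<close>

lemma realizes_u: "j \<in> {1..3} \<Longrightarrow> realizes q (u_wt q j) (u q j j) (map (\<lambda>k. (u q j k, u q k j)) [1,2,3])"
  unfolding realizes_def by (auto simp: dec_u lwt_u[simplified] rwt_u[simplified] intro!: Oq_gen_u dec_u[simplified])

lemma good_u: "j \<in> {1..3} \<Longrightarrow> good q (u_wt q j)"
  unfolding good_def using realizes_u by fast

lemma realizes_conv:
  assumes "realizes q \<alpha> v ps" "realizes q \<beta> w rs"
  shows "realizes q (\<lambda>i. \<alpha> i * \<beta> i) (conv v w)
    (map (\<lambda>z. (conv (fst (fst z)) (fst (snd z)), conv (snd (fst z)) (snd (snd z)))) (List.product ps rs))"
  using assms unfolding realizes_def by (auto intro!: Oq_gen_conv dec_conv lwt_convw rwt_convw)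

text \<open>The antipode exchanges the legs and also the sides of the weights, so first legs again
  carry a common left weight and second legs a common right weight.\<close>

lemma realizes_antipode:
  assumes "realizes q \<chi> w ps"
  shows "realizes q (\<lambda>i. 1 / \<chi> i) (w \<circ> antipode) (map (\<lambda>p. (snd p \<circ> antipode, fst p \<circ> antipode)) ps)"
proof -
  have nz: "\<chi> i \<noteq> 0" for i using assms good_nonzero by (auto simp: good_def)
  have q0: "q \<noteq> 0" using q by simp
  note D = assms[unfolded realizes_def]
  have l: "lin w" "\<And>p. p \<in> set ps \<Longrightarrow> lin (fst p) \<and> lin (snd p)" using D Oq_gen_lin by auto
  have "ev (w \<circ> antipode) [] = 1" using D l by (simp add: ev_antipode antw_def)
  moreover have "dec (w \<circ> antipode) (map (\<lambda>p. (snd p \<circ> antipode, fst p \<circ> antipode)) ps)"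
    using D l by (intro dec_antipode) auto
  moreover have "lwt (\<lambda>i. 1 / \<chi> i) (ev (snd p \<circ> antipode)) \<and> rwt (\<lambda>i. 1 / \<chi> i) (ev (fst p \<circ> antipode))" if "p \<in> set ps" for p
    using D that l(2)[OF that] nz Oq_gen_uqw[OF q] by (simp only: ev_antipode) (blast intro: lwt_antw[OF q0] rwt_antw[OF q0])
  ultimately show ?thesis using D unfolding realizes_def by (auto intro: Oq_gen_antipode)
qed

lemma good_mult: "good q \<alpha> \<Longrightarrow> good q \<beta> \<Longrightarrow> good q (\<lambda>i. \<alpha> i * \<beta> i)"
  unfolding good_def using realizes_conv by blast

lemma good_inverse: "good q \<chi> \<Longrightarrow> good q (\<lambda>i. 1 / \<chi> i)"
  unfolding good_def using realizes_antipode by blast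

text \<open>Right weights are what the quotient map sees; left weights are carried along because the
  antipode turns them into right weights. Goodness provides the realizing elements to compare
  with.\<close>

definition bihom :: "functional \<Rightarrow> bool" where
  "bihom a \<longleftrightarrow> a \<in> Oq_gen q \<and> (\<exists>\<alpha> \<beta>. good q \<alpha> \<and> good q \<beta> \<and> lwt \<alpha> (ev a) \<and> rwt \<beta> (ev a))"

lemma bihom_conv: "bihom a \<Longrightarrow> bihom b \<Longrightarrow> bihom (conv a b)"
  unfolding bihom_def ev_conv using good_mult lwt_convw rwt_convw Oq_gen_conv by meson

lemma bihom_cmult: "bihom a \<Longrightarrow> bihom (\<lambda>x. c * a x)"
  unfolding bihom_def ev_cmult
  by (auto intro: Oq_gen_cmult simp: lwt_def rwt_def mult.left_commute)

lemma bihom_antipode: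
  assumes "bihom a"
  shows "bihom (a \<circ> antipode)"
proof -
  have q0: "q \<noteq> 0" using q by simp
  obtain \<alpha> \<beta> where a: "a \<in> Oq_gen q" "good q \<alpha>" "good q \<beta>" "lwt \<alpha> (ev a)" "rwt \<beta> (ev a)"
    using assms by (auto simp: bihom_def)
  have "lwt (\<lambda>i. 1 / \<beta> i) (ev (a \<circ> antipode))" "rwt (\<lambda>i. 1 / \<alpha> i) (ev (a \<circ> antipode))"
    unfolding ev_antipode[OF Oq_gen_lin[OF a(1)]] using a Oq_gen_uqw[OF q a(1)] good_nonzero
    by (blast intro: lwt_antw[OF q0] rwt_antw[OF q0])+
  then show ?thesis
    unfolding bihom_def using a good_inverse Oq_gen_antipode by blast
qed

text \<open>Several summands may share a weight; they are collected only in
  \<open>vanishing_on_K_in_BplusA\<close>.\<close>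

lemma Oq_gen_bihom_span:
  assumes "a \<in> Oq_gen q"
  shows "\<exists>as. (\<forall>b\<in>set as. bihom b) \<and> a = (\<lambda>x. \<Sum>b\<leftarrow>as. b x)"
  using assms
proof induction
  case (Oq_gen_u i j)
  then have "bihom (u q i j)"
    unfolding bihom_def
    by (intro conjI exI[of _ "u_wt q i"] exI[of _ "u_wt q j"] good_u lwt_u rwt_u Oq_gen.Oq_gen_u)
  then show ?case by (intro exI[of _ "[u q i j]"]) auto
next
  case Oq_gen_counit
  have "bihom counit"
    unfolding bihom_def ev_counit
    by (intro conjI exI[of _ "\<lambda>i. 1"] good_one wt_epsw Oq_gen.Oq_gen_counit)
  then show ?case by (intro exI[of _ "[counit]"]) auto
next
  case (Oq_gen_conv a b)
  then obtain as bs where A: "\<forall>x\<in>set as. bihom x" "a = (\<lambda>x. \<Sum>b\<leftarrow>as. b x)"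
    and B: "\<forall>x\<in>set bs. bihom x" "b = (\<lambda>x. \<Sum>b\<leftarrow>bs. b x)" by blast
  have ea: "ev a = (\<lambda>w. \<Sum>b\<leftarrow>as. ev b w)" "ev b = (\<lambda>w. \<Sum>b\<leftarrow>bs. ev b w)"
    using A B by (simp_all add: ev_def fun_eq_iff)
  let ?cs = "map (\<lambda>z. conv (fst z) (snd z)) (List.product as bs)"
  have "conv a b = (\<lambda>x. \<Sum>c\<leftarrow>?cs. c x)"
  proof (rule lin_ext)
    show "lin (\<lambda>x. \<Sum>c\<leftarrow>?cs. c x)" by (rule lin_sum_list) auto
    fix w
    have "ev (\<lambda>x. \<Sum>c\<leftarrow>?cs. c x) w = (\<Sum>z\<leftarrow>List.product as bs. convw (ev (fst z)) (ev (snd z)) w)"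
      unfolding ev_def[of "\<lambda>x. \<Sum>c\<leftarrow>?cs. c x"] by (simp add: comp_def conv_wrd)
    then show "ev (conv a b) w = ev (\<lambda>x. \<Sum>c\<leftarrow>?cs. c x) w"
      by (simp add: ea convw_sum_list_left convw_sum_list_right sum_list_product[where f = "\<lambda>x y. convw (ev x) (ev y) w"])
  qed simp
  moreover have "\<forall>c\<in>set ?cs. bihom c" using A B bihom_conv by auto
  ultimately show ?case by blast
next
  case (Oq_gen_plus a b)
  then obtain as bs where A: "\<forall>x\<in>set as. bihom x" "a = (\<lambda>x. \<Sum>b\<leftarrow>as. b x)"
    and B: "\<forall>x\<in>set bs. bihom x" "b = (\<lambda>x. \<Sum>b\<leftarrow>bs. b x)" by blast
  then show ?case by (intro exI[of _ "as @ bs"]) auto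
next
  case (Oq_gen_cmult a c)
  then obtain as where "\<forall>x\<in>set as. bihom x" "a = (\<lambda>x. \<Sum>b\<leftarrow>as. b x)" by blast
  then show ?case
    by (intro exI[of _ "map (\<lambda>b x. c * b x) as"]) (auto simp: bihom_cmult comp_def sum_list_const_mult)
next
  case (Oq_gen_antipode a)
  then obtain as where "\<forall>x\<in>set as. bihom x" "a = (\<lambda>x. \<Sum>b\<leftarrow>as. b x)" by blast
  then show ?case
    by (intro exI[of _ "map (\<lambda>b. b \<circ> antipode) as"]) (auto simp: bihom_antipode[unfolded comp_def] comp_def)
qed

end

text \<open>Dedekind's argument: the relation at \<open>i # ns\<close> minus \<nu>(i) times the
  relation at \<open>ns\<close> no longer involves \<nu> and multiplies each other coefficient by
  \<mu>(i) - \<nu>(i), which is nonzero for a suitable \<open>i\<close>.\<close>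

lemma characters_independent:
  assumes "finite M" "\<And>ns. (\<Sum>\<mu>\<in>M. c \<mu> * prod_list (map \<mu> ns)) = 0" "\<mu> \<in> M"
  shows "c \<mu> = (0 :: complex)"
  using assms
proof (induction M arbitrary: c \<mu>)
  case (insert \<nu> M)
  have M: "c \<mu> = 0" if "\<mu> \<in> M" for \<mu>
  proof -
    have "\<mu> \<noteq> \<nu>" using that insert by auto
    then obtain i where i: "\<mu> i \<noteq> \<nu> i" by auto
    have "(\<Sum>\<mu>\<in>M. c \<mu> * (\<mu> i - \<nu> i) * prod_list (map \<mu> ns)) = 0" for ns
    proof -
      have 1: "c \<nu> * prod_list (map \<nu> ns) = - (\<Sum>\<mu>\<in>M. c \<mu> * prod_list (map \<mu> ns))"
        "c \<nu> * (\<nu> i * prod_list (map \<nu> ns)) = - (\<Sum>\<mu>\<in>M. c \<mu> * (\<mu> i * prod_list (map \<mu> ns)))"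
        using insert.prems(1)[of ns] insert.prems(1)[of "i # ns"] insert.hyps by (simp_all add: eq_neg_iff_add_eq_0)
      have "(\<Sum>\<mu>\<in>M. c \<mu> * (\<mu> i - \<nu> i) * prod_list (map \<mu> ns))
          = (\<Sum>\<mu>\<in>M. c \<mu> * (\<mu> i * prod_list (map \<mu> ns))) - \<nu> i * (\<Sum>\<mu>\<in>M. c \<mu> * prod_list (map \<mu> ns))"
        by (simp add: sum_distrib_left sum_subtractf[symmetric] algebra_simps)
      also have "\<dots> = - (c \<nu> * (\<nu> i * prod_list (map \<nu> ns))) + \<nu> i * (c \<nu> * prod_list (map \<nu> ns))"
        unfolding 1 by simp
      finally show ?thesis by simp
    qed
    from insert.IH[OF this that] i show ?thesis by simp
  qed
  then have "c \<nu> = 0" using insert.prems(1)[of "[]"] insert.hyps by simp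
  with M show ?case using insert.prems(2) by auto
qed simp

text \<open>Test monomials on the torus. Inverses can be left out, since characters are already
  independent on the monoid of such monomials.\<close>

abbreviation kw :: "node list \<Rightarrow> qgen list" where
  "kw ns \<equiv> map GK ns"

lemma rwt_kw: "rwt \<chi> \<phi> \<Longrightarrow> \<phi> (w @ kw ns) = prod_list (map \<chi> ns) * \<phi> w"
proof (induction ns rule: rev_induct)
  case (snoc n ns)
  then have "\<phi> ((w @ kw ns) @ [GK n]) = \<chi> n * \<phi> (w @ kw ns)" unfolding rwt_def by blast
  then show ?case using snoc by simp
qed simp

lemma sum_list_splits_append:
  "(\<Sum>p\<leftarrow>splits (v @ w). h (fst p) (snd p)) =
   (\<Sum>p\<leftarrow>splits v. \<Sum>r\<leftarrow>splits w. h (fst p @ fst r) (snd p @ snd r) :: complex)"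
proof (induction v arbitrary: h)
  case (Cons g v)
  show ?case
    by (cases g) (simp_all add: comp_def Cons[of "\<lambda>a b. h (_ # a) (_ # b)"]
        Cons[of "\<lambda>a b. h a (_ # b)"] Cons[of "\<lambda>a b. h (_ # a) b"])
qed simp

lemma convw_epsw_left: "convw epsw \<phi> w = \<phi> w"
proof (induction w arbitrary: \<phi>)
  case (Cons g w)
  have z: "convw (\<lambda>w. 0) \<phi> w = 0" for \<phi>
    using convw_cmult_left[of 0 "\<lambda>w. 0" \<phi> w] by simp
  show ?case using Cons by (cases g) (simp_all add: z)
qed simp

text \<open>The antipode axiom inside a context. Removing the last letter fits because
  \<open>S(x_1 y_1) x_2 y_2 = S(y_1) S(x_1) x_2 y_2\<close>: the inner product cancels first, and
  the parts of the removed letter join the context.\<close>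

lemma antipode_cancel:
  assumes "q \<noteq> 0" "uqw q \<phi>"
  shows "(\<Sum>p\<leftarrow>splits w. asgn (fst p) * \<phi> (us @ aw (fst p) @ snd p @ vs)) = epsw w * \<phi> (us @ vs)"
proof (induction w arbitrary: us vs rule: rev_induct)
  case (snoc g w)
  have "(\<Sum>p\<leftarrow>splits (w @ [g]). asgn (fst p) * \<phi> (us @ aw (fst p) @ snd p @ vs))
      = (\<Sum>p\<leftarrow>splits w. \<Sum>r\<leftarrow>splits [g]. asgn (fst r) * (asgn (fst p) * \<phi> ((us @ aw (fst r)) @ aw (fst p) @ snd p @ (snd r @ vs))))"
    by (simp add: sum_list_splits_append[where h = "\<lambda>a b. asgn a * \<phi> (us @ aw a @ b @ vs)"] mult_ac
        del: splits.simps)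
  also have "\<dots> = (\<Sum>r\<leftarrow>splits [g]. asgn (fst r) * (epsw w * \<phi> ((us @ aw (fst r)) @ snd r @ vs)))"
    unfolding sum_list_swap[of _ "splits [g]" "splits w"] by (simp only: sum_list_const_mult snoc.IH)
  also have "\<dots> = epsw (w @ [g]) * \<phi> (us @ vs)"
    \<comment> \<open>For \<open>GF\<close> the two terms cancel as they stand; the other letters
      need the cancellation of \<open>K i\<close> against its inverse.\<close>
    using uqw_KKi[OF assms, of us] uqw_KKi[OF assms, of "us @ [GE i]" for i]
    by (cases g) simp_all
  finally show ?case .
qed simp

context
  fixes q :: real
  assumes q: "q \<notin> {-1, 0, 1}"
begin

lemma q_nonzero: "q \<noteq> 0"
  using q by simp

lemma uq_dual_algebra_simps [simp]:
  "carrier (uq_dual_algebra q) = uq_dual q" "mult (uq_dual_algebra q) = conv"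
  "zero (uq_dual_algebra q) = (\<lambda>x. 0)" "add (uq_dual_algebra q) = (\<lambda>a b x. a x + b x)"
  "smult (uq_dual_algebra q) = (\<lambda>c a x. c * a x)"
  by (simp_all add: uq_dual_algebra_def)

lemma cspace_uq_dual_algebra: "cspace (uq_dual_algebra q)"
proof (rule cspaceI)
  show "abelian_group (uq_dual_algebra q)"
  proof (rule abelian_groupI)
    fix a assume "a \<in> carrier (uq_dual_algebra q)"
    then show "\<exists>b\<in>carrier (uq_dual_algebra q). b \<oplus>\<^bsub>uq_dual_algebra q\<^esub> a = \<zero>\<^bsub>uq_dual_algebra q\<^esub>"
      using lin_cmult[of a "- 1"] uqw_cmult[of q "ev a" "- 1"] ev_cmult[of "- 1" a]
      by (intro bexI[of _ "\<lambda>x. - 1 * a x"]) (auto simp: uq_dual_iff)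
  next
    show "\<zero>\<^bsub>uq_dual_algebra q\<^esub> \<in> carrier (uq_dual_algebra q)"
      using uqw_cmult[OF uqw_epsw, of q 0] ev_cmult[of 0 counit] by (simp add: uq_dual_iff lin_const0)
  qed (auto simp: uq_dual_iff lin_plus uqw_add fun_eq_iff)
qed (auto simp: uq_dual_iff lin_cmult uqw_cmult algebra_simps)

lemma Oq_gen_uq_dual: "a \<in> Oq_gen q \<Longrightarrow> a \<in> uq_dual q"
  using Oq_gen_uqw[OF q] by (simp add: uq_dual_iff)

lemma Oq_gen_decomp:
  assumes "a \<in> Oq_gen q"
  obtains n f g where "coprod_decomp (Oq_gen q) a n f g"
proof -
  obtain ps where "set ps \<subseteq> Oq_gen q \<times> Oq_gen q" "dec a ps" using Oq_gen_dec[OF q assms] by blast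
  then show ?thesis
    using coprod_decomp_of_dec[OF Oq_gen_lin[OF q assms], of ps "Oq_gen q"] Oq_gen_lin[OF q] that by blast
qed

lemma Oq_gen_decomp_ex: "a \<in> Oq_gen q \<Longrightarrow> \<exists>n f g. coprod_decomp (Oq_gen q) a n f g"
  by (rule Oq_gen_decomp) blast+

lemma hopf_subalgebra_Oq_gen: "hopf_subalgebra q (Oq_gen q)"
proof -
  have "Oq_gen q \<subseteq> hopf_dual q"
  proof
    fix a assume a: "a \<in> Oq_gen q"
    then obtain n f g where "coprod_decomp (Oq_gen q) a n f g" by (rule Oq_gen_decomp)
    then have "coprod_decomp (uq_dual q) a n f g" using Oq_gen_uq_dual by (simp add: coprod_decomp_def)
    then show "a \<in> hopf_dual q" using Oq_gen_uq_dual[OF a] unfolding hopf_dual_def by blast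
  qed
  moreover have "csubspace (Oq_gen q) (uq_dual_algebra q)"
    using Oq_gen_uq_dual by (intro csubspaceI cspace_uq_dual_algebra) (auto intro: Oq_gen_plus Oq_gen_cmult Oq_gen_zero)
  ultimately show ?thesis
    unfolding hopf_subalgebra_def
    by (intro conjI ballI Oq_gen_counit Oq_gen_conv Oq_gen_antipode) (auto intro: Oq_gen_decomp_ex)
qed

text \<open>The inductive closure is itself one of the Hopf subalgebras being intersected, and each
  of them is closed under its rules.\<close>

lemma Oq_SU3_eq_Oq_gen: "Oq_SU3 q = Oq_gen q"
proof
  show "Oq_SU3 q \<subseteq> Oq_gen q"
    unfolding Oq_SU3_def using hopf_subalgebra_Oq_gen Oq_gen_u by blast
  have "a \<in> H" if "a \<in> Oq_gen q" and H: "hopf_subalgebra q H" "\<forall>i\<in>{1..3}. \<forall>j\<in>{1..3}. u q i j \<in> H" for a H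
  proof -
    have "csubspace H (uq_dual_algebra q)" using H(1) by (simp add: hopf_subalgebra_def)
    note D = csubspaceD(3,4)[OF cspace_uq_dual_algebra this, simplified]
    have H': "counit \<in> H" "\<And>a b. a \<in> H \<Longrightarrow> b \<in> H \<Longrightarrow> conv a b \<in> H" "\<And>a. a \<in> H \<Longrightarrow> a \<circ> antipode \<in> H"
      using H(1) unfolding hopf_subalgebra_def by blast+
    show ?thesis using that(1) by induction (simp_all add: H(2)[rule_format] D H'[unfolded comp_def] comp_def)
  qed
  then show "Oq_gen q \<subseteq> Oq_SU3 q" unfolding Oq_SU3_def by blast
qed

abbreviation (input) "A_space \<equiv> Oq_SU3_algebra q"

lemma A_space_simps [simp]:
  "carrier A_space = Oq_gen q" "mult A_space = conv" "zero A_space = (\<lambda>x. 0)" "add A_space = (\<lambda>a b x. a x + b x)"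
  "smult A_space = (\<lambda>c a x. c * a x)"
  by (simp_all add: Oq_SU3_algebra_def Oq_SU3_eq_Oq_gen)

lemma cspace_A_space: "cspace A_space"
  using hopf_subalgebra_Oq_gen cspace_subspace[OF cspace_uq_dual_algebra, of "Oq_gen q"]
  by (simp add: hopf_subalgebra_def Oq_SU3_algebra_def Oq_SU3_eq_Oq_gen)

section \<open>The right ideal generated by the augmentation ideal of B\<close>

abbreviation (input) "BplusA \<equiv> aug_ideal A_space (Oq_F3 q)"

lemma Oq_F3_subset: "Oq_F3 q \<subseteq> Oq_gen q"
  by (auto simp: Oq_F3_def Oq_SU3_eq_Oq_gen)

text \<open>Invariance is an identity of linear functionals, so it may be tested on words, where it
  is the weight condition; inverses are covered by \<open>rwt_Ki\<close>.\<close>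

lemma Oq_F3I:
  assumes b: "b \<in> Oq_gen q" and r: "rwt (\<lambda>i. 1) (ev b)"
  shows "b \<in> Oq_F3 q"
proof -
  have l: "lin b" and w: "uqw q (ev b)" using Oq_gen_uqw[OF q b] by auto
  have "act (K i) b = b" "act (Kinv i) b = b" for i
    unfolding act_def gen_eq_wrd using r rwt_Ki[OF q_nonzero w r]
    by (intro lin_ext[OF lin_mult_right[OF l] l]; simp add: ev_def[of "\<lambda>Y. b (Y * _)"] wrd_append flip: ev_def;
        simp add: rwt_def)+
  then show ?thesis using b by (simp add: Oq_F3_def Oq_SU3_eq_Oq_gen)
qed

lemma csubspace_BplusA: "csubspace BplusA A_space"
  unfolding aug_ideal_def using Oq_F3_subset
  by (intro csubspace_lin_span cspace_A_space) (auto intro: Oq_gen_conv)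

lemma conv_in_BplusA: "b \<in> Oq_F3 q \<Longrightarrow> b 1 = 0 \<Longrightarrow> a \<in> Oq_gen q \<Longrightarrow> conv b a \<in> BplusA"
  unfolding aug_ideal_def by (rule subsetD[OF lin_span_superset]) auto

lemma BplusA_sum_list: "(\<And>p. p \<in> set ps \<Longrightarrow> f p \<in> BplusA) \<Longrightarrow> (\<lambda>x. \<Sum>p\<leftarrow>ps. f p x) \<in> BplusA"
  using csubspaceD(2,3)[OF cspace_A_space csubspace_BplusA] by (induction ps) simp_all

text \<open>The identity \<open>S(w_1) w_2 = \<epsilon>(w) 1\<close> in A, obtained from
  \<open>antipode_cancel\<close> by exchanging the sum over the legs of \<open>w\<close> with the
  sum over the splittings of \<open>v\<close>.\<close>

lemma antipode_dec:
  assumes "w \<in> Oq_gen q" "dec w ps" "set ps \<subseteq> Oq_gen q \<times> Oq_gen q"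
  shows "(\<Sum>p\<leftarrow>ps. convw (antw (ev (fst p))) (ev (snd p)) v) = ev w [] * epsw v"
proof -
  have "(\<Sum>p\<leftarrow>ps. convw (antw (ev (fst p))) (ev (snd p)) v)
      = (\<Sum>s\<leftarrow>splits v. asgn (fst s) * (\<Sum>p\<leftarrow>ps. ev (fst p) (aw (fst s)) * ev (snd p) (snd s)))"
    by (simp add: convw_def antw_def sum_list_swap[of _ "splits v"] mult.assoc sum_list_const_mult[symmetric])
  also have "\<dots> = (\<Sum>s\<leftarrow>splits v. asgn (fst s) * ev w ([] @ aw (fst s) @ snd s @ []))"
    using assms(2) by (simp add: dec_def)
  also have "\<dots> = epsw v * ev w []"
    using Oq_gen_uqw[OF q assms(1)] by (subst antipode_cancel[OF q_nonzero]) auto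
  finally show ?thesis by simp
qed

text \<open>Put \<open>b = f S(w_1) - \<epsilon>(f) \<epsilon>(w_1)\<close>. The correction gives it
  counit 0, and it lies in B since the right weights of \<open>f\<close> and \<open>S(w_1)\<close>
  cancel. The sum of the products \<open>b w_2\<close> is
  \<open>f - \<epsilon>(f) w\<close>.\<close>

lemma weight_vector_mod_BplusA:
  assumes f: "f \<in> Oq_gen q" "rwt \<chi> (ev f)" and w: "realizes q \<chi> w ps"
  shows "(\<lambda>x. f x + - ev f [] * w x) \<in> BplusA"
proof -
  note D = w[unfolded realizes_def]
  have ps: "set ps \<subseteq> Oq_gen q \<times> Oq_gen q" using D by auto
  have nz: "\<chi> i \<noteq> 0" for i using w good_nonzero[OF q] by (auto simp: good_def)
  define b where "b p = (\<lambda>x. conv f (fst p \<circ> antipode) x + - (ev f [] * ev (fst p) []) * counit x)" for p :: "functional \<times> functional"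
  have evb: "ev (b p) = (\<lambda>v. convw (ev f) (antw (ev (fst p))) v + - (ev f [] * ev (fst p) []) * epsw v)"
    if "p \<in> set ps" for p
  proof -
    have "lin (fst p)" using that ps by (auto intro!: Oq_gen_lin[OF q])
    then show ?thesis
      unfolding b_def by (simp only: ev_plus ev_cmult ev_conv ev_counit ev_antipode)
  qed
  have b: "b p \<in> Oq_F3 q" "b p 1 = 0" if p: "p \<in> set ps" for p
  proof -
    have fp: "fst p \<in> Oq_gen q" "lwt \<chi> (ev (fst p))" using D p by auto
    have "rwt (\<lambda>i. \<chi> i * (1 / \<chi> i)) (convw (ev f) (antw (ev (fst p))))"
      using Oq_gen_uqw[OF q fp(1)] fp(2) nz by (intro rwt_convw f(2) rwt_antw[OF q_nonzero]) auto
    then have "rwt (\<lambda>i. 1) (ev (b p))"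
      using nz unfolding evb[OF p] by (simp add: rwt_def)
    moreover have "b p \<in> Oq_gen q"
      unfolding b_def by (intro Oq_gen_plus Oq_gen_cmult Oq_gen_counit Oq_gen_conv Oq_gen_antipode f(1) fp(1))
    ultimately show "b p \<in> Oq_F3 q" by (intro Oq_F3I)
    show "b p 1 = 0" unfolding eval_one evb[OF p] by (simp add: antw_def)
  qed
  have "(\<lambda>x. \<Sum>p\<leftarrow>ps. conv (b p) (snd p) x) \<in> BplusA"
    using b ps by (intro BplusA_sum_list conv_in_BplusA) auto
  also have "(\<lambda>x. \<Sum>p\<leftarrow>ps. conv (b p) (snd p) x) = (\<lambda>x. f x + - ev f [] * w x)"
  proof (rule lin_ext)
    show "lin (\<lambda>x. \<Sum>p\<leftarrow>ps. conv (b p) (snd p) x)" by (intro lin_sum_list lin_conv)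
    show "lin (\<lambda>x. f x + - ev f [] * w x)" using Oq_gen_lin[OF q] f D by (intro lin_plus lin_cmult) auto
    fix v
    have "ev (\<lambda>x. \<Sum>p\<leftarrow>ps. conv (b p) (snd p) x) v = (\<Sum>p\<leftarrow>ps. convw (ev (b p)) (ev (snd p)) v)"
      by (simp add: ev_def[of "\<lambda>x. \<Sum>p\<leftarrow>ps. conv (b p) (snd p) x"] conv_wrd)
    also have "\<dots> = (\<Sum>p\<leftarrow>ps. convw (ev f) (convw (antw (ev (fst p))) (ev (snd p))) v
        + - ev f [] * (ev (fst p) [] * ev (snd p) v))"
      by (intro arg_cong[where f = sum_list] map_cong refl)
        (simp only: evb convw_add_left convw_cmult_left convw_epsw_left convw_assoc, simp)
    also have "\<dots> = convw (ev f) (\<lambda>v. \<Sum>p\<leftarrow>ps. convw (antw (ev (fst p))) (ev (snd p)) v) v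
        + - ev f [] * (\<Sum>p\<leftarrow>ps. ev (fst p) [] * ev (snd p) v)"
      by (simp only: sum_list_addf sum_list_const_mult convw_sum_list_right)
    also have "(\<Sum>p\<leftarrow>ps. ev (fst p) [] * ev (snd p) v) = ev w ([] @ v)"
      using D unfolding dec_def by metis
    also have "convw (ev f) (\<lambda>v. \<Sum>p\<leftarrow>ps. convw (antw (ev (fst p))) (ev (snd p)) v) v = ev f v"
      using D antipode_dec[of w ps] ps by (simp add: convw_epsw)
    finally show "ev (\<lambda>x. \<Sum>p\<leftarrow>ps. conv (b p) (snd p) x) v = ev (\<lambda>x. f x + - ev f [] * w x) v"
      by (simp only: ev_plus ev_cmult append_Nil)
  qed
  finally show ?thesis .
qed

end

lemma sum_list_group:
  assumes "finite M" "wt ` set as \<subseteq> M"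
  shows "(\<Sum>b\<leftarrow>as. h (wt b) * e b) = (\<Sum>\<mu>\<in>M. (\<Sum>b\<leftarrow>filter (\<lambda>b. wt b = \<mu>) as. e b) * h \<mu> :: complex)"
  using assms(2)
proof (induction as)
  case (Cons a as)
  have "(\<Sum>\<mu>\<in>M. (\<Sum>b\<leftarrow>filter (\<lambda>b. wt b = \<mu>) (a # as). e b) * h \<mu>)
      = (\<Sum>\<mu>\<in>M. (if \<mu> = wt a then h (wt a) * e a else 0) + (\<Sum>b\<leftarrow>filter (\<lambda>b. wt b = \<mu>) as. e b) * h \<mu>)"
    by (intro sum.cong) (auto simp: algebra_simps)
  then show ?case using Cons assms(1) by (simp add: sum.distrib)
qed simp

lemma vanishing_on_K_in_BplusA:
  assumes q: "q \<notin> {-1, 0, 1}" and g: "g \<in> Oq_gen q" "\<And>ns. ev g (kw ns) = 0"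
  shows "g \<in> aug_ideal (Oq_SU3_algebra q) (Oq_F3 q)"
proof -
  obtain as where as: "\<forall>b\<in>set as. bihom q b" "g = (\<lambda>x. \<Sum>b\<leftarrow>as. b x)"
    using Oq_gen_bihom_span[OF q g(1)] by blast
  have "\<forall>b\<in>set as. \<exists>\<beta>. good q \<beta> \<and> rwt \<beta> (ev b)" using as(1) bihom_def[OF q] by blast
  then obtain wt where wt: "\<And>b. b \<in> set as \<Longrightarrow> good q (wt b) \<and> rwt (wt b) (ev b)" by metis
  have "\<forall>\<beta>\<in>wt ` set as. \<exists>w ps. realizes q \<beta> w ps" using wt by (auto simp: good_def)
  \<comment> \<open>One realizing element per weight, not per summand, so that summands of equal
    weight are compared with the same element.\<close>
  then obtain W R where W: "\<And>\<beta>. \<beta> \<in> wt ` set as \<Longrightarrow> realizes q \<beta> (W \<beta>) (R \<beta>)" by metis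
  \<comment> \<open>The coefficient of the character \<open>\<mu>\<close> in the restriction of
    \<open>g\<close> to the torus.\<close>
  define c where "c \<mu> = (\<Sum>b\<leftarrow>filter (\<lambda>b. wt b = \<mu>) as. ev b [])" for \<mu>
  have "(\<Sum>\<mu>\<in>wt ` set as. c \<mu> * prod_list (map \<mu> ns)) = 0" for ns
  proof -
    have "ev g (kw ns) = (\<Sum>b\<leftarrow>as. ev b ([] @ kw ns))"
      unfolding as(2) by (simp add: ev_def)
    also have "\<dots> = (\<Sum>b\<leftarrow>as. prod_list (map (wt b) ns) * ev b [])"
      using wt by (intro arg_cong[where f = sum_list] map_cong refl rwt_kw) blast
    also have "\<dots> = (\<Sum>\<mu>\<in>wt ` set as. c \<mu> * prod_list (map \<mu> ns))"
      unfolding c_def by (rule sum_list_group[where h = "\<lambda>\<mu>. prod_list (map \<mu> ns)"]) auto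
    finally show ?thesis using g(2) by simp
  qed
  then have c0: "c \<mu> = 0" if "\<mu> \<in> wt ` set as" for \<mu>
    by (rule characters_independent[rotated]) (use that in auto)
  \<comment> \<open>As these coefficients vanish, the corrections add up to 0, so each summand of
    \<open>g\<close> may be replaced by its difference from a multiple of the realizing
    element.\<close>
  have "(\<Sum>b\<leftarrow>as. ev b [] * W (wt b) x) = 0" for x
  proof -
    have "(\<Sum>b\<leftarrow>as. W (wt b) x * ev b []) = (\<Sum>\<mu>\<in>wt ` set as. c \<mu> * W \<mu> x)"
      unfolding c_def by (rule sum_list_group[where h = "\<lambda>\<mu>. W \<mu> x"]) auto
    then show ?thesis using c0 by (simp add: mult.commute)
  qed
  then have "(\<Sum>b\<leftarrow>as. b x) = (\<Sum>b\<leftarrow>as. b x + - ev b [] * W (wt b) x)" for x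
    by (simp add: sum_list_subtractf)
  then have "g = (\<lambda>x. \<Sum>b\<leftarrow>as. b x + - ev b [] * W (wt b) x)" unfolding as(2) by metis
  also have "\<dots> \<in> aug_ideal (Oq_SU3_algebra q) (Oq_F3 q)"
    using as(1) wt W bihom_def[OF q]
    by (intro BplusA_sum_list[OF q] weight_vector_mod_BplusA[OF q, where \<chi> = "wt _"]) blast+
  finally show ?thesis .
qed

section \<open>Sums over coproducts\<close>

lemma bilinear_map_sum_right:
  assumes "cspace M" "cspace N" "cspace W" "bilinear_map M N W Q" "x \<in> carrier M" "f \<in> I \<rightarrow> carrier N"
  shows "Q x (\<Oplus>\<^bsub>N\<^esub>i\<in>I. f i) = (\<Oplus>\<^bsub>W\<^esub>i\<in>I. Q x (f i))"
  using assms by (intro linear_map_finsum) (auto simp: bilinear_map_def)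

lemma bilinear_map_sum_left:
  assumes "cspace M" "cspace N" "cspace W" "bilinear_map M N W Q" "y \<in> carrier N" "f \<in> I \<rightarrow> carrier M"
  shows "Q (\<Oplus>\<^bsub>M\<^esub>i\<in>I. f i) y = (\<Oplus>\<^bsub>W\<^esub>i\<in>I. Q (f i) y)"
  using assms linear_map_finsum[of M W "\<lambda>x. Q x y"] by (auto simp: bilinear_map_def)

context
  fixes q :: real
  assumes q: "q \<notin> {-1, 0, 1}"
begin

declare A_space_simps[OF q, simp]

lemma A_space_finsum:
  assumes "\<And>i. i \<in> I \<Longrightarrow> f i \<in> Oq_gen q"
  shows "(\<Oplus>\<^bsub>A_space q\<^esub>i\<in>I. f i) = (\<lambda>x. \<Sum>i\<in>I. f i x)"
proof -
  interpret M: module complex_field "A_space q" by (rule cspace_A_space[OF q])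
  show ?thesis
    using assms
  proof (induction I rule: infinite_finite_induct)
    case (insert i I)
    then show ?case by (subst M.finsum_insert) (auto simp: Pi_def)
  qed (simp_all)
qed

lemma Oq_gen_sum: "(\<And>i. i \<in> I \<Longrightarrow> f i \<in> Oq_gen q) \<Longrightarrow> (\<lambda>x. \<Sum>i\<in>I. f i x) \<in> Oq_gen q"
  by (induction I rule: infinite_finite_induct) (simp_all add: Oq_gen_zero Oq_gen_plus)

lemma Oq_gen_ext: "a \<in> Oq_gen q \<Longrightarrow> b \<in> Oq_gen q \<Longrightarrow> (\<And>w. ev a w = ev b w) \<Longrightarrow> a = b"
  using lin_ext Oq_gen_lin[OF q] by blast

text \<open>Isolates what is used of \<pi> when it is applied to the second leg of a coproduct:
  functionals vanishing on the torus go to zero.\<close>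

definition K_separated :: "(complex, 'w, 'n) module_scheme \<Rightarrow> (functional \<Rightarrow> functional \<Rightarrow> 'w) \<Rightarrow> bool" where
  "K_separated W Q \<longleftrightarrow> bilinear_map (A_space q) (A_space q) W Q \<and>
     (\<forall>x\<in>Oq_gen q. \<forall>y\<in>Oq_gen q. (\<forall>ns. ev y (kw ns) = 0) \<longrightarrow> Q x y = \<zero>\<^bsub>W\<^esub>)"

text \<open>
  A bilinear expression in the two legs of a coproduct only depends on the values of the
  coproduct, and for the second leg only on its restriction to the torus.
\<close>

lemma K_separated_sum_zero:
  assumes W: "cspace W" and Q: "K_separated W Q" and "finite I"
    and "\<And>i. i \<in> I \<Longrightarrow> f i \<in> Oq_gen q \<and> g i \<in> Oq_gen q"
    and "\<And>v ns. (\<Sum>i\<in>I. ev (f i) v * ev (g i) (kw ns)) = 0"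
  shows "(\<Oplus>\<^bsub>W\<^esub>i\<in>I. Q (f i) (g i)) = \<zero>\<^bsub>W\<^esub>"
  using assms(3-5)
proof (induction I arbitrary: f)
  case empty
  interpret W: module complex_field W by (rule W)
  show ?case by simp
next
  case (insert k I)
  interpret W: module complex_field W by (rule W)
  have Qb: "bilinear_map (A_space q) (A_space q) W Q"
    and Qs: "\<And>x y. x \<in> Oq_gen q \<Longrightarrow> y \<in> Oq_gen q \<Longrightarrow> (\<And>ns. ev y (kw ns) = 0) \<Longrightarrow> Q x y = \<zero>\<^bsub>W\<^esub>"
    using Q by (auto simp: K_separated_def)
  note b = bilinear_mapD[OF Qb, simplified]
  have fg: "f i \<in> Oq_gen q" "g i \<in> Oq_gen q" if "i \<in> insert k I" for i using insert.prems(1) that by auto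
  have s: "(\<Sum>i\<in>I. ev (f i) v * ev (g i) (kw ns)) + ev (f k) v * ev (g k) (kw ns) = 0" for v ns
    using insert.prems(2)[of v ns] insert.hyps by (simp add: add.commute)
  have ins: "(\<Oplus>\<^bsub>W\<^esub>i\<in>insert k I. Q (f i) (g i)) = Q (f k) (g k) \<oplus>\<^bsub>W\<^esub> (\<Oplus>\<^bsub>W\<^esub>i\<in>I. Q (f i) (g i))"
    using insert.hyps fg b(1) by (subst W.finsum_insert) auto
  show ?case
  proof (cases "\<forall>v. ev (f k) v = 0")
    case True
    have "f k = (\<lambda>x. 0)" using True fg(1)[of k] by (intro Oq_gen_ext) (auto simp: Oq_gen_zero ev_def)
    \<comment> \<open>Written as a scalar multiple of an element of A, so that homogeneity in the
      first argument applies.\<close>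
    then have "f k = (\<lambda>x. 0 * counit x)" by simp
    then have "Q (f k) (g k) = 0 \<odot>\<^bsub>W\<^esub> Q counit (g k)"
      using b(4)[OF Oq_gen_counit fg(2)[of k], of 0] by simp
    then have "Q (f k) (g k) = \<zero>\<^bsub>W\<^esub>"
      using b(1)[OF Oq_gen_counit fg(2)[of k]] cspaceD(6)[OF W] by simp
    moreover have "(\<Oplus>\<^bsub>W\<^esub>i\<in>I. Q (f i) (g i)) = \<zero>\<^bsub>W\<^esub>"
      using s True fg by (intro insert.IH) auto
    ultimately show ?thesis unfolding ins by simp
  next
    case False
    then obtain v0 where v0: "ev (f k) v0 \<noteq> 0" by blast
    \<comment> \<open>Elimination with pivot \<open>ev (f k) v0\<close>: the hypothesis at
      \<open>v0\<close> expresses \<open>g k\<close> on the torus through the remaining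
      \<open>g i\<close>, and substituting this absorbs the term \<open>k\<close> into the new first
      legs.\<close>
    define c where "c i = ev (f i) v0 / ev (f k) v0" for i
    define f' where "f' i = (\<lambda>x. f i x + - c i * f k x)" for i
    have f': "f' i \<in> Oq_gen q" if "i \<in> I" for i
      unfolding f'_def using fg that by (intro Oq_gen_plus Oq_gen_cmult) auto
    have cg: "(\<lambda>x. - c i * g i x) \<in> Oq_gen q" if "i \<in> I" for i using fg that by (intro Oq_gen_cmult) auto
    have gk: "ev (g k) (kw ns) = - (\<Sum>i\<in>I. c i * ev (g i) (kw ns))" for ns
    proof -
      have "ev (f k) v0 * ev (g k) (kw ns) = - (\<Sum>i\<in>I. ev (f i) v0 * ev (g i) (kw ns))"
        using s[of v0 ns] by (simp add: eq_neg_iff_add_eq_0 add.commute)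
      then show ?thesis
        using v0 unfolding c_def by (simp add: sum_divide_distrib[symmetric] field_simps)
    qed
    have "(\<Oplus>\<^bsub>W\<^esub>i\<in>I. Q (f' i) (g i)) = \<zero>\<^bsub>W\<^esub>"
    proof (rule insert.IH)
      show "f' i \<in> Oq_gen q \<and> g i \<in> Oq_gen q" if "i \<in> I" for i using f' fg that by auto
      show "(\<Sum>i\<in>I. ev (f' i) v * ev (g i) (kw ns)) = 0" for v ns
      proof -
        have "(\<Sum>i\<in>I. ev (f' i) v * ev (g i) (kw ns))
            = (\<Sum>i\<in>I. ev (f i) v * ev (g i) (kw ns)) + ev (f k) v * - (\<Sum>i\<in>I. c i * ev (g i) (kw ns))"
          unfolding f'_def ev_plus ev_cmult
          by (simp add: sum_distrib_left sum_subtractf algebra_simps)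
        then show ?thesis using s[of v ns] gk by simp
      qed
    qed
    moreover have "(\<Oplus>\<^bsub>W\<^esub>i\<in>I. Q (f' i) (g i)) = (\<Oplus>\<^bsub>W\<^esub>i\<in>I. Q (f i) (g i)) \<oplus>\<^bsub>W\<^esub> (\<Oplus>\<^bsub>W\<^esub>i\<in>I. Q (f k) (\<lambda>x. - c i * g i x))"
    proof -
      have "(\<Oplus>\<^bsub>W\<^esub>i\<in>I. Q (f' i) (g i)) = (\<Oplus>\<^bsub>W\<^esub>i\<in>I. Q (f i) (g i) \<oplus>\<^bsub>W\<^esub> Q (f k) (\<lambda>x. - c i * g i x))"
      proof (intro W.finsum_cong' refl)
        fix i assume i: "i \<in> I"
        show "Q (f' i) (g i) = Q (f i) (g i) \<oplus>\<^bsub>W\<^esub> Q (f k) (\<lambda>x. - c i * g i x)"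
          unfolding f'_def using i fg[of i] fg[of k] b(2)[of "f i" "g i" "\<lambda>x. - c i * f k x"] b(4)[of "f k" "g i" "- c i"] b(5)[of "f k" "g i" "- c i"]
            Oq_gen_cmult[of "f k" q "- c i"]
          by simp
      qed (use fg cg in \<open>auto intro!: W.a_closed b(1)\<close>)
      also have "\<dots> = (\<Oplus>\<^bsub>W\<^esub>i\<in>I. Q (f i) (g i)) \<oplus>\<^bsub>W\<^esub> (\<Oplus>\<^bsub>W\<^esub>i\<in>I. Q (f k) (\<lambda>x. - c i * g i x))"
        using fg cg by (intro W.finsum_addf) (auto intro!: b(1))
      finally show ?thesis .
    qed
    moreover have "(\<Oplus>\<^bsub>W\<^esub>i\<in>I. Q (f k) (\<lambda>x. - c i * g i x)) = Q (f k) (g k)"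
    proof -
      let ?s = "\<lambda>x. \<Sum>i\<in>I. - c i * g i x"
      have so: "?s \<in> Oq_gen q" using cg by (rule Oq_gen_sum)
      have "(\<Oplus>\<^bsub>W\<^esub>i\<in>I. Q (f k) (\<lambda>x. - c i * g i x)) = Q (f k) (\<Oplus>\<^bsub>A_space q\<^esub>i\<in>I. (\<lambda>x. - c i * g i x))"
        using fg cg cspace_A_space[OF q] W by (intro bilinear_map_sum_right[OF _ _ _ Qb, symmetric]) auto
      also have "\<dots> = Q (f k) ?s" using cg by (simp only: A_space_finsum)
      also have "\<dots> = Q (f k) (g k)"
      proof -
        \<comment> \<open>The difference of the two second arguments vanishes on the torus by
          \<open>gk\<close>, hence \<open>Q\<close> does not see it.\<close>
        let ?d = "\<lambda>x. ?s x + - 1 * g k x"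
        have "?d \<in> Oq_gen q" using fg(2)[of k] by (intro Oq_gen_plus Oq_gen_cmult so) simp
        then have "Q (f k) ?d = \<zero>\<^bsub>W\<^esub>"
        proof (rule Qs[rotated])
          show "ev ?d (kw ns) = 0" for ns
            using gk[of ns] by (simp add: ev_def sum_negf)
        qed (use fg in simp)
        moreover have "Q (f k) ?d = Q (f k) ?s \<ominus>\<^bsub>W\<^esub> Q (f k) (g k)"
          using fg[of k] so b(3)[of "f k" ?s "\<lambda>x. - 1 * g k x"] b(5)[of "f k" "g k" "- 1"] b(1) Oq_gen_cmult[of "g k" q "- 1"]
          by (simp only: cspace_diff[OF W] insertI1)
        ultimately show ?thesis
          using cspace_diff_zero_iff[OF W] b(1) fg[of k] so by auto
      qed
      finally show ?thesis .
    qed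
    ultimately show ?thesis
      unfolding ins using fg b(1) by (simp add: W.a_comm)
  qed
qed

text \<open>The difference of the two sums is a single sum over the disjoint union of the index
  sets, with the sign placed on the first legs of the second family.\<close>

lemma K_separated_sum_eq:
  fixes I :: "'i set" and J :: "'j set"
  assumes W: "cspace W" and Q: "K_separated W Q" and I: "finite I" "finite J"
    and fg: "\<And>i. i \<in> I \<Longrightarrow> f i \<in> Oq_gen q \<and> g i \<in> Oq_gen q" "\<And>j. j \<in> J \<Longrightarrow> f' j \<in> Oq_gen q \<and> g' j \<in> Oq_gen q"
    and eq: "\<And>v ns. (\<Sum>i\<in>I. ev (f i) v * ev (g i) (kw ns)) = (\<Sum>j\<in>J. ev (f' j) v * ev (g' j) (kw ns))"
  shows "(\<Oplus>\<^bsub>W\<^esub>i\<in>I. Q (f i) (g i)) = (\<Oplus>\<^bsub>W\<^esub>j\<in>J. Q (f' j) (g' j))"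
proof -
  interpret W: module complex_field W by (rule W)
  have Qb: "bilinear_map (A_space q) (A_space q) W Q" using Q by (auto simp: K_separated_def)
  note b = bilinear_mapD[OF Qb, simplified]
  let ?f = "case_sum f (\<lambda>j x. - 1 * f' j x)" and ?g = "case_sum g g'"
  have m: "(\<lambda>x. - 1 * f' j x) \<in> Oq_gen q" if "j \<in> J" for j using fg(2)[OF that] by (intro Oq_gen_cmult) auto
  have z: "(\<Oplus>\<^bsub>W\<^esub>k\<in>I <+> J. Q (?f k) (?g k)) = \<zero>\<^bsub>W\<^esub>"
  proof (rule K_separated_sum_zero[OF W Q])
    show "finite (I <+> J)" using I by simp
    show "?f k \<in> Oq_gen q \<and> ?g k \<in> Oq_gen q" if "k \<in> I <+> J" for k using that fg m by auto
    have "(\<Sum>k\<in>I <+> J. ev (?f k) v * ev (?g k) (kw ns))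
        = (\<Sum>i\<in>I. ev (f i) v * ev (g i) (kw ns)) + (\<Sum>j\<in>J. - 1 * (ev (f' j) v * ev (g' j) (kw ns)))" for v ns
      using I by (simp add: sum.Plus ev_def)
    then show "(\<Sum>k\<in>I <+> J. ev (?f k) v * ev (?g k) (kw ns)) = 0" for v ns
      using eq[of v ns] by (simp add: sum_negf)
  qed
  have e1: "(\<lambda>k. Q (?f k) (?g k)) = case_sum (\<lambda>i. Q (f i) (g i)) (\<lambda>j. Q (\<lambda>x. - 1 * f' j x) (g' j))"
    by (rule ext) (simp split: sum.split)
  have e2: "(\<Oplus>\<^bsub>W\<^esub>k\<in>I <+> J. case_sum (\<lambda>i. Q (f i) (g i)) (\<lambda>j. Q (\<lambda>x. - 1 * f' j x) (g' j)) k)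
      = (\<Oplus>\<^bsub>W\<^esub>i\<in>I. Q (f i) (g i)) \<oplus>\<^bsub>W\<^esub> (\<Oplus>\<^bsub>W\<^esub>j\<in>J. Q (\<lambda>x. - 1 * f' j x) (g' j))"
    using I fg m b(1) by (intro W.finsum_Plus) auto
  have e3: "(\<Oplus>\<^bsub>W\<^esub>j\<in>J. Q (\<lambda>x. - 1 * f' j x) (g' j)) = (- 1) \<odot>\<^bsub>W\<^esub> (\<Oplus>\<^bsub>W\<^esub>j\<in>J. Q (f' j) (g' j))"
  proof -
    have "(\<Oplus>\<^bsub>W\<^esub>j\<in>J. Q (\<lambda>x. - 1 * f' j x) (g' j)) = (\<Oplus>\<^bsub>W\<^esub>j\<in>J. (- 1) \<odot>\<^bsub>W\<^esub> Q (f' j) (g' j))"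
      using fg(2) b(1) cspaceD(1)[OF W] by (intro W.finsum_cong' refl b(4)) auto
    also have "\<dots> = (- 1) \<odot>\<^bsub>W\<^esub> (\<Oplus>\<^bsub>W\<^esub>j\<in>J. Q (f' j) (g' j))"
      using fg(2) b(1) I by (intro W.finsum_smult_ldistr[symmetric]) auto
    finally show ?thesis .
  qed
  have e4: "(\<Oplus>\<^bsub>W\<^esub>i\<in>I. Q (f i) (g i)) \<in> carrier W" "(\<Oplus>\<^bsub>W\<^esub>j\<in>J. Q (f' j) (g' j)) \<in> carrier W"
    using fg b(1) by (auto intro!: W.finsum_closed)
  have "(\<Oplus>\<^bsub>W\<^esub>i\<in>I. Q (f i) (g i)) \<ominus>\<^bsub>W\<^esub> (\<Oplus>\<^bsub>W\<^esub>j\<in>J. Q (f' j) (g' j)) = \<zero>\<^bsub>W\<^esub>"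
    using z unfolding e1 e2 e3 cspace_diff[OF W e4] .
  then show ?thesis using cspace_diff_zero_iff[OF W e4] by simp
qed

end

section \<open>The tangent space\<close>

text \<open>The scalar that arises when \<open>K i\<close> is moved to the right past one
  letter.\<close>

fun letter_wt :: "real \<Rightarrow> node \<Rightarrow> qgen \<Rightarrow> complex" where
  "letter_wt q i (GE j) = qc q i j"
| "letter_wt q i (GF j) = 1 / qc q i j"
| "letter_wt q i (GK j) = 1"
| "letter_wt q i (GKi j) = 1"

lemma uqw_K_word:
  assumes "q \<noteq> 0" "uqw q \<phi>"
  shows "\<phi> (us @ GK i # w @ vs) = prod_list (map (letter_wt q i) w) * \<phi> (us @ w @ GK i # vs)"
proof (induction w arbitrary: us)
  case (Cons g w)
  have "\<phi> (us @ GK i # g # w @ vs) = letter_wt q i g * \<phi> ((us @ [g]) @ GK i # w @ vs)"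
    using uqw_KE[OF assms, of us i] uqw_KF[OF assms, of us i] uqw_KK[OF assms, of us i] uqw_KiK[OF assms, of us _ i]
    by (cases g) simp_all
  then show ?case unfolding Cons by simp
qed simp

lemma uqw_kw_word:
  assumes "q \<noteq> 0" "uqw q \<phi>"
  shows "\<phi> (us @ kw ns @ w @ vs) = prod_list (map (\<lambda>i. prod_list (map (letter_wt q i) w)) ns) * \<phi> (us @ w @ kw ns @ vs)"
proof (induction ns arbitrary: us)
  case (Cons n ns)
  have "\<phi> (us @ kw (n # ns) @ w @ vs) = \<phi> ((us @ [GK n]) @ kw ns @ w @ vs)" by simp
  also have "\<dots> = prod_list (map (\<lambda>i. prod_list (map (letter_wt q i) w)) ns) * \<phi> (us @ GK n # w @ kw ns @ vs)"
    unfolding Cons by simp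
  finally show ?case unfolding uqw_K_word[OF assms, of us n w] by simp
qed simp

lemma star_add: "star (x + y) = star x + star y"
  unfolding star_def by (rule setsum_keys_plus_distrib) (simp_all add: scal_def single_add distrib_right)

lemma star_single: "star (Poly_Mapping.single w c) = scal (cnj c) * prod_list (map star_gen (rev (letters w)))"
  by (cases "c = 0") (simp_all add: star_def scal_def)

lemma star_diff_single:
  "star (x - Poly_Mapping.single w c) = star x - scal (cnj c) * prod_list (map star_gen (rev (letters w)))"
proof -
  have "star (x + Poly_Mapping.single w (- c)) = star x - scal (cnj c) * prod_list (map star_gen (rev (letters w)))"
    unfolding star_add star_single by (simp add: scal_def single_uminus)
  then show ?thesis by (simp add: single_uminus)
qed

lemma scal_one [simp]: "scal 1 = (1 :: free_alg)"
  by (simp add: scal_def)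

text \<open>\<open>True\<close> selects E and \<open>False\<close> selects F. A single index set
  lets all six tangent vectors, and the forms dual to them, be treated alike.\<close>

definition tangent_vec :: "real \<Rightarrow> posroot \<times> bool \<Rightarrow> free_alg" where
  "tangent_vec q t = (if snd t then Epos q (fst t) else Fpos q (fst t))"

text \<open>Row and column of the matrix unit by which \<open>Epos\<close> acts in the vector
  representation. For \<open>A12\<close> the product \<open>E_1 E_2\<close> acts as 0, so the matrix
  is that of \<open>E_2 E_1\<close>.\<close>

fun troot :: "posroot \<Rightarrow> nat \<times> nat" where
  "troot A1 = (2, 1)" | "troot A2 = (3, 2)" | "troot A12 = (3, 1)"

definition trow :: "posroot \<times> bool \<Rightarrow> nat" where
  "trow t = (if snd t then fst (troot (fst t)) else snd (troot (fst t)))"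

definition tcol :: "posroot \<times> bool \<Rightarrow> nat" where
  "tcol t = (if snd t then snd (troot (fst t)) else fst (troot (fst t)))"

lemma trow_tcol: "trow t \<in> {1..3}" "tcol t \<in> {1..3}"
  by (cases "fst t"; simp add: trow_def tcol_def)+

text \<open>A matrix unit X in row r and column c satisfies \<open>K X = (wt r / wt c) X K\<close>.
  The quotient is spelled as a product to match \<open>good_mult\<close> and
  \<open>good_inverse\<close>.\<close>

definition tangent_wt :: "real \<Rightarrow> posroot \<times> bool \<Rightarrow> node \<Rightarrow> complex" where
  "tangent_wt q t i = u_wt q (trow t) i * (1 / u_wt q (tcol t) i)"

lemma posroot_split: "P (t :: posroot \<times> bool)" if "P (A1, True)" "P (A2, True)" "P (A12, True)"
  "P (A1, False)" "P (A2, False)" "P (A12, False)"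
proof (cases t)
  case (Pair \<gamma> b)
  then show ?thesis using that by (cases \<gamma>; cases b) auto
qed

lemma UNIV_posroot: "(UNIV :: posroot set) = {A1, A2, A12}"
  using posroot.exhaust by auto

lemma tangent_vec_simps:
  "tangent_vec q (A1, True) = wrd [GE N1]" "tangent_vec q (A2, True) = wrd [GE N2]"
  "tangent_vec q (A12, True) = wrd [GE N2, GE N1] - scal (1 / complex_of_real q) * wrd [GE N1, GE N2]"
  "tangent_vec q (A1, False) = wrd [GK N1, GF N1]" "tangent_vec q (A2, False) = wrd [GK N2, GF N2]"
  "tangent_vec q (A12, False) = wrd [GK N1, GF N1, GK N2, GF N2] - scal (1 / complex_of_real q) * wrd [GK N2, GF N2, GK N1, GF N1]"
proof -
  show "tangent_vec q (A1, True) = wrd [GE N1]" "tangent_vec q (A2, True) = wrd [GE N2]"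
    by (simp_all add: tangent_vec_def gen_def)
  show E12: "tangent_vec q (A12, True) = wrd [GE N2, GE N1] - scal (1 / complex_of_real q) * wrd [GE N1, GE N2]"
    by (simp add: tangent_vec_def gen_eq_wrd wrd_append mult.assoc)
  show "tangent_vec q (A1, False) = wrd [GK N1, GF N1]" "tangent_vec q (A2, False) = wrd [GK N2, GF N2]"
    by (simp_all add: tangent_vec_def Fpos_def gen_eq_wrd star_single wrd_append)
  have "Epos q A12 = wrd [GE N2, GE N1] - Poly_Mapping.single (Word [GE N1, GE N2]) (1 / complex_of_real q)"
    using E12 by (simp add: tangent_vec_def scal_def mult_single zero_word_def plus_word_def del: Epos.simps)
  then show "tangent_vec q (A12, False) = wrd [GK N1, GF N1, GK N2, GF N2] - scal (1 / complex_of_real q) * wrd [GK N2, GF N2, GK N1, GF N1]"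
    by (simp add: tangent_vec_def Fpos_def star_diff_single star_single gen_eq_wrd wrd_append del: Epos.simps)
qed

text \<open>The factors for F undo the powers of q in the vector representation:
  \<open>K_i F_i\<close> has the entry 1/q, and \<open>K_1 F_1 K_2 F_2\<close> has the entry 1/q^2,
  while \<open>K_2 F_2 K_1 F_1\<close> acts as 0.\<close>

definition dual_elem :: "real \<Rightarrow> posroot \<times> bool \<Rightarrow> functional" where
  "dual_elem q t = (\<lambda>x. (if snd t then 1 else if fst t = A12 then (complex_of_real q)\<^sup>2 else complex_of_real q)
     * u q (trow t) (tcol t) x)"

lemma dual_elem_tangent_vec:
  assumes "q \<noteq> 0"
  shows "dual_elem q t (tangent_vec q s) = (if s = t then 1 else 0)"
proof -
  have c: "u q i j (wrd w) = word_matrix q w i j" "u q i j (x - y) = u q i j x - u q i j y"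
    "u q i j (scal c * x) = c * u q i j x" for i j w x y c
    by (metis ev_def ev_u, rule lin_diff[OF lin_u], rule linD(2)[OF lin_u])
  have "complex_of_real q * complex_of_real q * (inverse (complex_of_real q) * inverse (complex_of_real q)) = 1"
    using assms by (simp add: field_simps)
  then show ?thesis
    using assms
    by (induction t rule: posroot_split; induction s rule: posroot_split)
      (simp_all add: dual_elem_def trow_def tcol_def tangent_vec_simps c sum_Suc_0_3 power_int_minus power2_eq_square)
qed

text \<open>Commutation with the torus up to a character is imposed under functionals of A, because
  the free algebra itself does not satisfy the relations.\<close>

definition has_wt :: "real \<Rightarrow> free_alg \<Rightarrow> (node \<Rightarrow> complex) \<Rightarrow> bool" where
  "has_wt q X \<gamma> \<longleftrightarrow> (\<forall>a\<in>Oq_gen q. \<forall>s ns. a (wrd s * wrd (kw ns) * X) = prod_list (map \<gamma> ns) * a (wrd s * X * wrd (kw ns)))"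

lemma has_wt_wrd:
  assumes q: "q \<notin> {-1, 0, 1}" and \<gamma>: "\<And>i. prod_list (map (letter_wt q i) w) = \<gamma> i"
  shows "has_wt q (wrd w) \<gamma>"
  unfolding has_wt_def wrd_append
proof (intro ballI allI)
  fix a s ns assume "a \<in> Oq_gen q"
  then have "uqw q (ev a)" using Oq_gen_uqw[OF q] by blast
  then show "a (wrd ((s @ kw ns) @ w)) = prod_list (map \<gamma> ns) * a (wrd ((s @ w) @ kw ns))"
    using uqw_kw_word[of q "ev a" s ns w "[]"] q by (simp add: ev_def \<gamma>)
qed

text \<open>Used for \<open>A12\<close>, where the vector is a combination of two monomials of the
  same weight.\<close>

lemma has_wt_diff:
  assumes q: "q \<notin> {-1, 0, 1}" and "has_wt q X \<gamma>" "has_wt q Y \<gamma>"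
  shows "has_wt q (X - scal c * Y) \<gamma>"
proof -
  have s: "wrd s * wrd t * (scal c * Y) = scal c * (wrd s * wrd t * Y)" "wrd s * (scal c * Y) * wrd t = scal c * (wrd s * Y * wrd t)" for s t
    by (metis mult.assoc scal_commute)+
  show ?thesis
    using assms Oq_gen_lin[OF q] unfolding has_wt_def
    by (auto simp: right_diff_distrib left_diff_distrib s lin_diff linD)
qed

lemma has_wt_tangent_vec:
  assumes q: "q \<notin> {-1, 0, 1}"
  shows "has_wt q (tangent_vec q t) (tangent_wt q t)"
proof -
  have q0: "complex_of_real q \<noteq> 0" using q by simp
  show ?thesis
  proof (induction t rule: posroot_split)
    case 1 show ?case unfolding tangent_vec_simps
      by (rule has_wt_wrd[OF q]; rename_tac i; case_tac i) (use q0 in \<open>simp_all add: tangent_wt_def trow_def tcol_def u_wt_def qc_def power_int_minus power2_eq_square field_simps\<close>)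
  next
    case 2 show ?case unfolding tangent_vec_simps
      by (rule has_wt_wrd[OF q]; rename_tac i; case_tac i) (use q0 in \<open>simp_all add: tangent_wt_def trow_def tcol_def u_wt_def qc_def power_int_minus power2_eq_square field_simps\<close>)
  next
    case 3 show ?case unfolding tangent_vec_simps
      by (intro has_wt_diff[OF q]; rule has_wt_wrd[OF q]; rename_tac i; case_tac i) (use q0 in \<open>simp_all add: tangent_wt_def trow_def tcol_def u_wt_def qc_def power_int_minus power2_eq_square field_simps\<close>)
  next
    case 4 show ?case unfolding tangent_vec_simps
      by (rule has_wt_wrd[OF q]; rename_tac i; case_tac i) (use q0 in \<open>simp_all add: tangent_wt_def trow_def tcol_def u_wt_def qc_def power_int_minus power2_eq_square field_simps\<close>)
  next
    case 5 show ?case unfolding tangent_vec_simps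
      by (rule has_wt_wrd[OF q]; rename_tac i; case_tac i) (use q0 in \<open>simp_all add: tangent_wt_def trow_def tcol_def u_wt_def qc_def power_int_minus power2_eq_square field_simps\<close>)
  next
    case 6 show ?case unfolding tangent_vec_simps
      by (intro has_wt_diff[OF q]; rule has_wt_wrd[OF q]; rename_tac i; case_tac i) (use q0 in \<open>simp_all add: tangent_wt_def trow_def tcol_def u_wt_def qc_def power_int_minus power2_eq_square field_simps\<close>)
  qed
qed

text \<open>An element realizing the inverse character restricts to exactly that character on the
  torus, because its counit is 1.\<close>

lemma inv_wt_elem_exists:
  assumes q: "q \<notin> {-1, 0, 1}"
  shows "\<exists>w\<in>Oq_gen q. \<forall>ns. prod_list (map (tangent_wt q t) ns) * ev w (kw ns) = 1"
proof -
  let ?\<chi> = "\<lambda>i. 1 / (u_wt q (trow t) i * (1 / u_wt q (tcol t) i))"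
  have "good q ?\<chi>"
    by (intro good_inverse[OF q] good_mult[OF q] good_u[OF q] trow_tcol)
  then obtain w ps where w: "realizes q ?\<chi> w ps" by (auto simp: good_def)
  have "ev w ([] @ kw ns) = prod_list (map ?\<chi> ns) * ev w []" for ns
    by (rule rwt_kw[OF realizes_rwt[OF w]])
  moreover have "prod_list (map (tangent_wt q t) ns) * prod_list (map ?\<chi> ns) = 1" for ns
    using q u_wt_nonzero[of q] by (induction ns) (simp_all add: tangent_wt_def)
  moreover have "w \<in> Oq_gen q" "ev w [] = 1" using w by (simp_all add: realizes_def)
  ultimately show ?thesis by (intro bexI[of _ w]) auto
qed

section \<open>The forms\<close>

lemma convw_sum_left: "convw (\<lambda>w. \<Sum>x\<in>I. \<phi> x w) \<psi> w = (\<Sum>x\<in>I. convw (\<phi> x) \<psi> w)"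
  using convw_cmult_left[of 0 "\<lambda>w. 0"]
  by (induction I rule: infinite_finite_induct) (simp_all add: convw_add_left)

lemma convw_sum_right: "convw \<phi> (\<lambda>w. \<Sum>x\<in>I. \<psi> x w) w = (\<Sum>x\<in>I. convw \<phi> (\<psi> x) w)"
  using convw_cmult_right[of _ 0 "\<lambda>w. 0"]
  by (induction I rule: infinite_finite_induct) (simp_all add: convw_add_right)

lemma convw_kw: "convw \<phi> \<psi> (kw ns) = \<phi> (kw ns) * \<psi> (kw ns)"
  by (induction ns arbitrary: \<phi> \<psi>) simp_all

text \<open>Torus monomials are group-like, so right translation by them is multiplicative for
  convolution.\<close>

lemma convw_append_kw: "convw \<phi> \<psi> (v @ kw ns) = convw (\<lambda>s. \<phi> (s @ kw ns)) (\<lambda>s. \<psi> (s @ kw ns)) v"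
proof -
  have "splits (kw ns) = [(kw ns, kw ns)]" by (induction ns) simp_all
  then show ?thesis unfolding convw_append2 by simp
qed

lemma cspace_free_algebra: "cspace free_algebra"
proof -
  interpret ring free_algebra by (rule ring_free_algebra)
  have "scal (c + d) = scal c + (scal d :: free_alg)" "scal (c * d) = scal c * (scal d :: free_alg)" for c d
    by (simp_all add: scal_def single_add mult_single)
  then show ?thesis
    by (intro cspaceI abelian_group_axioms) (auto simp: algebra_simps)
qed

context
  fixes q :: real
  assumes q: "q \<notin> {-1, 0, 1}"
begin

declare A_space_simps[OF q, simp]

abbreviation (input) "Aplus_space \<equiv> (A_space q)\<lparr>carrier := Oq_SU3_plus q\<rparr>"

lemma Oq_SU3_plus_iff: "y \<in> Oq_SU3_plus q \<longleftrightarrow> y \<in> Oq_gen q \<and> y 1 = 0"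
  by (simp add: Oq_SU3_plus_def Oq_SU3_eq_Oq_gen[OF q])

lemma cspace_Aplus_space: "cspace Aplus_space"
  by (intro cspace_subspace cspace_A_space[OF q] csubspaceI) (auto simp: Oq_SU3_plus_iff Oq_gen_zero Oq_gen_plus Oq_gen_cmult)

lemma tangent_vec_in_tangent_space: "tangent_vec q t \<in> tangent_space q"
  unfolding tangent_space_def by (rule subsetD[OF lin_span_superset]) (auto simp: tangent_vec_def)

lemma vanishes_on_tangent_space:
  assumes "lin y" "\<And>t. y (tangent_vec q t) = 0" "X \<in> tangent_space q"
  shows "y X = 0"
proof -
  have "csubspace {x. y x = 0} free_algebra"
    using assms(1) by (intro csubspaceI cspace_free_algebra) (auto simp: linD lin_zero)
  moreover have "range (Epos q) \<union> range (Fpos q) \<subseteq> {x. y x = 0}"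
    using assms(2)[of "(_, True)"] assms(2)[of "(_, False)"] by (auto simp: tangent_vec_def)
  ultimately show ?thesis
    using lin_span_least assms(3) unfolding tangent_space_def by blast
qed

text \<open>Vanishing on a span is vanishing on the spanning vectors, so a coset in
  \<open>Lambda1\<close> is determined by six numbers.\<close>

lemma Lambda1_null_iff: "y \<in> Lambda1_null q \<longleftrightarrow> y \<in> Oq_gen q \<and> y 1 = 0 \<and> (\<forall>t. y (tangent_vec q t) = 0)"
  using vanishes_on_tangent_space[OF Oq_gen_lin[OF q]] tangent_vec_in_tangent_space
  by (auto simp: Lambda1_null_def Oq_SU3_plus_iff)

lemma csubspace_null: "csubspace (Lambda1_null q) Aplus_space"
  by (intro csubspaceI cspace_Aplus_space) (auto simp: Lambda1_null_iff Oq_SU3_plus_iff Oq_gen_zero Oq_gen_plus Oq_gen_cmult)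

lemma cspace_Lambda1: "cspace (Lambda1 q)"
  unfolding Lambda1_def by (intro cspace_quot_space cspace_Aplus_space csubspace_null)

lemma mem_null_coset:
  assumes "y \<in> Oq_SU3_plus q"
  shows "y' \<in> Lambda1_null q +>\<^bsub>Aplus_space\<^esub> y \<longleftrightarrow> y' \<in> Oq_SU3_plus q \<and> (\<forall>t. y' (tangent_vec q t) = y (tangent_vec q t))"
proof -
  have "y' \<ominus>\<^bsub>Aplus_space\<^esub> y = (\<lambda>x. y' x + - 1 * y x)" if "y' \<in> Oq_SU3_plus q"
    using assms that by (subst cspace_diff[OF cspace_Aplus_space]) auto
  moreover have "(\<lambda>x. y' x + - 1 * y x) \<in> Oq_gen q" if "y' \<in> Oq_SU3_plus q"
    using assms that by (intro Oq_gen_plus Oq_gen_cmult) (auto simp: Oq_SU3_plus_iff)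
  ultimately show ?thesis
    using assms by (subst mem_coset_iff[OF cspace_Aplus_space csubspace_null]) (auto simp: Lambda1_null_iff Oq_SU3_plus_iff)
qed

lemma null_coset_eqI:
  assumes "y \<in> Oq_SU3_plus q" "y' \<in> Oq_SU3_plus q" "\<And>t. y' (tangent_vec q t) = y (tangent_vec q t)"
  shows "Lambda1_null q +>\<^bsub>Aplus_space\<^esub> y' = Lambda1_null q +>\<^bsub>Aplus_space\<^esub> y"
  using assms mem_null_coset by auto

section \<open>Coordinates on \<open>Lambda1\<close> and the dual basis\<close>

lemma Lambda1_cases:
  assumes "v \<in> carrier (Lambda1 q)"
  obtains y where "y \<in> Oq_SU3_plus q" "v = Lambda1_null q +>\<^bsub>Aplus_space\<^esub> y"
  using assms coset_cases[OF cspace_Aplus_space csubspace_null, of v] unfolding Lambda1_def by auto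

text \<open>Every representative gives the same value, by \<open>mem_null_coset\<close>.\<close>

definition coord :: "posroot \<times> bool \<Rightarrow> functional set \<Rightarrow> complex" where
  "coord t v = (SOME y. y \<in> v) (tangent_vec q t)"

lemma coord_coset:
  assumes "y \<in> Oq_SU3_plus q"
  shows "coord t (Lambda1_null q +>\<^bsub>Aplus_space\<^esub> y) = y (tangent_vec q t)"
proof -
  have "y \<in> Lambda1_null q +>\<^bsub>Aplus_space\<^esub> y" using assms mem_null_coset by blast
  then have "(SOME y'. y' \<in> Lambda1_null q +>\<^bsub>Aplus_space\<^esub> y) \<in> Lambda1_null q +>\<^bsub>Aplus_space\<^esub> y"
    by (auto simp: some_in_eq)
  then show ?thesis unfolding coord_def using assms mem_null_coset by blast
qed

lemma coord_add:
  assumes "v \<in> carrier (Lambda1 q)" "v' \<in> carrier (Lambda1 q)"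
  shows "coord t (v \<oplus>\<^bsub>Lambda1 q\<^esub> v') = coord t v + coord t v'"
proof -
  obtain y where y: "y \<in> Oq_SU3_plus q" "v = Lambda1_null q +>\<^bsub>Aplus_space\<^esub> y" using assms(1) by (rule Lambda1_cases)
  obtain y' where y': "y' \<in> Oq_SU3_plus q" "v' = Lambda1_null q +>\<^bsub>Aplus_space\<^esub> y'" using assms(2) by (rule Lambda1_cases)
  have "v \<oplus>\<^bsub>Lambda1 q\<^esub> v' = Lambda1_null q +>\<^bsub>Aplus_space\<^esub> (\<lambda>x. y x + y' x)"
    unfolding y y' Lambda1_def using y(1) y'(1) by (subst coset_add[OF cspace_Aplus_space csubspace_null]) auto
  moreover have "(\<lambda>x. y x + y' x) \<in> Oq_SU3_plus q" using y y' by (auto simp: Oq_SU3_plus_iff Oq_gen_plus)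
  ultimately show ?thesis using y y' by (simp add: coord_coset)
qed

lemma coord_smult:
  assumes "v \<in> carrier (Lambda1 q)"
  shows "coord t (c \<odot>\<^bsub>Lambda1 q\<^esub> v) = c * coord t v"
proof -
  obtain y where y: "y \<in> Oq_SU3_plus q" "v = Lambda1_null q +>\<^bsub>Aplus_space\<^esub> y" using assms(1) by (rule Lambda1_cases)
  have "c \<odot>\<^bsub>Lambda1 q\<^esub> v = Lambda1_null q +>\<^bsub>Aplus_space\<^esub> (\<lambda>x. c * y x)"
    unfolding y Lambda1_def using y(1) by (subst coset_smult[OF cspace_Aplus_space csubspace_null]) auto
  moreover have "(\<lambda>x. c * y x) \<in> Oq_SU3_plus q" using y by (auto simp: Oq_SU3_plus_iff Oq_gen_cmult)
  ultimately show ?thesis using y by (simp add: coord_coset)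
qed

definition dual_form :: "posroot \<times> bool \<Rightarrow> functional set" where
  "dual_form t = (if snd t then e_form q (fst t) else f_form q (fst t))"

lemma dual_elem_plus: "dual_elem q t \<in> Oq_SU3_plus q"
proof -
  have "trow t \<noteq> tcol t" by (cases "fst t") (simp_all add: trow_def tcol_def)
  then show ?thesis
    unfolding Oq_SU3_plus_iff dual_elem_def eval_one[of "u q (trow t) (tcol t)"]
    by (auto intro!: Oq_gen_cmult Oq_gen_u trow_tcol[simplified])
qed

text \<open>The forms are definite descriptions, so existence and uniqueness are both due: the coset
  of \<open>dual_elem\<close> has the required values, and any other candidate has the same six
  values and is therefore the same coset.\<close>

lemma dual_form_eq: "dual_form t = Lambda1_null q +>\<^bsub>Aplus_space\<^esub> dual_elem q t"
proof -
  let ?C = "Lambda1_null q +>\<^bsub>Aplus_space\<^esub> dual_elem q t"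
  have q0: "q \<noteq> 0" using q by simp
  have C: "?C \<in> carrier (Lambda1 q)"
    unfolding Lambda1_def using dual_elem_plus by (intro coset_closed[OF cspace_Aplus_space csubspace_null]) simp
  have v: "y (tangent_vec q s) = (if s = t then 1 else 0)" if "y \<in> ?C" for y s
    using that unfolding mem_null_coset[OF dual_elem_plus] by (simp only: dual_elem_tangent_vec[OF q0])
  have un: "v = ?C" if vv: "v \<in> carrier (Lambda1 q)" "\<And>y s. y \<in> v \<Longrightarrow> y (tangent_vec q s) = (if s = t then 1 else 0)" for v
  proof -
    obtain y where y: "y \<in> Oq_SU3_plus q" "v = Lambda1_null q +>\<^bsub>Aplus_space\<^esub> y" using vv(1) by (rule Lambda1_cases)
    have "y \<in> v" unfolding y(2) using y(1) mem_null_coset by blast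
    then show ?thesis unfolding y(2) using vv(2) y dual_elem_plus dual_elem_tangent_vec[OF q0] by (intro null_coset_eqI) auto
  qed
  have tvE: "tangent_vec q (\<delta>, True) = Epos q \<delta>" "tangent_vec q (\<delta>, False) = Fpos q \<delta>" for \<delta>
    by (simp_all add: tangent_vec_def)
  obtain \<gamma> b where t: "t = (\<gamma>, b)" by force
  show ?thesis
  proof (cases b)
    case True
    have "e_form q \<gamma> = ?C"
      unfolding e_form_def
    proof (rule the_equality)
      show "?C \<in> carrier (Lambda1 q) \<and> (\<forall>y\<in>?C. \<forall>\<delta>. y (Epos q \<delta>) = (if \<delta> = \<gamma> then 1 else 0) \<and> y (Fpos q \<delta>) = 0)"
        using C v[of _ "(_, True)"] v[of _ "(_, False)"] True by (auto simp: t tvE)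
    next
      fix w assume w: "w \<in> carrier (Lambda1 q) \<and> (\<forall>y\<in>w. \<forall>\<delta>. y (Epos q \<delta>) = (if \<delta> = \<gamma> then 1 else 0) \<and> y (Fpos q \<delta>) = 0)"
      show "w = ?C"
      proof (rule un)
        fix y s assume "y \<in> w"
        then show "y (tangent_vec q s) = (if s = t then 1 else 0)" using w True by (cases s) (auto simp: t tangent_vec_def)
      qed (use w in blast)
    qed
    then show ?thesis using True by (simp add: dual_form_def t)
  next
    case False
    have "f_form q \<gamma> = ?C"
      unfolding f_form_def
    proof (rule the_equality)
      show "?C \<in> carrier (Lambda1 q) \<and> (\<forall>y\<in>?C. \<forall>\<delta>. y (Epos q \<delta>) = 0 \<and> y (Fpos q \<delta>) = (if \<delta> = \<gamma> then 1 else 0))"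
        using C v[of _ "(_, True)"] v[of _ "(_, False)"] False by (auto simp: t tvE)
    next
      fix w assume w: "w \<in> carrier (Lambda1 q) \<and> (\<forall>y\<in>w. \<forall>\<delta>. y (Epos q \<delta>) = 0 \<and> y (Fpos q \<delta>) = (if \<delta> = \<gamma> then 1 else 0))"
      show "w = ?C"
      proof (rule un)
        fix y s assume "y \<in> w"
        then show "y (tangent_vec q s) = (if s = t then 1 else 0)" using w False by (cases s) (auto simp: t tangent_vec_def)
      qed (use w in blast)
    qed
    then show ?thesis using False by (simp add: dual_form_def t)
  qed
qed

lemma dual_form_closed: "dual_form t \<in> carrier (Lambda1 q)"
  unfolding dual_form_eq Lambda1_def using dual_elem_plus by (intro coset_closed[OF cspace_Aplus_space csubspace_null]) simp

lemma coord_dual_form: "coord s (dual_form t) = (if s = t then 1 else 0)"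
  unfolding dual_form_eq coord_coset[OF dual_elem_plus] using q by (intro dual_elem_tangent_vec) simp

section \<open>The coaction on multiples of a single basis form\<close>

abbreviation (input) "\<Omega> \<equiv> Omega1_space q"
abbreviation (input) "piA \<equiv> qhs_quot (A_space q) (Oq_F3 q)"
abbreviation (input) "\<Omega>P \<equiv> tensor \<Omega> piA"
abbreviation (input) "\<pi> \<equiv> qhs_proj (A_space q) (Oq_F3 q)"

lemma cspace_Omega: "cspace \<Omega>"
  unfolding Omega1_space_def by (intro cspace_tensor cspace_A_space[OF q] cspace_Lambda1)

lemma cspace_piA: "cspace piA"
  unfolding qhs_quot_def by (intro cspace_quot_space cspace_A_space[OF q] csubspace_BplusA[OF q])

lemma cspace_OmegaP: "cspace \<Omega>P"
  by (intro cspace_tensor cspace_Omega cspace_piA)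

lemma linear_proj: "linear_map (A_space q) piA \<pi>"
  unfolding linear_map_def qhs_quot_def qhs_proj_def
proof (intro conjI funcsetI ballI allI)
  note F = cspace_A_space[OF q] csubspace_BplusA[OF q]
  show "\<And>x. x \<in> carrier (A_space q) \<Longrightarrow> BplusA q +>\<^bsub>A_space q\<^esub> x \<in> carrier (quot_space (A_space q) (BplusA q))"
    by (rule coset_closed[OF F])
  show "BplusA q +>\<^bsub>A_space q\<^esub> (x \<oplus>\<^bsub>A_space q\<^esub> y) = (BplusA q +>\<^bsub>A_space q\<^esub> x) \<oplus>\<^bsub>quot_space (A_space q) (BplusA q)\<^esub> (BplusA q +>\<^bsub>A_space q\<^esub> y)"
    if "x \<in> carrier (A_space q)" "y \<in> carrier (A_space q)" for x y
    by (rule coset_add[OF F that, symmetric])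
  show "BplusA q +>\<^bsub>A_space q\<^esub> (c \<odot>\<^bsub>A_space q\<^esub> x) = c \<odot>\<^bsub>quot_space (A_space q) (BplusA q)\<^esub> (BplusA q +>\<^bsub>A_space q\<^esub> x)"
    if "x \<in> carrier (A_space q)" for c x
    by (rule coset_smult[OF F that, symmetric])
qed

definition coact_term :: "posroot \<times> bool \<Rightarrow> functional \<Rightarrow> functional \<Rightarrow> (su3_form \<times> functional set \<Rightarrow>\<^sub>0 complex) set" where
  "coact_term t x y = ptensor \<Omega> piA (form_tensor q x (dual_form t)) (\<pi> y)"

lemma bilinear_form_tensor: "bilinear_map (A_space q) (Lambda1 q) \<Omega> (form_tensor q)"
  unfolding Omega1_space_def by (intro bilinear_ptensor cspace_A_space[OF q] cspace_Lambda1)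

lemma bilinear_ptensor_OmegaP: "bilinear_map \<Omega> piA \<Omega>P (ptensor \<Omega> piA)"
  by (intro bilinear_ptensor cspace_Omega cspace_piA)

text \<open>The second argument enters through \<pi>, whose kernel contains the functionals
  vanishing on the torus by \<open>vanishing_on_K_in_BplusA\<close>.\<close>

lemma K_separated_coact_term: "K_separated q \<Omega>P (coact_term t)"
  unfolding K_separated_def[OF q]
proof (intro conjI ballI impI)
  note f = bilinear_mapD[OF bilinear_form_tensor _ dual_form_closed[of t]]
  note p = bilinear_mapD[OF bilinear_ptensor_OmegaP]
  note l = linear_mapD[OF linear_proj]
  show "bilinear_map (A_space q) (A_space q) \<Omega>P (coact_term t)"
    unfolding coact_term_def by (rule bilinear_mapI) (simp_all only: f p l)
  fix x y assume "x \<in> Oq_gen q" and y: "y \<in> Oq_gen q" "\<forall>ns. ev y (kw ns) = 0"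
  then have x: "form_tensor q x (dual_form t) \<in> carrier \<Omega>" using f(1)[of x] by simp
  have "\<pi> y = \<zero>\<^bsub>piA\<^esub>"
    unfolding qhs_proj_def qhs_quot_def using y
    by (intro coset_zero[OF cspace_A_space[OF q] csubspace_BplusA[OF q]] vanishing_on_K_in_BplusA[OF q]) auto
  then show "coact_term t x y = \<zero>\<^bsub>\<Omega>P\<^esub>"
    unfolding coact_term_def using bilinear_ptensor_OmegaP x linear_map_zero[OF cspace_piA cspace_OmegaP]
    by (simp add: bilinear_map_def)
qed

text \<open>A coproduct decomposition exhibits the result as a combination of the first legs, with
  the values of the second legs at \<open>X\<close> as coefficients.\<close>

lemma Oq_gen_act:
  assumes "a \<in> Oq_gen q"
  shows "act X a \<in> Oq_gen q"
proof -
  obtain n f g where d: "coprod_decomp (Oq_gen q) a n f g" using assms by (rule Oq_gen_decomp[OF q])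
  then have "act X a = (\<lambda>Y. \<Sum>i<n. g i X * f i Y)"
    by (simp add: act_def coprod_decomp_def mult.commute)
  also have "\<dots> \<in> Oq_gen q"
    using d by (intro Oq_gen_sum[OF q] Oq_gen_cmult) (auto simp: coprod_decomp_def)
  finally show ?thesis .
qed

definition inv_wt_elem :: "posroot \<times> bool \<Rightarrow> functional" where
  "inv_wt_elem t = (SOME w. w \<in> Oq_gen q \<and> (\<forall>ns. prod_list (map (tangent_wt q t) ns) * ev w (kw ns) = 1))"

lemma inv_wt_elem: "inv_wt_elem t \<in> Oq_gen q" "prod_list (map (tangent_wt q t) ns) * ev (inv_wt_elem t) (kw ns) = 1"
proof -
  have "inv_wt_elem t \<in> Oq_gen q \<and> (\<forall>ns. prod_list (map (tangent_wt q t) ns) * ev (inv_wt_elem t) (kw ns) = 1)"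
    using someI_ex[OF inv_wt_elem_exists[OF q, of t, unfolded Bex_def]] unfolding inv_wt_elem_def .
  then show "inv_wt_elem t \<in> Oq_gen q" "prod_list (map (tangent_wt q t) ns) * ev (inv_wt_elem t) (kw ns) = 1" by auto
qed

text \<open>The intended image of b \<otimes> \<open>dual_form t\<close>. Decompositions of a
  coproduct are not canonical, so one is chosen; \<open>coact_eqI\<close> removes the dependence on
  the choice.\<close>

definition coact :: "posroot \<times> bool \<Rightarrow> functional \<Rightarrow> (su3_form \<times> functional set \<Rightarrow>\<^sub>0 complex) set" where
  "coact t b = (SOME \<eta>. \<exists>n f g. coprod_decomp (Oq_gen q) b n f g \<and>
     \<eta> = (\<Oplus>\<^bsub>\<Omega>P\<^esub>i\<in>{..<n}. coact_term t (f i) (conv (g i) (inv_wt_elem t))))"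

lemma decomp_ev:
  assumes "coprod_decomp (Oq_gen q) b n f g"
  shows "i < n \<Longrightarrow> f i \<in> Oq_gen q \<and> g i \<in> Oq_gen q" "ev b (v @ w) = (\<Sum>i<n. ev (f i) v * ev (g i) w)"
proof -
  show "i < n \<Longrightarrow> f i \<in> Oq_gen q \<and> g i \<in> Oq_gen q" using assms by (simp add: coprod_decomp_def)
  have "b (wrd v * wrd w) = (\<Sum>i<n. f i (wrd v) * g i (wrd w))"
    using assms by (simp only: coprod_decomp_def)
  then show "ev b (v @ w) = (\<Sum>i<n. ev (f i) v * ev (g i) w)" by (simp add: ev_def wrd_append)
qed

lemma coact_decomp:
  assumes "b \<in> Oq_gen q"
  obtains n f g where "coprod_decomp (Oq_gen q) b n f g" "coact t b = (\<Oplus>\<^bsub>\<Omega>P\<^esub>i\<in>{..<n}. coact_term t (f i) (conv (g i) (inv_wt_elem t)))"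
proof -
  have "\<exists>n f g. coprod_decomp (Oq_gen q) b n f g \<and> coact t b = (\<Oplus>\<^bsub>\<Omega>P\<^esub>i\<in>{..<n}. coact_term t (f i) (conv (g i) (inv_wt_elem t)))"
    unfolding coact_def by (rule someI_ex) (use Oq_gen_decomp_ex[OF q assms] in blast)
  then show ?thesis using that by blast
qed

text \<open>Replaces calculations with tensors: a sum of terms is recognized from its values with
  the second leg on the torus, since \<open>coact_term\<close> is \<open>K_separated\<close>.
  Linearity and the covariance formula both follow from this criterion.\<close>

lemma coact_eqI:
  assumes b: "b \<in> Oq_gen q" and I: "finite I" and fg: "\<And>i. i \<in> I \<Longrightarrow> f i \<in> Oq_gen q \<and> g i \<in> Oq_gen q"
    and eq: "\<And>v ns. (\<Sum>i\<in>I. ev (f i) v * ev (g i) (kw ns)) = ev b (v @ kw ns) * ev (inv_wt_elem t) (kw ns)"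
  shows "(\<Oplus>\<^bsub>\<Omega>P\<^esub>i\<in>I. coact_term t (f i) (g i)) = coact t b"
proof -
  obtain n f' g' where d: "coprod_decomp (Oq_gen q) b n f' g'"
    and P: "coact t b = (\<Oplus>\<^bsub>\<Omega>P\<^esub>i\<in>{..<n}. coact_term t (f' i) (conv (g' i) (inv_wt_elem t)))" using b by (rule coact_decomp)
  show ?thesis
    unfolding P
  proof (rule K_separated_sum_eq[OF q cspace_OmegaP K_separated_coact_term I])
    show "f' j \<in> Oq_gen q \<and> conv (g' j) (inv_wt_elem t) \<in> Oq_gen q" if "j \<in> {..<n}" for j
      using decomp_ev(1)[OF d] that inv_wt_elem(1)[of t] by (auto intro: Oq_gen_conv)
    show "(\<Sum>i\<in>I. ev (f i) v * ev (g i) (kw ns)) = (\<Sum>j<n. ev (f' j) v * ev (conv (g' j) (inv_wt_elem t)) (kw ns))" for v ns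
      unfolding eq decomp_ev(2)[OF d] by (simp add: convw_kw sum_distrib_right mult.assoc)
  qed (use fg in auto)
qed

lemma linear_coact: "linear_map (A_space q) \<Omega>P (coact t)"
  unfolding linear_map_def
proof (intro conjI funcsetI ballI allI)
  interpret W: module complex_field \<Omega>P by (rule cspace_OmegaP)
  have Gb: "bilinear_map (A_space q) (A_space q) \<Omega>P (coact_term t)" using K_separated_coact_term by (simp add: K_separated_def[OF q])
  note g = bilinear_mapD[OF Gb, simplified]
  fix b assume "b \<in> carrier (A_space q)"
  then have b: "b \<in> Oq_gen q" by simp
  obtain n f h where d: "coprod_decomp (Oq_gen q) b n f h"
    and P: "coact t b = (\<Oplus>\<^bsub>\<Omega>P\<^esub>i\<in>{..<n}. coact_term t (f i) (conv (h i) (inv_wt_elem t)))" using b by (rule coact_decomp)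
  have G1: "coact_term t (f i) (conv (h i) (inv_wt_elem t)) \<in> carrier \<Omega>P" if "i < n" for i
    using decomp_ev(1)[OF d that] inv_wt_elem(1)[of t] by (intro g(1)) (auto intro: Oq_gen_conv)
  then show "coact t b \<in> carrier \<Omega>P" unfolding P by (intro W.finsum_closed) auto
  show "coact t (c \<odot>\<^bsub>A_space q\<^esub> b) = c \<odot>\<^bsub>\<Omega>P\<^esub> coact t b" for c
  proof -
    have "c \<odot>\<^bsub>\<Omega>P\<^esub> coact t b = (\<Oplus>\<^bsub>\<Omega>P\<^esub>i\<in>{..<n}. c \<odot>\<^bsub>\<Omega>P\<^esub> coact_term t (f i) (conv (h i) (inv_wt_elem t)))"
      unfolding P using G1 by (intro W.finsum_smult_ldistr) auto
    also have "\<dots> = (\<Oplus>\<^bsub>\<Omega>P\<^esub>i\<in>{..<n}. coact_term t (\<lambda>x. c * f i x) (conv (h i) (inv_wt_elem t)))"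
      using decomp_ev(1)[OF d] inv_wt_elem(1)[of t]
      by (intro W.finsum_cong' refl g(4)[symmetric]) (auto intro!: Oq_gen_conv Oq_gen_cmult g(1))
    also have "\<dots> = coact t (\<lambda>x. c * b x)"
      using decomp_ev[OF d] inv_wt_elem(1)[of t] b
      by (intro coact_eqI Oq_gen_cmult) (auto intro!: Oq_gen_conv Oq_gen_cmult simp: convw_kw sum_distrib_left sum_distrib_right mult.assoc)
    finally show ?thesis by simp
  qed
  fix b' assume "b' \<in> carrier (A_space q)"
  then have b': "b' \<in> Oq_gen q" by simp
  obtain n' f' h' where d': "coprod_decomp (Oq_gen q) b' n' f' h'"
    and P': "coact t b' = (\<Oplus>\<^bsub>\<Omega>P\<^esub>i\<in>{..<n'}. coact_term t (f' i) (conv (h' i) (inv_wt_elem t)))" using b' by (rule coact_decomp)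
  have G2: "coact_term t (f' i) (conv (h' i) (inv_wt_elem t)) \<in> carrier \<Omega>P" if "i < n'" for i
    using decomp_ev(1)[OF d' that] inv_wt_elem(1)[of t] by (intro g(1)) (auto intro: Oq_gen_conv)
  \<comment> \<open>The decompositions of \<open>b\<close> and \<open>b'\<close>, taken over the
    disjoint union of their index sets, decompose the sum.\<close>
  let ?f = "case_sum f f'" and ?h = "case_sum (\<lambda>i. conv (h i) (inv_wt_elem t)) (\<lambda>i. conv (h' i) (inv_wt_elem t))"
  have "coact t b \<oplus>\<^bsub>\<Omega>P\<^esub> coact t b' = (\<Oplus>\<^bsub>\<Omega>P\<^esub>k\<in>{..<n} <+> {..<n'}.
      case_sum (\<lambda>i. coact_term t (f i) (conv (h i) (inv_wt_elem t))) (\<lambda>i. coact_term t (f' i) (conv (h' i) (inv_wt_elem t))) k)"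
    unfolding P P' using G1 G2 by (intro W.finsum_Plus[symmetric]) auto
  also have "\<dots> = (\<Oplus>\<^bsub>\<Omega>P\<^esub>k\<in>{..<n} <+> {..<n'}. coact_term t (?f k) (?h k))"
    using G1 G2 by (intro W.finsum_cong' refl) auto
  also have "\<dots> = coact t (\<lambda>x. b x + b' x)"
  proof (rule coact_eqI)
    show "?f k \<in> Oq_gen q \<and> ?h k \<in> Oq_gen q" if "k \<in> {..<n} <+> {..<n'}" for k
      using that decomp_ev(1)[OF d] decomp_ev(1)[OF d'] inv_wt_elem(1)[of t] by (auto intro!: Oq_gen_conv)
    show "(\<Sum>k\<in>{..<n} <+> {..<n'}. ev (?f k) v * ev (?h k) (kw ns)) = ev (\<lambda>x. b x + b' x) (v @ kw ns) * ev (inv_wt_elem t) (kw ns)" for v ns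
      by (simp add: sum.Plus decomp_ev(2)[OF d] decomp_ev(2)[OF d'] convw_kw sum_distrib_right mult.assoc distrib_right)
  qed (use b b' Oq_gen_plus in auto)
  finally show "coact t (b \<oplus>\<^bsub>A_space q\<^esub> b') = coact t b \<oplus>\<^bsub>\<Omega>P\<^esub> coact t b'" by simp
qed


section \<open>The differential in the dual basis\<close>

lemma finsum_pairs:
  assumes W: "cspace W" and f: "\<And>t. f t \<in> carrier W"
  shows "(\<Oplus>\<^bsub>W\<^esub>\<gamma>\<in>UNIV. f (\<gamma>, True) \<oplus>\<^bsub>W\<^esub> f (\<gamma>, False)) = (\<Oplus>\<^bsub>W\<^esub>t\<in>(UNIV :: (posroot \<times> bool) set). f t)"
proof -
  interpret W: module complex_field W by (rule W)
  have fin: "finite (UNIV :: posroot set)" by (simp add: UNIV_posroot)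
  have "(\<Oplus>\<^bsub>W\<^esub>\<gamma>\<in>UNIV. f (\<gamma>, True) \<oplus>\<^bsub>W\<^esub> f (\<gamma>, False)) = (\<Oplus>\<^bsub>W\<^esub>\<gamma>\<in>UNIV. \<Oplus>\<^bsub>W\<^esub>b\<in>{True, False}. f (\<gamma>, b))"
    using f by (intro W.finsum_cong' refl) auto
  also have "\<dots> = (\<Oplus>\<^bsub>W\<^esub>t\<in>UNIV \<times> {True, False}. f (fst t, snd t))"
    using f fin by (intro W.finsum_Times) auto
  also have "UNIV \<times> {True, False} = (UNIV :: (posroot \<times> bool) set)" by auto
  finally show ?thesis by simp
qed

lemma finite_UNIV_index: "finite (UNIV :: (posroot \<times> bool) set)"
  by (simp add: finite_prod UNIV_posroot flip: UNIV_Times_UNIV)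

lemma form_tensor_closed: "a \<in> Oq_gen q \<Longrightarrow> form_tensor q a (dual_form t) \<in> carrier \<Omega>"
  using bilinear_mapD(1)[OF bilinear_form_tensor _ dual_form_closed] by simp

lemma diff_eq:
  assumes "a \<in> Oq_gen q"
  shows "Omega1_diff q a = (\<Oplus>\<^bsub>\<Omega>\<^esub>t\<in>UNIV. form_tensor q (act (tangent_vec q t) a) (dual_form t))"
  using finsum_pairs[OF cspace_Omega, of "\<lambda>t. form_tensor q (act (tangent_vec q t) a) (dual_form t)"]
    form_tensor_closed[OF Oq_gen_act[OF assms]]
  unfolding Omega1_diff_def by (simp add: tangent_vec_def dual_form_def)

lemma bilinear_lact:
  assumes a: "a \<in> Oq_gen q"
  shows "bilinear_map (A_space q) (Lambda1 q) \<Omega> (\<lambda>b v. form_tensor q (conv a b) v)"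
proof (rule bilinear_mapI)
  note f = bilinear_mapD[OF bilinear_form_tensor]
  have c: "conv a (\<lambda>x. b x + b' x) = (\<lambda>x. conv a b x + conv a b' x)" "conv a (\<lambda>x. c * b x) = (\<lambda>x. c * conv a b x)"
    if "b \<in> Oq_gen q" "b' \<in> Oq_gen q" for b b' c
    by (rule lin_ext; simp add: lin_plus lin_cmult convw_add_right convw_cmult_right)+
  show "form_tensor q (conv a b) v \<in> carrier \<Omega>" if "b \<in> carrier (A_space q)" "v \<in> carrier (Lambda1 q)" for b v
    using that a by (intro f(1)) (auto intro: Oq_gen_conv)
  show "form_tensor q (conv a (b \<oplus>\<^bsub>A_space q\<^esub> b')) v = form_tensor q (conv a b) v \<oplus>\<^bsub>\<Omega>\<^esub> form_tensor q (conv a b') v"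
    if "b \<in> carrier (A_space q)" "b' \<in> carrier (A_space q)" "v \<in> carrier (Lambda1 q)" for b b' v
    using that a f(2)[of "conv a b" v "conv a b'"] by (simp add: c Oq_gen_conv)
  show "form_tensor q (conv a b) (v \<oplus>\<^bsub>Lambda1 q\<^esub> v') = form_tensor q (conv a b) v \<oplus>\<^bsub>\<Omega>\<^esub> form_tensor q (conv a b) v'"
    if "b \<in> carrier (A_space q)" "v \<in> carrier (Lambda1 q)" "v' \<in> carrier (Lambda1 q)" for b v v'
    using that a by (intro f(3)) (auto intro: Oq_gen_conv)
  show "form_tensor q (conv a (c \<odot>\<^bsub>A_space q\<^esub> b)) v = c \<odot>\<^bsub>\<Omega>\<^esub> form_tensor q (conv a b) v"
    if "b \<in> carrier (A_space q)" "v \<in> carrier (Lambda1 q)" for c b v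
    using that a f(4)[of "conv a b" v c] by (simp add: c Oq_gen_conv)
  show "form_tensor q (conv a b) (c \<odot>\<^bsub>Lambda1 q\<^esub> v) = c \<odot>\<^bsub>\<Omega>\<^esub> form_tensor q (conv a b) v"
    if "b \<in> carrier (A_space q)" "v \<in> carrier (Lambda1 q)" for c b v
    using that a by (intro f(5)) (auto intro: Oq_gen_conv)
qed

lemma lact_diff:
  assumes a: "a \<in> Oq_gen q" and b: "b \<in> Oq_gen q"
  shows "Omega1_lact q a (Omega1_diff q b) = (\<Oplus>\<^bsub>\<Omega>\<^esub>t\<in>UNIV. form_tensor q (conv a (act (tangent_vec q t) b)) (dual_form t))"
proof -
  interpret W: module complex_field \<Omega> by (rule cspace_Omega)
  note B = cspace_A_space[OF q] cspace_Lambda1 cspace_Omega bilinear_lact[OF a]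
  have "Omega1_lact q a (Omega1_diff q b)
      = (\<Oplus>\<^bsub>\<Omega>\<^esub>t\<in>UNIV. Omega1_lact q a (form_tensor q (act (tangent_vec q t) b) (dual_form t)))"
    unfolding diff_eq[OF b] Omega1_lact_def using form_tensor_closed[OF Oq_gen_act[OF b]]
    by (intro linear_map_finsum[OF cspace_Omega cspace_Omega] linear_tensor_lift[OF B, folded Omega1_space_def]) auto
  also have "\<dots> = (\<Oplus>\<^bsub>\<Omega>\<^esub>t\<in>UNIV. form_tensor q (conv a (act (tangent_vec q t) b)) (dual_form t))"
    unfolding Omega1_lact_def using Oq_gen_act[OF b] dual_form_closed form_tensor_closed Oq_gen_conv[OF a]
    by (intro W.finsum_cong' refl tensor_lift_ptensor[OF B]) auto
  finally show ?thesis .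
qed

text \<open>By \<open>coact_eqI\<close> the second leg is tested on the torus. There both sides
  differ only in the order of the tangent vector and the torus element inside \<open>a\<close>;
  exchanging them costs the character of the tangent vector, which \<open>inv_wt_elem\<close>
  cancels.\<close>

lemma coact_term_sum:
  assumes a': "a' \<in> Oq_gen q" and a: "a \<in> Oq_gen q"
    and d': "coprod_decomp (Oq_gen q) a' n f g" and d: "coprod_decomp (Oq_gen q) a m h k"
  shows "(\<Oplus>\<^bsub>\<Omega>P\<^esub>i\<in>{..<n}. \<Oplus>\<^bsub>\<Omega>P\<^esub>j\<in>{..<m}. coact_term t (conv (f i) (act (tangent_vec q t) (h j))) (conv (g i) (k j)))
    = coact t (conv a' (act (tangent_vec q t) a))"
proof -
  interpret W: module complex_field \<Omega>P by (rule cspace_OmegaP)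
  let ?X = "tangent_vec q t"
  have Gb: "bilinear_map (A_space q) (A_space q) \<Omega>P (coact_term t)" using K_separated_coact_term by (simp add: K_separated_def[OF q])
  note coact_term = bilinear_mapD(1)[OF Gb, simplified]
  note D = decomp_ev(1)[OF d] decomp_ev(1)[OF d']
  have mem: "conv (f i) (act ?X (h j)) \<in> Oq_gen q" "conv (g i) (k j) \<in> Oq_gen q" if "i < n" "j < m" for i j
    using D that by (auto intro!: Oq_gen_conv Oq_gen_act)
  have "(\<Oplus>\<^bsub>\<Omega>P\<^esub>i\<in>{..<n}. \<Oplus>\<^bsub>\<Omega>P\<^esub>j\<in>{..<m}. coact_term t (conv (f i) (act ?X (h j))) (conv (g i) (k j)))
      = (\<Oplus>\<^bsub>\<Omega>P\<^esub>z\<in>{..<n} \<times> {..<m}. coact_term t (conv (f (fst z)) (act ?X (h (snd z)))) (conv (g (fst z)) (k (snd z))))"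
    using mem coact_term by (intro W.finsum_Times) auto
  also have "\<dots> = coact t (conv a' (act ?X a))"
  proof (rule coact_eqI)
    fix v ns
    \<comment> \<open>The value at s K is a(s K X). Moving K to the right of X gives the character
      times a(s X K), and this splits with s X in the first leg and K in the second.\<close>
    have actk: "ev (act ?X a) (s @ kw ns) = prod_list (map (tangent_wt q t) ns) * (\<Sum>j<m. ev (k j) (kw ns) * ev (act ?X (h j)) s)" for s
    proof -
      have "ev (act ?X a) (s @ kw ns) = a (wrd s * wrd (kw ns) * ?X)"
        by (simp add: ev_def act_def wrd_append)
      also have "\<dots> = prod_list (map (tangent_wt q t) ns) * a ((wrd s * ?X) * wrd (kw ns))"
        using has_wt_tangent_vec[OF q, of t] a unfolding has_wt_def by blast
      also have "a ((wrd s * ?X) * wrd (kw ns)) = (\<Sum>j<m. ev (k j) (kw ns) * ev (act ?X (h j)) s)"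
        using d by (simp add: coprod_decomp_def ev_def act_def mult.commute)
      finally show ?thesis .
    qed
    have a'k: "ev a' (s @ kw ns) = (\<Sum>i<n. ev (g i) (kw ns) * ev (f i) s)" for s
      by (simp add: decomp_ev(2)[OF d'] mult.commute)
    have "(\<Sum>z\<in>{..<n} \<times> {..<m}. ev (conv (f (fst z)) (act ?X (h (snd z)))) v * ev (conv (g (fst z)) (k (snd z))) (kw ns))
        = (\<Sum>i<n. \<Sum>j<m. ev (g i) (kw ns) * (ev (k j) (kw ns) * convw (ev (f i)) (ev (act ?X (h j))) v))"
      by (simp add: sum.cartesian_product case_prod_unfold convw_kw mult_ac)
    also have "\<dots> = convw (\<lambda>s. \<Sum>i<n. ev (g i) (kw ns) * ev (f i) s) (\<lambda>s. \<Sum>j<m. ev (k j) (kw ns) * ev (act ?X (h j)) s) v"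
      by (simp add: convw_sum_left convw_sum_right convw_cmult_left convw_cmult_right sum_distrib_left)
    \<comment> \<open>Inserts the factor 1, as the product of the character of the tangent vector
      and \<open>inv_wt_elem\<close> on the torus.\<close>
    also have "\<dots> = ev (inv_wt_elem t) (kw ns) * (prod_list (map (tangent_wt q t) ns) * convw (\<lambda>s. \<Sum>i<n. ev (g i) (kw ns) * ev (f i) s) (\<lambda>s. \<Sum>j<m. ev (k j) (kw ns) * ev (act ?X (h j)) s) v)"
      using inv_wt_elem(2)[of t ns] by (simp add: mult.assoc[symmetric] mult.commute)
    also have "\<dots> = ev (conv a' (act ?X a)) (v @ kw ns) * ev (inv_wt_elem t) (kw ns)"
      unfolding ev_conv convw_append_kw actk a'k convw_cmult_right by simp
    finally show "(\<Sum>z\<in>{..<n} \<times> {..<m}. ev (conv (f (fst z)) (act ?X (h (snd z)))) v * ev (conv (g (fst z)) (k (snd z))) (kw ns))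
        = ev (conv a' (act ?X a)) (v @ kw ns) * ev (inv_wt_elem t) (kw ns)" .
  qed (use mem Oq_gen_conv[OF a' Oq_gen_act[OF a]] in auto)
  finally show ?thesis .
qed

text \<open>Extends the coaction from the dual basis to all of \<open>Lambda1\<close> through
  coordinates; being bilinear, it induces a map on the tensor product.\<close>

definition coact_pair :: "functional \<Rightarrow> functional set \<Rightarrow> (su3_form \<times> functional set \<Rightarrow>\<^sub>0 complex) set" where
  "coact_pair b v = (\<Oplus>\<^bsub>\<Omega>P\<^esub>t\<in>UNIV. coord t v \<odot>\<^bsub>\<Omega>P\<^esub> coact t b)"

lemma bilinear_coact_pair: "bilinear_map (A_space q) (Lambda1 q) \<Omega>P coact_pair"
proof (rule bilinear_mapI)
  interpret W: module complex_field \<Omega>P by (rule cspace_OmegaP)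
  note p = linear_mapD[OF linear_coact]
  note w = cspaceD[OF cspace_OmegaP]
  note fin = finite_UNIV_index
  show "coact_pair b v \<in> carrier \<Omega>P" if "b \<in> carrier (A_space q)" for b v
    unfolding coact_pair_def using p(1)[OF that] w(1) by (intro W.finsum_closed) auto
  show "coact_pair (b \<oplus>\<^bsub>A_space q\<^esub> b') v = coact_pair b v \<oplus>\<^bsub>\<Omega>P\<^esub> coact_pair b' v"
    if "b \<in> carrier (A_space q)" "b' \<in> carrier (A_space q)" for b b' v
    unfolding coact_pair_def using p(1)[OF that(1)] p(1)[OF that(2)] w(1)
    by (subst W.finsum_addf[symmetric]) (auto intro!: W.finsum_cong' simp only: p(2)[OF that] w(3))
  show "coact_pair b (v \<oplus>\<^bsub>Lambda1 q\<^esub> v') = coact_pair b v \<oplus>\<^bsub>\<Omega>P\<^esub> coact_pair b v'"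
    if "b \<in> carrier (A_space q)" "v \<in> carrier (Lambda1 q)" "v' \<in> carrier (Lambda1 q)" for b v v'
    unfolding coact_pair_def using p(1)[OF that(1)] w(1)
    by (subst W.finsum_addf[symmetric]) (auto intro!: W.finsum_cong' simp only: coord_add[OF that(2,3)] w(2))
  show "coact_pair (c \<odot>\<^bsub>A_space q\<^esub> b) v = c \<odot>\<^bsub>\<Omega>P\<^esub> coact_pair b v" if "b \<in> carrier (A_space q)" for c b v
  proof -
    have "coord t v \<odot>\<^bsub>\<Omega>P\<^esub> coact t (c \<odot>\<^bsub>A_space q\<^esub> b) = c \<odot>\<^bsub>\<Omega>P\<^esub> (coord t v \<odot>\<^bsub>\<Omega>P\<^esub> coact t b)" for t
      unfolding p(3)[OF that] w(4)[OF p(1)[OF that], symmetric] by (simp only: mult.commute)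
    then show ?thesis
      unfolding coact_pair_def using p(1)[OF that(1)] w(1) fin by (subst W.finsum_smult_ldistr) auto
  qed
  show "coact_pair b (c \<odot>\<^bsub>Lambda1 q\<^esub> v) = c \<odot>\<^bsub>\<Omega>P\<^esub> coact_pair b v"
    if "b \<in> carrier (A_space q)" "v \<in> carrier (Lambda1 q)" for c b v
    unfolding coact_pair_def using p(1)[OF that(1)] w(1) fin
    by (subst W.finsum_smult_ldistr) (auto intro!: W.finsum_cong' simp: coord_smult[OF that(2)] w(4))
qed

lemma coact_pair_tform:
  assumes "b \<in> Oq_gen q"
  shows "coact_pair b (dual_form t) = coact t b"
proof -
  interpret W: module complex_field \<Omega>P by (rule cspace_OmegaP)
  have p: "coact s b \<in> carrier \<Omega>P" for s using linear_mapD(1)[OF linear_coact] assms by simp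
  have "coact_pair b (dual_form t) = (\<Oplus>\<^bsub>\<Omega>P\<^esub>s\<in>UNIV. if t = s then coact s b else \<zero>\<^bsub>\<Omega>P\<^esub>)"
    unfolding coact_pair_def using p cspaceD(5,6)[OF cspace_OmegaP p]
    by (intro W.finsum_cong' refl) (auto simp: coord_dual_form)
  also have "\<dots> = coact t b" using p by (intro W.finsum_singleton finite_UNIV_index) auto
  finally show ?thesis .
qed

text \<open>The map is linear as a lift of a bilinear one. On \<open>a' da\<close> it decomposes
  along the six tangent vectors, and \<open>coact_term_sum\<close> treats each of them for arbitrary
  coproduct decompositions.\<close>

lemma right_covariant_Omega1: "right_covariant (A_space q) (Oq_F3 q) (Omega1_q_SU3 q)"
proof -
  interpret W: module complex_field \<Omega>P by (rule cspace_OmegaP)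
  let ?\<Phi> = "tensor_lift \<Omega>P coact_pair"
  note B = cspace_A_space[OF q] cspace_Lambda1 cspace_OmegaP bilinear_coact_pair
  have lin\<Phi>: "linear_map \<Omega> \<Omega>P ?\<Phi>"
    unfolding Omega1_space_def by (rule linear_tensor_lift[OF B, unfolded Omega1_space_def])
  moreover have "?\<Phi> (Omega1_lact q a' (Omega1_diff q a)) =
      (\<Oplus>\<^bsub>\<Omega>P\<^esub>i\<in>{..<n}. \<Oplus>\<^bsub>\<Omega>P\<^esub>j\<in>{..<m}. ptensor \<Omega> piA (Omega1_lact q (f i) (Omega1_diff q (h j))) (\<pi> (conv (g i) (k j))))"
    if a': "a' \<in> Oq_gen q" and a: "a \<in> Oq_gen q" and d': "coprod_decomp (Oq_gen q) a' n f g"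
      and d: "coprod_decomp (Oq_gen q) a m h k" for a' a n f g m h k
  proof -
    note D = decomp_ev(1)[OF d] decomp_ev(1)[OF d']
    have Gb: "bilinear_map (A_space q) (A_space q) \<Omega>P (coact_term t)" for t using K_separated_coact_term by (simp add: K_separated_def[OF q])
    have Gc: "coact_term t (conv (f i) (act (tangent_vec q t) (h j))) (conv (g i) (k j)) \<in> carrier \<Omega>P" if "i < n" "j < m" for t i j
      using D that by (intro bilinear_mapD(1)[OF Gb]) (auto intro!: Oq_gen_conv Oq_gen_act)
    have Pc: "coact t (conv a' (act (tangent_vec q t) a)) \<in> carrier \<Omega>P" for t
      using linear_mapD(1)[OF linear_coact] Oq_gen_conv[OF a' Oq_gen_act[OF a]] by simp
    have "?\<Phi> (Omega1_lact q a' (Omega1_diff q a))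
        = (\<Oplus>\<^bsub>\<Omega>P\<^esub>t\<in>UNIV. ?\<Phi> (form_tensor q (conv a' (act (tangent_vec q t) a)) (dual_form t)))"
      unfolding lact_diff[OF a' a] using form_tensor_closed[OF Oq_gen_conv[OF a' Oq_gen_act[OF a]]]
      by (intro linear_map_finsum[OF cspace_Omega cspace_OmegaP lin\<Phi>]) auto
    also have "\<dots> = (\<Oplus>\<^bsub>\<Omega>P\<^esub>t\<in>UNIV. coact t (conv a' (act (tangent_vec q t) a)))"
    proof (intro W.finsum_cong' refl)
      fix t
      have "?\<Phi> (form_tensor q (conv a' (act (tangent_vec q t) a)) (dual_form t)) = coact_pair (conv a' (act (tangent_vec q t) a)) (dual_form t)"
        using Oq_gen_conv[OF a' Oq_gen_act[OF a]] dual_form_closed by (intro tensor_lift_ptensor[OF B]) auto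
      then show "?\<Phi> (form_tensor q (conv a' (act (tangent_vec q t) a)) (dual_form t)) = coact t (conv a' (act (tangent_vec q t) a))"
        using coact_pair_tform[OF Oq_gen_conv[OF a' Oq_gen_act[OF a]]] by simp
    qed (use Pc in auto)
    also have "\<dots> = (\<Oplus>\<^bsub>\<Omega>P\<^esub>t\<in>UNIV. \<Oplus>\<^bsub>\<Omega>P\<^esub>i\<in>{..<n}. \<Oplus>\<^bsub>\<Omega>P\<^esub>j\<in>{..<m}. coact_term t (conv (f i) (act (tangent_vec q t) (h j))) (conv (g i) (k j)))"
      by (simp only: coact_term_sum[OF a' a d' d])
    \<comment> \<open>The sum over tangent vectors is moved innermost, where it reassembles the form
      \<open>f i\<close> times the differential of \<open>h j\<close> for each pair of
      summands.\<close>
    also have "\<dots> = (\<Oplus>\<^bsub>\<Omega>P\<^esub>i\<in>{..<n}. \<Oplus>\<^bsub>\<Omega>P\<^esub>t\<in>UNIV. \<Oplus>\<^bsub>\<Omega>P\<^esub>j\<in>{..<m}. coact_term t (conv (f i) (act (tangent_vec q t) (h j))) (conv (g i) (k j)))"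
      using Gc by (intro W.finsum_swap finite_UNIV_index) (auto intro!: W.finsum_closed)
    also have "\<dots> = (\<Oplus>\<^bsub>\<Omega>P\<^esub>i\<in>{..<n}. \<Oplus>\<^bsub>\<Omega>P\<^esub>j\<in>{..<m}. \<Oplus>\<^bsub>\<Omega>P\<^esub>t\<in>UNIV. coact_term t (conv (f i) (act (tangent_vec q t) (h j))) (conv (g i) (k j)))"
      using Gc by (intro W.finsum_cong' refl W.finsum_swap finite_UNIV_index) (auto intro!: W.finsum_closed)
    also have "\<dots> = (\<Oplus>\<^bsub>\<Omega>P\<^esub>i\<in>{..<n}. \<Oplus>\<^bsub>\<Omega>P\<^esub>j\<in>{..<m}. ptensor \<Omega> piA (Omega1_lact q (f i) (Omega1_diff q (h j))) (\<pi> (conv (g i) (k j))))"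
    proof -
      have "(\<Oplus>\<^bsub>\<Omega>P\<^esub>t\<in>UNIV. coact_term t (conv (f i) (act (tangent_vec q t) (h j))) (conv (g i) (k j)))
          = ptensor \<Omega> piA (Omega1_lact q (f i) (Omega1_diff q (h j))) (\<pi> (conv (g i) (k j)))" if ij: "i < n" "j < m" for i j
      proof -
        have m: "f i \<in> Oq_gen q" "g i \<in> Oq_gen q" "h j \<in> Oq_gen q" "k j \<in> Oq_gen q" using D ij by auto
        show ?thesis
          unfolding coact_term_def lact_diff[OF m(1,3)]
          using form_tensor_closed[OF Oq_gen_conv[OF m(1) Oq_gen_act[OF m(3)]]] linear_mapD(1)[OF linear_proj] Oq_gen_conv[OF m(2,4)]
          by (intro bilinear_map_sum_left[OF cspace_Omega cspace_piA cspace_OmegaP bilinear_ptensor_OmegaP, symmetric]) auto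
      qed
      moreover have "(\<Oplus>\<^bsub>\<Omega>P\<^esub>t\<in>UNIV. coact_term t (conv (f i) (act (tangent_vec q t) (h j))) (conv (g i) (k j))) \<in> carrier \<Omega>P" if "i < n" "j < m" for i j
        using Gc[OF that] by (auto intro!: W.finsum_closed)
      ultimately show ?thesis
        by (intro W.finsum_cong' refl) (auto intro!: W.finsum_closed)
    qed
    finally show ?thesis .
  qed
  ultimately show ?thesis
    unfolding right_covariant_def Let_def Omega1_q_SU3_def by (intro exI[of _ ?\<Phi>]) simp
qed

end

theorem proposition3p3:
  fixes q :: real
  assumes "q \<notin> {-1, 0, 1}"
  shows "quantum_principal_bundle (Oq_SU3_algebra q) (Oq_F3 q) (Omega1_q_SU3 q)"
  unfolding quantum_principal_bundle_def by (rule right_covariant_Omega1[OF assms])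

end
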